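(* Let $a,b\in\mathbb{Z}\setminus\{0\}$ and let $S(t)$ be the linear propagator on $\mathbb{T}^2=(\mathbb{R}/2\pi\mathbb{Z})^2$ with $\widehat{S(t)\phi}(k)=e^{-it(ak_1^2+bk_2^2)}\widehat\phi(k)$, $k\in\mathbb{Z}^2$. There exist $c=c(a,b)>0$ and $K=K(a,b)>0$ such that, for every dyadic $N\ge2$ and every $\phi\in L^2(\mathbb{T}^2)$, $$\|S(t)P_{\le N}\phi\|_{L^4([0,T_N]\times\mathbb{T}^2)}\le K\|\phi\|_{L^2(\mathbb{T}^2)},$$ where $$T_N=\begin{cases} cN^{-1}, & -ab\text{ is a square (i.e. } -ab=h^2 \text{ for some } h\in\mathbb{Z}),\\ c(\log N)^{-1}, & -ab \text{ is not a square.}\end{cases}$$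
   Context: Fourier convention on $\mathbb{T}^2=(\mathbb{R}/2\pi\mathbb{Z})^2$: $f(x)=\sum_{k\in\mathbb{Z}^2}\widehat f(k)e^{ik\cdot x}$, $\widehat f(k)=(2\pi)^{-2}\int_{\mathbb{T}^2}f(x)e^{-ik\cdot x}\,dx$. $P_{\le N}$ is the sharp Fourier projection onto frequencies in $[-N,N]^2\cap\mathbb{Z}^2$. Dyadic numbers are those of the form $2^j$, $j\in\mathbb{Z}_{\ge0}$. *)

theory Defs
  imports "HOL-Analysis.Analysis"
begin

definition in_Lp :: "real \<Rightarrow> 'a measure \<Rightarrow> ('a \<Rightarrow> complex) \<Rightarrow> bool"
  where "in_Lp p M f \<longleftrightarrow> f \<in> borel_measurable M \<and> integrable M (\<lambda>x. norm (f x) powr p)"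

(* Meaningful for functions with in_Lp p M f only: the Bochner integral of a
   non-integrable function is 0. *)
definition Lp_norm :: "real \<Rightarrow> 'a measure \<Rightarrow> ('a \<Rightarrow> complex) \<Rightarrow> real"
  where "Lp_norm p M f = (LINT x|M. norm (f x) powr p) powr (1 / p)"

(* Functions on the torus (R/2 pi Z)^2 are represented by their restrictions to the
   fundamental domain [0, 2 pi)^2; the measure is not normalised. *)
definition torus_domain :: "(real \<times> real) set"
  where "torus_domain = {0..<2 * pi} \<times> {0..<2 * pi}"

definition torus :: "(real \<times> real) measure"
  where "torus = lebesgue_on torus_domain"

definition time_torus :: "real \<Rightarrow> (real \<times> (real \<times> real)) measure"
  where "time_torus T = lebesgue_on ({0..T} \<times> torus_domain)"

definition fourier_char :: "int \<times> int \<Rightarrow> real \<times> real \<Rightarrow> complex"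
  where "fourier_char k x = cis (real_of_int (fst k) * fst x + real_of_int (snd k) * snd x)"

definition fourier_coeff :: "(real \<times> real \<Rightarrow> complex) \<Rightarrow> int \<times> int \<Rightarrow> complex"
  where "fourier_coeff f k = (LINT x|torus. f x * cnj (fourier_char k x)) / (2 * pi)\<^sup>2"

definition freq_box :: "nat \<Rightarrow> (int \<times> int) set"
  where "freq_box N = {- int N..int N} \<times> {- int N..int N}"

definition sharp_proj :: "nat \<Rightarrow> (real \<times> real \<Rightarrow> complex) \<Rightarrow> real \<times> real \<Rightarrow> complex"
  where "sharp_proj N f x = (\<Sum>k\<in>freq_box N. fourier_coeff f k * fourier_char k x)"

(* The Fourier series with coefficients exp (- i t (a k1^2 + b k2^2)) * fourier_coeff f k,
   as the pointwise limit of its square partial sums.  For square-integrable f this limit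
   exists almost everywhere and represents the L^2 sum (Carleson, Fefferman); for
   trigonometric polynomials the partial sums are eventually constant, see
   propagator_sharp_proj below. *)
definition propagator ::
    "int \<Rightarrow> int \<Rightarrow> real \<Rightarrow> (real \<times> real \<Rightarrow> complex) \<Rightarrow> real \<times> real \<Rightarrow> complex"
  where "propagator a b t f x =
    lim (\<lambda>M. \<Sum>k\<in>freq_box M.
      cis (- t * real_of_int (a * (fst k)\<^sup>2 + b * (snd k)\<^sup>2)) * fourier_coeff f k * fourier_char k x)"

definition dyadic :: "nat \<Rightarrow> bool"
  where "dyadic N \<longleftrightarrow> (\<exists>j. N = 2 ^ j)"

definition time_scale :: "int \<Rightarrow> int \<Rightarrow> real \<Rightarrow> nat \<Rightarrow> real"
  where "time_scale a b c N =
    (if \<exists>h::int. - (a * b) = h\<^sup>2 then c / real N else c / ln (real N))"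

lemma finite_freq_box [simp]: "finite (freq_box N)"
  by (simp add: freq_box_def)

lemma integrable_cis_interval:
  "integrable lborel (\<lambda>x. indicator {0..<2 * pi} x *\<^sub>R cis (real_of_int m * x))"
proof -
  have "continuous_on {0..2 * pi} (\<lambda>x. cis (real_of_int m * x))"
    by (intro continuous_intros)
  then have "set_integrable lborel {0..2 * pi} (\<lambda>x. cis (real_of_int m * x))"
    by (rule borel_integrable_atLeastAtMost')
  then have "set_integrable lborel {0..<2 * pi} (\<lambda>x. cis (real_of_int m * x))"
    by (rule set_integrable_subset) auto
  then show ?thesis
    by (simp add: set_integrable_def)
qed

lemma integral_cis_interval:
  "(LINT x|lborel. indicator {0..<2 * pi} x *\<^sub>R cis (real_of_int m * x)) =
    (if m = 0 then 2 * pi else 0)"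
proof -
  have ae: "AE x in lborel. indicator {0..<2 * pi} x *\<^sub>R cis (real_of_int m * x) =
      indicator {0..2 * pi} x *\<^sub>R cis (real_of_int m * x)"
    using AE_lborel_singleton[of "2 * pi"] by eventually_elim (auto simp: indicator_def)
  have "(LINT x|lborel. indicator {0..<2 * pi} x *\<^sub>R cis (real_of_int m * x)) =
      (LINT x|lborel. indicator {0..2 * pi} x *\<^sub>R cis (real_of_int m * x))"
    by (rule integral_cong_AE[OF _ _ ae])
       (intro borel_measurable_scaleR borel_measurable_indicator
          borel_measurable_continuous_onI continuous_intros; simp)+
  also have "\<dots> = (if m = 0 then 2 * pi else 0)"
  proof (cases "m = 0")
    case True
    have "(LINT x|lborel. indicator {0..2 * pi} x *\<^sub>R (1::complex)) = complex_of_real (2 * pi)"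
      by (simp add: scaleR_conv_of_real)
    with True show ?thesis by simp
  next
    case False
    define F where "F x = cis (real_of_int m * x) / (\<i> * of_int m)" for x
    have "(LINT x|lborel. indicator {0..2 * pi} x *\<^sub>R cis (real_of_int m * x)) = F (2 * pi) - F 0"
    proof (rule integral_FTC_Icc)
      show "(F has_vector_derivative cis (real_of_int m * x)) (at x within {0..2 * pi})" for x
        unfolding F_def cis_conv_exp using False
        by (auto intro!: derivative_eq_intros has_vector_derivative_real_field
              simp: has_vector_derivative_complex_iff field_simps)
    qed (auto intro!: continuous_intros)
    also have "\<dots> = 0"
      using cis_multiple_2pi[of "real_of_int m"] by (simp add: F_def mult.commute mult.left_commute)
    finally show ?thesis using False by simp
  qed
  finally show ?thesis .
qed

lemma torus_domain_measurable [measurable]: "torus_domain \<in> sets borel"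
  unfolding torus_domain_def by (simp add: borel_Times)

lemma fourier_char_measurable: "fourier_char k \<in> borel_measurable borel"
  unfolding fourier_char_def
  by (intro borel_measurable_continuous_onI continuous_intros)

lemma integrable_torus_iff:
  fixes f :: "real \<times> real \<Rightarrow> complex"
  assumes "f \<in> borel_measurable borel"
  shows "integrable torus f \<longleftrightarrow> integrable lborel (\<lambda>x. indicator torus_domain x *\<^sub>R f x)"
  unfolding torus_def using assms
  by (subst integrable_restrict_space) (auto simp: integrable_completion)

lemma integral_torus:
  fixes f :: "real \<times> real \<Rightarrow> complex"
  assumes "f \<in> borel_measurable borel"
  shows "(LINT x|torus. f x) = (LINT x|lborel. indicator torus_domain x *\<^sub>R f x)"
  unfolding torus_def using assms
  by (subst integral_restrict_space) (auto simp: integral_completion)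

lemma fourier_char_torus:
  shows integrable_fourier_char: "integrable torus (fourier_char k)"
    and integral_fourier_char: "(LINT x|torus. fourier_char k x) = (if k = 0 then (2 * pi)\<^sup>2 else 0)"
proof -
  define g where "g m x = indicator {0..<2 * pi} x *\<^sub>R cis (real_of_int m * x)" for m x
  have eq: "indicator torus_domain x *\<^sub>R fourier_char k x = g (fst k) (fst x) * g (snd k) (snd x)" for x
    by (cases x) (auto simp: g_def torus_domain_def fourier_char_def indicator_def cis_mult)
  have g: "integrable lborel (g m)" for m
    unfolding g_def by (rule integrable_cis_interval)
  have int_g: "(LINT x|lborel. g m x) = (if m = 0 then 2 * pi else 0)" for m
    unfolding g_def by (rule integral_cis_interval)
  have int: "integrable (lborel \<Otimes>\<^sub>M lborel) (\<lambda>x. g (fst k) (fst x) * g (snd k) (snd x))"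
    using lborel_pair.Fubini_integrable[of "\<lambda>x. g (fst k) (fst x) * g (snd k) (snd x)"]
      borel_measurable_integrable[OF g] g
    by (simp add: norm_mult)
  show "integrable torus (fourier_char k)"
    using int by (simp add: integrable_torus_iff[OF fourier_char_measurable] eq lborel_prod)
  have "(LINT x|torus. fourier_char k x) =
      (LINT x|(lborel \<Otimes>\<^sub>M lborel). g (fst k) (fst x) * g (snd k) (snd x))"
    by (simp add: integral_torus[OF fourier_char_measurable] eq lborel_prod)
  also have "\<dots> = (LINT y|lborel. (LINT x|lborel. g (fst k) x * g (snd k) y))"
    using lborel_pair.integral_snd[of "\<lambda>x y. g (fst k) x * g (snd k) y"] int
    by (simp add: case_prod_unfold)
  also have "\<dots> = (LINT x|lborel. g (fst k) x) * (LINT y|lborel. g (snd k) y)"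
    by simp
  finally show "(LINT x|torus. fourier_char k x) = (if k = 0 then (2 * pi)\<^sup>2 else 0)"
    by (auto simp: int_g prod_eq_iff power2_eq_square)
qed

lemma fourier_char_mult_cnj: "fourier_char k x * cnj (fourier_char l x) = fourier_char (k - l) x"
  by (simp add: fourier_char_def cis_cnj cis_mult algebra_simps)

lemma fourier_coeff_trig_sum:
  assumes "finite A"
  shows "fourier_coeff (\<lambda>x. \<Sum>k\<in>A. c k * fourier_char k x) l = (if l \<in> A then c l else 0)"
proof -
  have "(LINT x|torus. (\<Sum>k\<in>A. c k * fourier_char k x) * cnj (fourier_char l x)) =
      (LINT x|torus. (\<Sum>k\<in>A. c k * fourier_char (k - l) x))"
    by (simp add: sum_distrib_right mult.assoc fourier_char_mult_cnj)
  also have "\<dots> = (\<Sum>k\<in>A. c k * (if k = l then (2 * pi)\<^sup>2 else 0))"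
    by (simp add: integrable_fourier_char integral_fourier_char)
  also have "\<dots> = (\<Sum>k\<in>A. if k = l then c l * (2 * pi)\<^sup>2 else 0)"
    by (rule sum.cong) auto
  also have "\<dots> = (if l \<in> A then c l * (2 * pi)\<^sup>2 else 0)"
    using assms by simp
  finally show ?thesis
    by (simp add: fourier_coeff_def)
qed

lemma fourier_coeff_sharp_proj:
  "fourier_coeff (sharp_proj N f) k = (if k \<in> freq_box N then fourier_coeff f k else 0)"
  unfolding sharp_proj_def by (rule fourier_coeff_trig_sum) simp

lemma propagator_sharp_proj:
  "propagator a b t (sharp_proj N f) x =
    (\<Sum>k\<in>freq_box N.
      cis (- t * real_of_int (a * (fst k)\<^sup>2 + b * (snd k)\<^sup>2)) * fourier_coeff f k * fourier_char k x)"
proof -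
  define s where "s M = (\<Sum>k\<in>freq_box M.
      cis (- t * real_of_int (a * (fst k)\<^sup>2 + b * (snd k)\<^sup>2)) * fourier_coeff (sharp_proj N f) k *
        fourier_char k x)" for M
  have "s M = s N" if "N \<le> M" for M
    unfolding s_def using that
    by (intro sum.mono_neutral_right) (auto simp: fourier_coeff_sharp_proj, auto simp: freq_box_def)
  then have "s \<longlonglongrightarrow> s N"
    by (intro tendsto_eventually eventually_sequentiallyI)
  then have "propagator a b t (sharp_proj N f) x = s N"
    unfolding propagator_def s_def by (rule limI)
  also have "\<dots> = (\<Sum>k\<in>freq_box N.
      cis (- t * real_of_int (a * (fst k)\<^sup>2 + b * (snd k)\<^sup>2)) * fourier_coeff f k * fourier_char k x)"
    unfolding s_def by (rule sum.cong) (auto simp: fourier_coeff_sharp_proj)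
  finally show ?thesis .
qed

lemma fourier_coeff_propagator_sharp_proj:
  "fourier_coeff (propagator a b t (sharp_proj N f)) k =
    cis (- t * real_of_int (a * (fst k)\<^sup>2 + b * (snd k)\<^sup>2)) * fourier_coeff (sharp_proj N f) k"
proof -
  have "propagator a b t (sharp_proj N f) = (\<lambda>x. \<Sum>k\<in>freq_box N.
      (cis (- t * real_of_int (a * (fst k)\<^sup>2 + b * (snd k)\<^sup>2)) * fourier_coeff f k) * fourier_char k x)"
    by (rule ext) (rule propagator_sharp_proj)
  then show ?thesis
    by (simp only: fourier_coeff_trig_sum[OF finite_freq_box] fourier_coeff_sharp_proj) simp
qed

end

theory Submission
  imports Defs
begin

text \<open>
  Multiplying the square of the solution by a Dirichlet sum in time and using orthogonality in space
  and time reduces the estimate to a weighted count of parallelograms \<open>x, x + \<xi>, x + \<eta>, x + \<xi> + \<eta>\<close>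
  in the frequency box with \<open>\<bar>a \<xi>\<^sub>1 \<eta>\<^sub>1 + b \<xi>\<^sub>2 \<eta>\<^sub>2\<bar> \<le> M\<close>, where \<open>M\<close> is the reciprocal of the
  time scale; the bound needed is \<open>M\<close> times the fourth power of the \<open>\<ell>\<^sup>2\<close> norm.  For a fixed longer
  side there are \<open>O(M)\<close> shorter sides with a nonzero value of the form, so these parallelograms are
  controlled by the inequality of the two means on opposite sides.  With \<open>M = N\<close> the zeros of the form
  are equally harmless.  If \<open>- a b\<close> is not a square, the form is anisotropic, its zeros are genuine
  rectangles, and one has to gain from \<open>N\<close> to \<open>log N\<close> (Herr and Kwak).  The value of the weight is
  dyadically decomposed.  A line is rich for a level set with \<open>n\<close> points if it contains more than
  \<open>2 \<surd>n\<close> of them.  Vertices on rich lines, and vertices that are the only point of their level on a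
  side, are removed by Cauchy-Schwarz without any loss.  In the remaining rectangles the smallest value
  is dropped and the rest is reduced to collinear triples on lines with at most \<open>2 \<surd>n\<close> points, whose
  number the theorem of Szemeredi and Trotter bounds by \<open>n\<^sup>2\<close> per dyadic scale, hence by \<open>n\<^sup>2 log N\<close>.
\<close>

section \<open>Incidences of points and lines\<close>

text \<open>The time scale 1 / log N leaves room for one logarithm, and it is spent on the dyadic
  richness of lines; no other sum may lose one. The sum over levels of the weight stays free because
  the smallest vertex value is distributed as two square roots of minima over the sides at the
  opposite corner, which yields exponential decay in the distance between levels. The bound n^2 /
  k^3 for lines with k points is what a third moment needs at each scale, but it holds only for 2 <=
  k <= 2 sqrt n: beyond that n / k dominates, and lines with one point are not controlled at all.
  Hence two classes of exceptional vertices. Removing them works on squares of column sums, whereas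
  exchanging the sides of a rectangle needs nondegenerate rectangles; the argument therefore passes
  back and forth between \<open>square_form\<close> and \<open>rect_form\<close>, each time at the
  price of a diagonal bounded by the square of \<open>mass\<close>. If - a b = h^2, the vector (h,
  a) is orthogonal to its own multiples, and the zero value of the form really has up to order N
  partners.\<close>

type_synonym point = "real \<times> real"
type_synonym edge = "point \<times> point"

definition slope :: "edge \<Rightarrow> real"
  where "slope e = (snd (snd e) - snd (fst e)) / (fst (snd e) - fst (fst e))"

definition height :: "edge \<Rightarrow> real \<Rightarrow> real"
  where "height e t = snd (fst e) + slope e * (t - fst (fst e))"

text \<open>Both intervals are open, so edges sharing an end do not cross there, while overlapping
  collinear edges do. The heights are those of the supporting lines, defined for every
  abscissa.\<close>

definition crosses_at :: "edge \<Rightarrow> edge \<Rightarrow> real \<Rightarrow> bool"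
  where "crosses_at e d t \<longleftrightarrow> fst (fst e) < t \<and> t < fst (snd e) \<and> fst (fst d) < t \<and> t < fst (snd d) \<and>
    height e t = height d t"

lemma height_left [simp]: "height e (fst (fst e)) = snd (fst e)"
  by (simp add: height_def)

lemma height_right: "fst (fst e) < fst (snd e) \<Longrightarrow> height e (fst (snd e)) = snd (snd e)"
  by (simp add: height_def slope_def)

lemma height_shift: "height e t = height e s + slope e * (t - s)"
  by (simp add: height_def algebra_simps)

text \<open>A drawing by segments stored from left to right. Distinct abscissae make every edge the
  graph of an affine function, so planarity becomes a matter of comparing heights;
  \<open>vertex_free\<close> keeps vertices out of the interior of edges.\<close>

locale straight_graph =
  fixes V :: "point set" and E :: "edge set"
  assumes finite_V: "finite V"
    and inj_V: "inj_on fst V"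
    and E_subset: "E \<subseteq> V \<times> V"
    and E_less: "e \<in> E \<Longrightarrow> fst (fst e) < fst (snd e)"
    and vertex_free: "e \<in> E \<Longrightarrow> w \<in> V \<Longrightarrow> fst (fst e) < fst w \<Longrightarrow> fst w < fst (snd e) \<Longrightarrow>
      snd w \<noteq> height e (fst w)"
begin

lemma finite_E: "finite E"
  using E_subset finite_V by (meson finite_SigmaI finite_subset)

lemma fst_in_V: "e \<in> E \<Longrightarrow> fst e \<in> V" and snd_in_V: "e \<in> E \<Longrightarrow> snd e \<in> V"
  using E_subset by auto

text \<open>Of two collinear edges with a common left end, the shorter would have its right end
  inside the longer one, against \<open>vertex_free\<close>.\<close>

lemma same_left_slope:
  assumes "e \<in> E" "d \<in> E" "fst e = fst d" "slope e = slope d" shows "e = d"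
proof -
  have h: "height e t = height d t" for t
    using assms by (simp add: height_def)
  have "fst (snd e) = fst (snd d)"
  proof (rule ccontr)
    assume "fst (snd e) \<noteq> fst (snd d)"
    then consider "fst (snd e) < fst (snd d)" | "fst (snd d) < fst (snd e)" by linarith
    then show False
    proof cases
      case 1
      then show False
        using vertex_free[OF assms(2) snd_in_V[OF assms(1)]] E_less[OF assms(1)] assms(3)
          height_right[OF E_less[OF assms(1)]] h by auto
    next
      case 2
      then show False
        using vertex_free[OF assms(1) snd_in_V[OF assms(2)]] E_less[OF assms(2)] assms(3)
          height_right[OF E_less[OF assms(2)]] h by auto
    qed
  qed
  then have "snd e = snd d"
    using inj_V snd_in_V[OF assms(1)] snd_in_V[OF assms(2)] by (auto dest: inj_onD)
  with assms(3) show ?thesis by (simp add: prod_eq_iff)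
qed

lemma same_right_slope:
  assumes "e \<in> E" "d \<in> E" "snd e = snd d" "slope e = slope d" shows "e = d"
proof -
  have h: "height e t = height d t" for t
    using height_shift[of e t "fst (snd e)"] height_shift[of d t "fst (snd d)"] assms
      height_right[OF E_less[OF assms(1)]] height_right[OF E_less[OF assms(2)]] by simp
  have "fst (fst e) = fst (fst d)"
  proof (rule ccontr)
    assume "fst (fst e) \<noteq> fst (fst d)"
    then consider "fst (fst e) < fst (fst d)" | "fst (fst d) < fst (fst e)" by linarith
    then show False
    proof cases
      case 1
      then show False
        using vertex_free[OF assms(1) fst_in_V[OF assms(2)]] E_less[OF assms(2)] assms(3) h by auto
    next
      case 2
      then show False
        using vertex_free[OF assms(2) fst_in_V[OF assms(1)]] E_less[OF assms(1)] assms(3)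
          h[symmetric] by auto
    qed
  qed
  then have "fst e = fst d"
    using inj_V fst_in_V[OF assms(1)] fst_in_V[OF assms(2)] by (auto dest: inj_onD)
  with assms(3) show ?thesis by (simp add: prod_eq_iff)
qed

end

text \<open>The difference of the heights is affine and changes sign, so it vanishes strictly
  between \<open>t1\<close> and \<open>t2\<close>, hence in the open range of both edges.\<close>

lemma sign_change_crosses:
  assumes "fst (fst e) \<le> t1" "t1 \<le> fst (snd e)" "fst (fst d) \<le> t1" "t1 \<le> fst (snd d)"
    and "fst (fst e) \<le> t2" "t2 \<le> fst (snd e)" "fst (fst d) \<le> t2" "t2 \<le> fst (snd d)"
    and "height e t1 < height d t1" "height d t2 < height e t2"
  shows "\<exists>t. crosses_at e d t"
proof -
  define m where "m = slope d - slope e"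
  define u where "u = height d t1 - height e t1"
  have eq: "height d t - height e t = u + m * (t - t1)" for t
    using height_shift[of e t t1] height_shift[of d t t1] by (simp add: u_def m_def algebra_simps)
  have u: "u > 0" and v: "u + m * (t2 - t1) < 0"
    using assms(9,10) eq[of t2] by (auto simp: u_def)
  have m: "m * (t2 - t1) < 0" using u v by linarith
  \<comment> \<open>Relative position, between \<open>t1\<close> and \<open>t2\<close>, of the zero
    of the affine difference.\<close>
  define r where "r = u / (- (m * (t2 - t1)))"
  have r: "0 < r" "r < 1"
    using u v m by (simp_all add: r_def divide_simps)
  define t where "t = t1 + r * (t2 - t1)"
  have "m * (t - t1) = - u"
    using m by (cases "m = 0 \<or> t1 = t2") (auto simp: t_def r_def field_simps)
  then have h: "height e t = height d t"
    using eq[of t] by simp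
  have "t1 \<noteq> t2" using m by auto
  then consider "t1 < t2" | "t2 < t1" by linarith
  then have "min t1 t2 < t \<and> t < max t1 t2"
  proof cases
    case 1
    have "0 < r * (t2 - t1)" using 1 r by simp
    moreover have "r * (t2 - t1) < t2 - t1" using 1 r mult_strict_right_mono[of r 1 "t2 - t1"] by simp
    ultimately have "t1 < t" "t < t2" unfolding t_def by linarith+
    then show ?thesis by simp
  next
    case 2
    have "r * (t2 - t1) < 0" using 2 r by (simp add: mult_pos_neg)
    moreover have "t2 - t1 < r * (t2 - t1)" using 2 r mult_strict_right_mono_neg[of r 1 "t2 - t1"] by simp
    ultimately have "t2 < t" "t < t1" unfolding t_def by linarith+
    then show ?thesis by simp
  qed
  then have "crosses_at e d t"
    using assms h unfolding crosses_at_def by (auto simp: min_def max_def split: if_splits)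
  then show ?thesis ..
qed

section \<open>Linear edge bound for drawings without crossings\<close>

context straight_graph begin

text \<open>Every edge is charged to a vertex in one of three ways, each injective: as the steepest
  edge leaving its left end (\<open>T1\<close>), as the flattest edge arriving at its right end
  (\<open>T2\<close>), or as the highest edge passing below a vertex (\<open>T3\<close>). An edge
  outside \<open>T1\<close> and \<open>T2\<close> has neighbours above it at both ends, and these
  enclose a vertex directly above it.\<close>

lemma card_E_noncrossing:
  assumes nc: "\<And>e d t. e \<in> E \<Longrightarrow> d \<in> E \<Longrightarrow> crosses_at e d t \<Longrightarrow> e = d"
  shows "card E \<le> 3 * card V"
proof -
  define T1 where "T1 = {e \<in> E. \<forall>d\<in>E. fst d = fst e \<longrightarrow> slope d \<le> slope e}"
  define T2 where "T2 = {e \<in> E. \<forall>d\<in>E. snd d = snd e \<longrightarrow> slope e \<le> slope d}"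
  define below where "below e w \<longleftrightarrow> fst (fst e) < fst w \<and> fst w < fst (snd e) \<and> height e (fst w) < snd w \<and>
    (\<forall>d\<in>E. fst (fst d) < fst w \<longrightarrow> fst w < fst (snd d) \<longrightarrow> height d (fst w) < snd w \<longrightarrow>
      height d (fst w) \<le> height e (fst w))" for e w
  define T3 where "T3 = {e \<in> E. \<exists>w\<in>V. below e w}"
  have nc': "height e t2 \<le> height d t2"
    if "e \<in> E" "d \<in> E" "height e t1 < height d t1"
      and "fst (fst e) \<le> t1" "t1 \<le> fst (snd e)" "fst (fst d) \<le> t1" "t1 \<le> fst (snd d)"
      and "fst (fst e) \<le> t2" "t2 \<le> fst (snd e)" "fst (fst d) \<le> t2" "t2 \<le> fst (snd d)" for e d t1 t2
  proof (rule ccontr)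
    assume "\<not> height e t2 \<le> height d t2"
    then have "\<exists>t. crosses_at e d t"
      using sign_change_crosses[of e t1 d t2] that by (auto simp: not_le)
    with nc[of e d] that show False by auto
  qed
  have "card T1 \<le> card V"
  proof (rule card_inj_on_le[where f = fst])
    show "inj_on fst T1"
    proof (rule inj_onI)
      fix e d assume ed: "e \<in> T1" "d \<in> T1" "fst e = fst d"
      then have "slope e = slope d"
        by (intro antisym) (simp_all add: T1_def)
      with ed show "e = d"
        by (intro same_left_slope) (simp_all add: T1_def)
    qed
  qed (auto simp: T1_def dest: fst_in_V intro: finite_V)
  moreover have "card T2 \<le> card V"
  proof (rule card_inj_on_le[where f = snd])
    show "inj_on snd T2"
    proof (rule inj_onI)
      fix e d assume ed: "e \<in> T2" "d \<in> T2" "snd e = snd d"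
      then have "slope e = slope d"
        by (intro antisym) (simp_all add: T2_def)
      with ed show "e = d"
        by (intro same_right_slope) (simp_all add: T2_def)
    qed
  qed (auto simp: T2_def dest: snd_in_V intro: finite_V)
  moreover have "card T3 \<le> card V"
  proof -
    define W where "W e = (SOME w. w \<in> V \<and> below e w)" for e
    have W: "W e \<in> V" "below e (W e)" if "e \<in> T3" for e
      using that someI_ex[of "\<lambda>w. w \<in> V \<and> below e w"] by (auto simp: T3_def W_def)
    show ?thesis
    proof (rule card_inj_on_le[where f = W])
      show "inj_on W T3"
      proof (rule inj_onI)
        fix e d assume ed: "e \<in> T3" "d \<in> T3" "W e = W d"
        then have "crosses_at e d (fst (W e))"
          using W[of e] W[of d] by (force simp: below_def crosses_at_def T3_def intro!: antisym)
        with nc ed show "e = d" by (auto simp: T3_def)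
      qed
    qed (use W finite_V in auto)
  qed
  moreover have "E \<subseteq> T1 \<union> T2 \<union> T3"
  proof
    fix e assume e: "e \<in> E"
    show "e \<in> T1 \<union> T2 \<union> T3"
    proof (rule ccontr)
      assume "e \<notin> T1 \<union> T2 \<union> T3"
      then have n1: "e \<notin> T1" and n2: "e \<notin> T2" and n3: "e \<notin> T3" by auto
      define p q where "p = fst e" and "q = snd e"
      have pq: "fst p < fst q" using E_less[OF e] by (simp add: p_def q_def)
      \<comment> \<open>The next edge above \<open>e\<close> at its left end is chosen with the
        smallest slope, so that no edge leaves \<open>p\<close> between \<open>e\<close> and
        \<open>e1\<close>.\<close>
      define U where "U = {d \<in> E. fst d = p \<and> slope e < slope d}"
      have "finite U" using finite_E by (simp add: U_def)
      moreover have "\<exists>d\<in>E. fst d = p \<and> slope e < slope d"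
        using n1 e by (auto simp: T1_def p_def not_le simp del: split_paired_Ex)
      then have "U \<noteq> {}" unfolding U_def by blast
      ultimately obtain e1 where e1U: "e1 \<in> U" and min: "\<And>d. d \<in> U \<Longrightarrow> slope e1 \<le> slope d"
        using arg_min_if_finite[of U slope] by (metis not_le)
      have e1: "e1 \<in> E" "fst e1 = p" "slope e < slope e1"
        using e1U by (auto simp: U_def)
      obtain e2 where e2: "e2 \<in> E" "snd e2 = q" "slope e2 < slope e"
        using n2 e by (auto simp: T2_def q_def not_le)
      define q1 p2 where "q1 = snd e1" and "p2 = fst e2"
      have pq1: "fst p < fst q1" using E_less[OF e1(1)] e1 by (simp add: q1_def)
      have p2q: "fst p2 < fst q" using E_less[OF e2(1)] e2 by (simp add: p2_def)
      have he: "height e t = snd p + slope e * (t - fst p)" for t by (simp add: height_def p_def)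
      have he1: "height e1 t = snd p + slope e1 * (t - fst p)" for t by (simp add: height_def e1)
      have heq: "height e (fst q) = snd q" using height_right pq by (simp add: p_def q_def)
      have he2q: "height e2 (fst q) = snd q" using height_right[of e2] p2q e2 by (simp add: p2_def)
      have e_e1: "height e t < height e1 t" if "fst p < t" for t
        using that e1(3) by (simp add: he he1)
      have e_e2: "height e t < height e2 t" if "t < fst q" for t
        using height_shift[of e t "fst q"] height_shift[of e2 t "fst q"] heq he2q that e2(3)
        by (simp add: mult_less_cancel_right)
      \<comment> \<open>The vertices between \<open>e\<close> and \<open>e1\<close>; the upper
        boundary is included so that the right end of \<open>e1\<close> qualifies.\<close>
      define W where "W = {w \<in> V. fst p < fst w \<and> fst w < fst q \<and> fst w \<le> fst q1 \<and>
        height e (fst w) < snd w \<and> snd w \<le> height e1 (fst w)}"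
      have "W \<noteq> {}"
      proof (cases "fst q1 < fst q")
        case True
        have "height e1 (fst q1) = snd q1" using height_right pq1 e1 by (simp add: q1_def)
        then have "q1 \<in> W"
          using True pq1 e_e1[of "fst q1"] snd_in_V[OF e1(1)] by (simp add: W_def q1_def)
        then show ?thesis by auto
      next
        \<comment> \<open>Here \<open>e1\<close> reaches at least as far as \<open>q\<close>, and
          \<open>e2\<close> ends at \<open>q\<close> below it. If \<open>e2\<close> started at or
          left of \<open>p\<close>, it would lie above \<open>e1\<close> there and cross it; so its
          left end lies between \<open>e\<close> and \<open>e1\<close>.\<close>
        case False
        have h1: "height e2 (fst q) < height e1 (fst q)"
          using e_e1[OF pq] heq he2q by simp
        have "fst p < fst p2"
        proof (rule ccontr)
          assume "\<not> fst p < fst p2"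
          then have "height e2 (fst p) \<le> height e1 (fst p)"
            using nc'[OF e2(1) e1(1) h1, of "fst p"] e1 e2 pq False by (simp add: q1_def p2_def)
          with e_e2[OF pq] show False by (simp add: he he1)
        qed
        moreover from this have "height e2 (fst p2) \<le> height e1 (fst p2)"
          using nc'[OF e2(1) e1(1) h1, of "fst p2"] e1 e2 pq False p2q by (simp add: q1_def p2_def)
        ultimately have "p2 \<in> W"
          using e_e2[OF p2q] p2q False fst_in_V[OF e2(1)] by (simp add: W_def p2_def)
        then show ?thesis by auto
      qed
      moreover have "finite W" using finite_V by (simp add: W_def)
      ultimately obtain w where w: "w \<in> W" and left: "\<And>z. z \<in> W \<Longrightarrow> fst w \<le> fst z"
        using arg_min_if_finite[of W fst] by (metis not_le)
      have wV: "w \<in> V" and pw: "fst p < fst w" and wq: "fst w < fst q" and wq1: "fst w \<le> fst q1"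
        and ew: "height e (fst w) < snd w" and we1: "snd w \<le> height e1 (fst w)"
        using w by (auto simp: W_def)
      have "below e w"
        unfolding below_def
      proof (intro conjI ballI impI)
        fix d assume d: "d \<in> E" "fst (fst d) < fst w" "fst w < fst (snd d)" "height d (fst w) < snd w"
        show "height d (fst w) \<le> height e (fst w)"
        proof (rule ccontr)
          assume "\<not> height d (fst w) \<le> height e (fst w)"
          then have ed: "height e (fst w) < height d (fst w)" by simp
          have de1: "height d (fst w) < height e1 (fst w)" using d we1 by linarith
          define p' where "p' = fst d"
          have p': "p' \<in> V" using fst_in_V[OF d(1)] by (simp add: p'_def)
          \<comment> \<open>An edge \<open>d\<close> between \<open>e\<close> and the leftmost
            vertex \<open>w\<close> of \<open>W\<close> has no possible left end: right of
            \<open>p\<close> it would be an earlier member of \<open>W\<close>, at \<open>p\<close>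
            it would contradict the choice of \<open>e1\<close>, and left of \<open>p\<close> the
            edge \<open>d\<close> would be squeezed through the vertex \<open>p\<close>.\<close>
          consider "fst p < fst p'" | "fst p' = fst p" | "fst p' < fst p" by linarith
          then show False
          proof cases
            case 1
            have "height e (fst p') \<le> height d (fst p')"
              using nc'[OF e d(1) ed, of "fst p'"] 1 d pw wq by (simp add: p'_def p_def q_def)
            moreover have "snd p' \<noteq> height e (fst p')"
              using vertex_free[OF e p'] 1 d wq by (simp add: p'_def p_def q_def)
            moreover have "height d (fst p') \<le> height e1 (fst p')"
              using nc'[OF d(1) e1(1) de1, of "fst p'"] 1 d pw wq1 e1(2)
              by (simp add: p'_def q1_def)
            ultimately have "p' \<in> W"
              using 1 d wq wq1 p' by (simp add: W_def p'_def)
            with left[of p'] d show False by (simp add: p'_def)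
          next
            case 2
            then have pp: "p' = p"
              using inj_V p' fst_in_V[OF e] by (auto simp: p_def dest: inj_onD)
            have hd: "height d t = snd p + slope d * (t - fst p)" for t
              using pp by (simp add: height_def p'_def)
            have "slope e < slope d"
              using ed pw by (simp add: he hd)
            then have "slope e1 \<le> slope d"
              using min[of d] pp d(1) by (simp add: U_def p'_def)
            moreover have "slope d < slope e1"
              using de1 pw by (simp add: he1 hd)
            ultimately show False by simp
          next
            case 3
            have "height e (fst p) \<le> height d (fst p)"
              using nc'[OF e d(1) ed, of "fst p"] 3 d pw wq by (simp add: p'_def p_def q_def)
            moreover have "snd p \<noteq> height d (fst p)"
              using vertex_free[OF d(1) fst_in_V[OF e]] 3 d pw by (simp add: p'_def p_def)
            moreover have "height d (fst p) \<le> height e1 (fst p)"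
              using nc'[OF d(1) e1(1) de1, of "fst p"] 3 d pw wq1 pq1 e1(2)
              by (simp add: p'_def q1_def)
            ultimately show False by (simp add: he he1)
          qed
        qed
      qed (use pw wq ew in \<open>simp_all add: p_def q_def\<close>)
      with n3 e wV show False by (auto simp: T3_def)
    qed
  qed
  then have "card E \<le> card (T1 \<union> T2 \<union> T3)"
    by (intro card_mono) (auto intro: finite_subset[OF _ finite_E] simp: T1_def T2_def T3_def)
  moreover have "card (T1 \<union> T2 \<union> T3) \<le> card T1 + card T2 + card T3"
    by (meson card_Un_le add_le_mono le_refl order_trans)
  ultimately show ?thesis by linarith
qed

section \<open>The crossing lemma by random sampling of vertices\<close>

definition crossings :: "(edge \<times> edge) set"
  where "crossings = {(e, d) \<in> E \<times> E. e \<noteq> d \<and> (\<exists>t. crosses_at e d t)}"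

lemma finite_crossings: "finite crossings"
  by (rule finite_subset[of _ "E \<times> E"]) (auto simp: crossings_def finite_E)

text \<open>Deleting the first edge of each ordered crossing leaves a drawing without crossings and
  removes at most \<open>card crossings\<close> edges.\<close>

lemma card_E_le_crossings: "card E \<le> 3 * card V + card crossings"
proof -
  define E' where "E' = E - fst ` crossings"
  interpret E': straight_graph V E'
    using finite_V inj_V E_subset E_less vertex_free by unfold_locales (auto simp: E'_def)
  have "card E' \<le> 3 * card V"
  proof (rule E'.card_E_noncrossing)
    fix e d t assume "e \<in> E'" "d \<in> E'" "crosses_at e d t"
    moreover from this have "(e, d) \<notin> crossings" unfolding E'_def by force
    ultimately show "e = d" by (auto simp: E'_def crossings_def)
  qed
  moreover have "card E \<le> card E' + card (fst ` crossings)"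
  proof -
    have "card E \<le> card (E' \<union> fst ` crossings)"
      by (rule card_mono) (auto simp: E'_def finite_E finite_crossings)
    also have "\<dots> \<le> card E' + card (fst ` crossings)" by (rule card_Un_le)
    finally show ?thesis .
  qed
  moreover have "card (fst ` crossings) \<le> card crossings"
    by (rule card_image_le[OF finite_crossings])
  ultimately show ?thesis by linarith
qed

text \<open>Edges with a common end that meet again have equal slope and coincide. The four distinct
  ends are what gives a crossing the survival probability \<open>p ^ 4\<close>.\<close>

lemma crossing_endpoints:
  assumes "(e, d) \<in> crossings"
  shows "card {fst e, snd e, fst d, snd d} = 4"
proof -
  obtain t where t: "crosses_at e d t" and ed: "e \<in> E" "d \<in> E" "e \<noteq> d"
    using assms by (auto simp: crossings_def)
  note t' = t[unfolded crosses_at_def]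
  have "fst e \<noteq> fst d"
  proof
    assume eq: "fst e = fst d"
    have "height e t = height d t" "t \<noteq> fst (fst d)" using t' by auto
    then have "slope e = slope d" using eq by (simp add: height_def)
    with same_left_slope[OF ed(1,2) eq] ed show False by auto
  qed
  moreover have "snd e \<noteq> snd d"
  proof
    assume eq: "snd e = snd d"
    have "height e t = height d t" "t \<noteq> fst (snd d)" using t' by auto
    then have "slope e = slope d"
      using eq height_shift[of e t "fst (snd e)"] height_shift[of d t "fst (snd d)"]
        height_right[OF E_less[OF ed(1)]] height_right[OF E_less[OF ed(2)]] by simp
    with same_right_slope[OF ed(1,2) eq] ed show False by auto
  qed
  moreover have "fst e \<noteq> snd e" "fst d \<noteq> snd d" "fst e \<noteq> snd d" "snd e \<noteq> fst d"
    using t' by auto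
  ultimately show ?thesis by simp
qed

end

text \<open>The probability that a random subset of \<open>V\<close>, keeping each vertex
  independently with probability \<open>p\<close>, contains \<open>B\<close>. It is read off by
  expanding the product over \<open>V\<close> of \<open>p\<close> plus \<open>1 - p\<close>, the
  second summand being replaced by 0 on \<open>B\<close>.\<close>

lemma sum_Pow_weights:
  fixes p :: real
  assumes "finite V" "B \<subseteq> V"
  shows "(\<Sum>A\<in>Pow V. if B \<subseteq> A then p ^ card A * (1 - p) ^ card (V - A) else 0) = p ^ card B"
proof -
  have "(\<Prod>v\<in>V. p + (if v \<in> B then 0 else 1 - p)) =
      (\<Sum>A\<in>Pow V. (\<Prod>v\<in>A. p) * (\<Prod>v\<in>V - A. if v \<in> B then 0 else 1 - p))"
    by (rule prod_add[OF assms(1)])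
  also have "\<dots> = (\<Sum>A\<in>Pow V. if B \<subseteq> A then p ^ card A * (1 - p) ^ card (V - A) else 0)"
  proof (rule sum.cong[OF refl])
    fix A assume A: "A \<in> Pow V"
    show "(\<Prod>v\<in>A. p) * (\<Prod>v\<in>V - A. if v \<in> B then 0 else 1 - p) =
        (if B \<subseteq> A then p ^ card A * (1 - p) ^ card (V - A) else 0)"
    proof (cases "B \<subseteq> A")
      case True
      then have "(\<Prod>v\<in>V - A. if v \<in> B then 0 else 1 - p) = (\<Prod>v\<in>V - A. 1 - p)"
        by (intro prod.cong) auto
      with True show ?thesis by simp
    next
      case False
      then have "\<exists>v\<in>V - A. v \<in> B" using assms by auto
      then have "(\<Prod>v\<in>V - A. if v \<in> B then 0 else 1 - p) = 0"
        using assms by (intro prod_zero) auto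
      with False show ?thesis by simp
    qed
  qed
  also have "(\<Prod>v\<in>V. p + (if v \<in> B then 0 else 1 - p)) = (\<Prod>v\<in>V. if v \<in> B then p else 1)"
    by (intro prod.cong) auto
  also have "\<dots> = p ^ card B"
    using assms by (simp add: prod.If_cases Int_absorb1)
  finally show ?thesis by simp
qed

text \<open>Averages the linear bound over random vertex sets in which every vertex survives
  with probability \<^term>\<open>p\<close>.\<close>

lemma (in straight_graph) crossing_average:
  fixes p :: real
  assumes p: "0 \<le> p" "p \<le> 1"
  shows "card E * p ^ 2 \<le> 3 * (card V * p) + card crossings * p ^ 4"
proof -
  define w where "w A = p ^ card A * (1 - p) ^ card (V - A)" for A :: "point set"
  have w0: "w A \<ge> 0" for A using p by (simp add: w_def)
  \<comment> \<open>Linearity of expectation for the number of configurations \<open>i\<close> all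
    of whose vertices \<open>g i\<close> survive.\<close>
  have avg: "(\<Sum>A\<in>Pow V. w A * real (card {i \<in> I. g i \<subseteq> A})) = (\<Sum>i\<in>I. p ^ card (g i))"
    if "finite I" "\<And>i. i \<in> I \<Longrightarrow> g i \<subseteq> V" for I :: "'i set" and g
  proof -
    have "w A * real (card {i \<in> I. g i \<subseteq> A}) = (\<Sum>i\<in>I. if g i \<subseteq> A then w A else 0)" for A
      using that(1) by (simp add: sum.If_cases Int_def mult.commute)
    then have "(\<Sum>A\<in>Pow V. w A * real (card {i \<in> I. g i \<subseteq> A})) =
        (\<Sum>i\<in>I. \<Sum>A\<in>Pow V. if g i \<subseteq> A then w A else 0)"
      by (simp only: sum.swap[of _ I])
    also have "\<dots> = (\<Sum>i\<in>I. p ^ card (g i))"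
      unfolding w_def by (intro sum.cong refl sum_Pow_weights finite_V that)
    finally show ?thesis .
  qed
  have le: "card {e \<in> E. {fst e, snd e} \<subseteq> A} \<le> 3 * card {v \<in> V. {v} \<subseteq> A} +
      card {c \<in> crossings. {fst (fst c), snd (fst c), fst (snd c), snd (snd c)} \<subseteq> A}" if A: "A \<subseteq> V" for A
  proof -
    interpret A: straight_graph A "{e \<in> E. {fst e, snd e} \<subseteq> A}"
      using A finite_V inj_V E_less vertex_free
      by unfold_locales (auto intro: finite_subset inj_on_subset)
    have "A.crossings = {c \<in> crossings. {fst (fst c), snd (fst c), fst (snd c), snd (snd c)} \<subseteq> A}"
      unfolding A.crossings_def crossings_def by (intro set_eqI) (simp add: case_prod_beta mem_Times_iff, blast)
    moreover have "{v \<in> V. {v} \<subseteq> A} = A" using A by auto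
    ultimately show ?thesis using A.card_E_le_crossings by simp
  qed
  define ends where "ends c = {fst (fst c), snd (fst c), fst (snd c), snd (snd c)}" for c :: "edge \<times> edge"
  define SV SE SX where "SV = (\<Sum>A\<in>Pow V. w A * real (card {v \<in> V. {v} \<subseteq> A}))"
    and "SE = (\<Sum>A\<in>Pow V. w A * real (card {e \<in> E. {fst e, snd e} \<subseteq> A}))"
    and "SX = (\<Sum>A\<in>Pow V. w A * real (card {c \<in> crossings. ends c \<subseteq> A}))"
  have "SE \<le> (\<Sum>A\<in>Pow V. w A * (3 * real (card {v \<in> V. {v} \<subseteq> A}) +
        real (card {c \<in> crossings. ends c \<subseteq> A})))"
    unfolding SE_def
  proof (intro sum_mono mult_left_mono w0)
    fix A assume "A \<in> Pow V"
    then have "A \<subseteq> V" by simp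
    from of_nat_mono[OF le[OF this], where 'a = real]
    show "real (card {e \<in> E. {fst e, snd e} \<subseteq> A}) \<le> 3 * real (card {v \<in> V. {v} \<subseteq> A}) +
        real (card {c \<in> crossings. ends c \<subseteq> A})"
      by (simp add: ends_def)
  qed
  also have "\<dots> = 3 * SV + SX"
    unfolding SV_def SX_def sum_distrib_left sum.distrib[symmetric]
    by (intro sum.cong refl) (simp only: distrib_left mult.left_commute)
  finally have main: "SE \<le> 3 * SV + SX" .
  have "SV = (\<Sum>v\<in>V. p ^ card {v})"
    unfolding SV_def by (rule avg) (auto simp: finite_V)
  then have SV: "SV = card V * p" by simp
  have "SX = (\<Sum>c\<in>crossings. p ^ card (ends c))"
    unfolding SX_def
  proof (rule avg[OF finite_crossings])
    fix c assume "c \<in> crossings"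
    then have "fst c \<in> E" "snd c \<in> E" by (auto simp: crossings_def)
    then show "ends c \<subseteq> V" by (simp add: ends_def fst_in_V snd_in_V)
  qed
  also have "\<dots> = (\<Sum>c\<in>crossings. p ^ 4)"
  proof (rule sum.cong[OF refl])
    fix c assume "c \<in> crossings"
    then have "card (ends c) = 4"
      unfolding ends_def by (intro crossing_endpoints) simp
    then show "p ^ card (ends c) = p ^ 4" by simp
  qed
  finally have SX: "SX = card crossings * p ^ 4" by simp
  have "SE = (\<Sum>e\<in>E. p ^ card {fst e, snd e})"
    unfolding SE_def by (rule avg[OF finite_E]) (simp add: fst_in_V snd_in_V)
  also have "\<dots> = (\<Sum>e\<in>E. p ^ 2)"
  proof (rule sum.cong[OF refl])
    fix e assume "e \<in> E"
    then have "fst e \<noteq> snd e" using E_less[of e] by auto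
    then show "p ^ card {fst e, snd e} = p ^ 2" by (simp add: power2_eq_square)
  qed
  finally have "SE = card E * p ^ 2" by simp
  with main SV SX show ?thesis by simp
qed

text \<open>The sampling probability is tuned so that the expected number of edges exceeds the
  vertex term by a fixed factor; the surplus must be paid by crossings.\<close>

lemma (in straight_graph) crossing_lemma:
  assumes "4 * card V \<le> card E"
  shows "real (card E) ^ 3 \<le> 64 * real (card V) ^ 2 * card crossings"
proof (cases "card E = 0")
  case False
  define n e X where "n = real (card V)" and "e = real (card E)" and "X = real (card crossings)"
  have e: "e > 0" and n4: "4 * n \<le> e" using False assms by (simp_all add: e_def n_def)
  have "n > 0"
    using False E_subset finite_V by (cases "V = {}") (auto simp: n_def card_gt_0_iff)
  \<comment> \<open>With this choice \<open>e * p ^ 2 = 4 * (n * p)\<close>, which leaves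
    \<open>n * p\<close> after subtracting \<open>3 * (n * p)\<close>. The hypothesis on the number
    of edges is \<open>p \<le> 1\<close>, and 64 is \<open>4 ^ 3\<close>.\<close>
  define p where "p = 4 * n / e"
  have p: "0 < p" "p \<le> 1" using e n4 \<open>n > 0\<close> by (simp_all add: p_def)
  have "e * p ^ 2 \<le> 3 * (n * p) + X * p ^ 4"
    using crossing_average[of p] p by (simp add: e_def n_def X_def)
  moreover have "e * p ^ 2 = 4 * (n * p)"
    using e by (simp add: p_def power2_eq_square)
  moreover have "X * p ^ 4 = X * p ^ 3 * p"
    by (simp add: power_numeral_reduce)
  ultimately have "n * p \<le> X * p ^ 3 * p" by linarith
  then have "n \<le> X * p ^ 3"
    using p by simp
  also have "\<dots> = X * (64 * n ^ 3) / e ^ 3"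
    by (simp add: p_def power_divide power_mult_distrib)
  finally have "n * e ^ 3 \<le> n * (64 * n ^ 2 * X)"
    using e by (simp add: field_simps power_numeral_reduce)
  then show ?thesis
    using \<open>n > 0\<close> by (simp add: e_def n_def X_def)
qed simp

section \<open>The theorem of Szemeredi and Trotter, by Szekely's argument\<close>

definition consecutive :: "point set \<Rightarrow> edge set"
  where "consecutive A = {(p, q). p \<in> A \<and> q \<in> A \<and> fst p < fst q \<and> (\<forall>r\<in>A. \<not> (fst p < fst r \<and> fst r < fst q))}"

lemma consecutive_subset: "consecutive A \<subseteq> A \<times> A"
  by (auto simp: consecutive_def)

text \<open>Every point except the rightmost has a successor, so a line with \<open>k\<close> points
  carries at least \<open>k - 1\<close> edges.\<close>

lemma card_consecutive:
  assumes "finite A" "inj_on fst A"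
  shows "card A \<le> card (consecutive A) + 1"
proof (cases "A = {}")
  case False
  have fin: "finite (consecutive A)"
    using assms(1) consecutive_subset by (meson finite_SigmaI finite_subset)
  obtain m where m: "m \<in> A" "\<And>p. p \<in> A \<Longrightarrow> fst p \<le> fst m"
  proof -
    have "Max (fst ` A) \<in> fst ` A" using assms(1) False by simp
    then obtain m where m: "m \<in> A" "fst m = Max (fst ` A)" by auto
    have "fst p \<le> fst m" if "p \<in> A" for p
      using assms(1) that by (simp add: m(2))
    with m(1) show ?thesis by (rule that)
  qed
  have "A - {m} \<subseteq> fst ` consecutive A"
  proof
    fix p assume p: "p \<in> A - {m}"
    then have "fst p \<noteq> fst m" using assms(2) m(1) by (auto dest: inj_onD)
    then have "m \<in> {q \<in> A. fst p < fst q}" using m(1) m(2)[of p] p by simp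
    then have ne: "{q \<in> A. fst p < fst q} \<noteq> {}" by blast
    have fin': "finite {q \<in> A. fst p < fst q}" using assms(1) by simp
    have "Min (fst ` {q \<in> A. fst p < fst q}) \<in> fst ` {q \<in> A. fst p < fst q}"
      using ne fin' by simp
    then obtain q where q: "q \<in> A" "fst p < fst q" "fst q = Min (fst ` {q \<in> A. fst p < fst q})"
      by auto
    have "fst q \<le> fst r" if "r \<in> A" "fst p < fst r" for r
      unfolding q(3) using fin' that by (intro Min_le) auto
    then have "(p, q) \<in> consecutive A"
      using p q(1,2) by (force simp: consecutive_def)
    then show "p \<in> fst ` consecutive A" by force
  qed
  then have "card (A - {m}) \<le> card (fst ` consecutive A)"
    by (intro card_mono) (auto simp: fin)
  also have "\<dots> \<le> card (consecutive A)" by (rule card_image_le[OF fin])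
  finally show ?thesis using m(1) by simp
qed simp

lemma consecutive_unique:
  assumes "inj_on fst A" "e \<in> consecutive A" "d \<in> consecutive A"
    and "fst (fst e) < t" "t < fst (snd e)" "fst (fst d) < t" "t < fst (snd d)"
  shows "e = d"
proof -
  have "fst (fst e) = fst (fst d)" "fst (snd e) = fst (snd d)"
    using assms(2-) by (force simp: consecutive_def)+
  moreover have "fst e \<in> A" "fst d \<in> A" "snd e \<in> A" "snd d \<in> A"
    using assms(2,3) by (auto simp: consecutive_def)
  ultimately have "fst e = fst d" "snd e = snd d"
    using assms(1) by (auto dest: inj_onD)
  then show ?thesis by (simp add: prod_eq_iff)
qed

text \<open>The drawing joins neighbouring points on each line: rich lines give many edges, while
  lines meeting at most once give few crossings. Lines are pairs of slope and intercept; with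
  distinct abscissae no line containing two points is vertical. The condition on
  \<open>k ^ 2\<close> selects the range where n^2 / k^3 is the dominant bound.\<close>

theorem szemeredi_trotter:
  fixes P :: "point set" and L :: "(real \<times> real) set" and k :: nat
  assumes fin: "finite P" "finite L" and inj: "inj_on fst P"
    and k: "2 \<le> k" "k ^ 2 \<le> 4 * card P"
    and rich: "\<And>l. l \<in> L \<Longrightarrow> k \<le> card {p \<in> P. snd p = fst l * fst p + snd l}"
  shows "card L * k ^ 3 \<le> 512 * card P ^ 2"
proof -
  define on where "on l = {p \<in> P. snd p = fst l * fst p + snd l}" for l
  define E where "E = (\<Union>l\<in>L. consecutive (on l))"
  define par where "par e = (slope e, snd (fst e) - slope e * fst (fst e))" for e
  have inj_on: "inj_on fst (on l)" and fin_on: "finite (on l)" for l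
    using inj fin by (auto simp: on_def intro: inj_on_subset)
  have par: "par e = l" if "e \<in> consecutive (on l)" for e l
  proof -
    have "slope e = fst l"
      using that by (auto simp: consecutive_def on_def slope_def algebra_simps divide_simps)
    then show ?thesis
      using that by (auto simp: consecutive_def on_def par_def prod_eq_iff)
  qed
  have height: "height e t = fst l * t + snd l" if "e \<in> consecutive (on l)" for e l t
    using par[OF that] by (auto simp: par_def height_def algebra_simps)
  interpret straight_graph P E
  proof
    show "E \<subseteq> P \<times> P" by (auto simp: E_def consecutive_def on_def)
    show "fst (fst e) < fst (snd e)" if "e \<in> E" for e
      using that by (auto simp: E_def consecutive_def)
    show "snd w \<noteq> height e (fst w)"
      if e: "e \<in> E" and w: "w \<in> P" "fst (fst e) < fst w" "fst w < fst (snd e)" for e w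
    proof
      assume h: "snd w = height e (fst w)"
      obtain l where l: "e \<in> consecutive (on l)" using e by (auto simp: E_def)
      then have "w \<in> on l" using w h height[OF l] by (simp add: on_def)
      with l w show False by (auto simp: consecutive_def)
    qed
  qed (use fin inj in auto)
  have finc: "finite (consecutive (on l))" for l
    by (rule finite_subset[OF consecutive_subset]) (simp add: fin_on)
  have "card E = (\<Sum>l\<in>L. card (consecutive (on l)))"
    unfolding E_def
  proof (rule card_UN_disjoint)
    show "\<forall>l\<in>L. \<forall>m\<in>L. l \<noteq> m \<longrightarrow> consecutive (on l) \<inter> consecutive (on m) = {}"
      using par by blast
  qed (use fin finc in auto)
  moreover have "(\<Sum>l\<in>L. k - 1) \<le> (\<Sum>l\<in>L. card (consecutive (on l)))"
  proof (rule sum_mono)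
    fix l assume "l \<in> L"
    then show "k - 1 \<le> card (consecutive (on l))"
      using rich[of l] card_consecutive[OF fin_on inj_on, of l] by (simp add: on_def)
  qed
  ultimately have cE: "card L * (k - 1) \<le> card E" by simp
  \<comment> \<open>Two distinct lines meet over one abscissa, and over it each line has only one
    segment; so the pair of lines determines the crossing.\<close>
  have "card crossings \<le> card (L \<times> L)"
  proof (rule card_inj_on_le[where f = "\<lambda>c. (par (fst c), par (snd c))"])
    show "inj_on (\<lambda>c. (par (fst c), par (snd c))) crossings"
    proof (rule inj_onI)
      fix c c' assume c: "c \<in> crossings" and c': "c' \<in> crossings"
        and eq: "(par (fst c), par (snd c)) = (par (fst c'), par (snd c'))"
      have ex: "\<exists>l m t. fst c \<in> consecutive (on l) \<and> snd c \<in> consecutive (on m) \<and>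
          crosses_at (fst c) (snd c) t \<and> fst c \<noteq> snd c" if "c \<in> crossings" for c
      proof -
        have "fst c \<in> E" "snd c \<in> E" "fst c \<noteq> snd c" "\<exists>t. crosses_at (fst c) (snd c) t"
          using that by (auto simp: crossings_def)
        then show ?thesis by (fastforce simp: E_def)
      qed
      obtain l m t where lm: "fst c \<in> consecutive (on l)" "snd c \<in> consecutive (on m)"
        and t: "crosses_at (fst c) (snd c) t" and ne: "fst c \<noteq> snd c"
        using ex[OF c] by blast
      obtain l' m' t' where lm': "fst c' \<in> consecutive (on l')" "snd c' \<in> consecutive (on m')"
        and t': "crosses_at (fst c') (snd c') t'"
        using ex[OF c'] by blast
      have same: "l' = l" "m' = m" using eq par lm lm' by auto
      note lm'' = lm'[unfolded same]
      have "l \<noteq> m"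
      proof
        assume "l = m"
        then have "fst c = snd c"
          using consecutive_unique[OF inj_on, of "fst c" l "snd c" t] lm t by (simp add: crosses_at_def)
        with ne show False by simp
      qed
      have "fst l * t + snd l = fst m * t + snd m"
        using t height[OF lm(1)] height[OF lm(2)] by (simp add: crosses_at_def)
      moreover have "fst l * t' + snd l = fst m * t' + snd m"
        using t' height[OF lm''(1)] height[OF lm''(2)] by (simp add: crosses_at_def)
      ultimately have "(fst l - fst m) * (t - t') = 0" and "fst l = fst m \<longrightarrow> snd l = snd m"
        by (simp add: algebra_simps, auto)
      then have "t = t'" using \<open>l \<noteq> m\<close> by (auto simp: prod_eq_iff)
      then have "fst c = fst c'" "snd c = snd c'"
        using consecutive_unique[OF inj_on lm(1) lm''(1), of t] consecutive_unique[OF inj_on lm(2) lm''(2), of t]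
          t t' by (simp_all add: crosses_at_def)
      then show "c = c'" by (simp add: prod_eq_iff)
    qed
    show "(\<lambda>c. (par (fst c), par (snd c))) ` crossings \<subseteq> L \<times> L"
    proof -
      have "par e \<in> L" if "e \<in> E" for e
        using that par unfolding E_def by (metis UN_E)
      moreover have "fst c \<in> E \<and> snd c \<in> E" if "c \<in> crossings" for c
        using that by (auto simp: crossings_def)
      ultimately show ?thesis by blast
    qed
  qed (use fin in auto)
  then have X: "card crossings \<le> card L ^ 2" by (simp add: card_cartesian_product power2_eq_square)
  define m n where "m = card L" and "n = card P"
  \<comment> \<open>Since \<open>k\<close> is at least 2, passing from \<open>k\<close> points to
    \<open>k - 1\<close> edges costs at most a factor 2.\<close>
  have "m * k \<le> 2 * (m * (k - 1))" using k(1) by (cases k) auto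
  moreover have "m * (k - 1) \<le> card E" using cE by (simp add: m_def)
  ultimately have mk: "m * k \<le> 2 * card E" by linarith
  have "m * k ^ 3 \<le> 512 * n ^ 2"
  proof (cases "4 * n \<le> card E")
    case True
    have "real (card E) ^ 3 \<le> real (64 * n ^ 2 * card crossings)"
      using crossing_lemma True by (simp add: n_def)
    then have "card E ^ 3 \<le> 64 * n ^ 2 * card crossings"
      unfolding of_nat_power[symmetric] of_nat_le_iff .
    also have "\<dots> \<le> 64 * n ^ 2 * m ^ 2" using X by (simp add: m_def)
    finally have e3: "card E ^ 3 \<le> 64 * n ^ 2 * m ^ 2" .
    have "(m * k) ^ 3 \<le> (2 * card E) ^ 3" by (rule power_mono[OF mk]) simp
    also have "\<dots> \<le> 512 * n ^ 2 * m ^ 2" using e3 by (simp add: power_mult_distrib ac_simps)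
    finally have "m ^ 2 * (m * k ^ 3) \<le> m ^ 2 * (512 * n ^ 2)"
      by (simp add: power_mult_distrib power_numeral_reduce algebra_simps)
    then show ?thesis by (cases "m = 0") auto
  next
    case False
    \<comment> \<open>With too few edges for the crossing lemma, the upper bound on
      \<open>k ^ 2\<close> supplies the missing factor and gives \<open>32 * n ^ 2\<close>.\<close>
    then have "m * k \<le> 8 * n" using mk by linarith
    from mult_le_mono[OF this k(2)] have "m * k * k ^ 2 \<le> 8 * n * (4 * n)"
      by (simp add: n_def)
    then show ?thesis by (simp add: power_numeral_reduce power2_eq_square algebra_simps)
  qed
  then show ?thesis by (simp add: m_def n_def)
qed

section \<open>Lines in the integer lattice\<close>

definition cross :: "int \<times> int \<Rightarrow> int \<times> int \<Rightarrow> int"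
  where "cross u v = fst u * snd v - snd u * fst v"

definition line :: "int \<times> int \<Rightarrow> int \<times> int \<Rightarrow> (int \<times> int) set"
  where "line x \<xi> = {y. cross \<xi> (y - x) = 0}"

definition lattice_lines :: "(int \<times> int) set set"
  where "lattice_lines = {line x \<xi> |x \<xi>. \<xi> \<noteq> 0}"

lemma cross_trans:
  assumes "cross u v = 0" "cross u w = 0" "u \<noteq> 0" shows "cross v w = 0"
proof -
  have "fst u * (fst v * snd w - snd v * fst w) = 0" "snd u * (fst v * snd w - snd v * fst w) = 0"
    using assms(1,2) unfolding cross_def by algebra+
  with assms(3) show ?thesis by (auto simp: cross_def prod_eq_iff)
qed

lemma cross_swap: "cross u v = 0 \<longleftrightarrow> cross v u = 0"
  by (auto simp: cross_def algebra_simps)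

lemma cross_diff: "cross u (v - w) = cross u v - cross u w"
  by (simp add: cross_def algebra_simps)

lemma line_through:
  assumes "\<xi> \<noteq> 0" "p \<in> line x \<xi>" "q \<in> line x \<xi>" "p \<noteq> q"
  shows "line x \<xi> = line p (q - p)"
proof (intro set_eqI iffI)
  have pq: "cross \<xi> (q - p) = 0"
    using assms(2,3) by (simp add: line_def cross_diff)
  fix z
  show "z \<in> line p (q - p)" if "z \<in> line x \<xi>"
  proof -
    have "cross \<xi> (z - p) = 0" using that assms(2) by (simp add: line_def cross_diff)
    from cross_trans[OF pq this assms(1)] show ?thesis by (simp add: line_def)
  qed
  show "z \<in> line x \<xi>" if "z \<in> line p (q - p)"
  proof -
    have "cross (q - p) (z - p) = 0" "cross (q - p) \<xi> = 0"
      using that pq by (simp_all add: line_def cross_swap)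
    from cross_trans[OF this(2) this(1)] assms(2,4) show ?thesis
      by (simp add: line_def cross_diff)
  qed
qed

lemma lattice_lines_eqI:
  assumes "l \<in> lattice_lines" "m \<in> lattice_lines" "p \<in> l" "p \<in> m" "q \<in> l" "q \<in> m" "p \<noteq> q"
  shows "l = m"
proof -
  have "l = line p (q - p)" "m = line p (q - p)"
    using assms line_through unfolding lattice_lines_def by blast+
  then show ?thesis by simp
qed

lemma card_inter_lines_le_1:
  assumes "l \<in> lattice_lines" "m \<in> lattice_lines" "l \<noteq> m"
  shows "card (l \<inter> m \<inter> S) \<le> 1"
proof (cases "finite (l \<inter> m \<inter> S)")
  case True
  have "p = q" if "p \<in> l \<inter> m \<inter> S" "q \<in> l \<inter> m \<inter> S" for p q
    using lattice_lines_eqI[of l m p q] that assms by auto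
  with True show ?thesis by (metis One_nat_def card_le_Suc0_iff_eq)
qed simp

section \<open>Incidence bounds for lattice lines\<close>

lemma two_elements:
  assumes "2 \<le> card B"
  obtains p q where "p \<in> B" "q \<in> B" "p \<noteq> q"
proof -
  have "finite B" using assms by (intro card_ge_0_finite) simp
  then show thesis
    using that assms card_le_Suc0_iff_eq[of B] by fastforce
qed

text \<open>The points are moved by an invertible linear map that makes all abscissae in
  \<open>S\<close> distinct; it preserves collinearity and turns every line with two points of
  \<open>S\<close> into a graph.\<close>

lemma lattice_szemeredi_trotter:
  assumes fin: "finite S" "finite A" and lines: "A \<subseteq> lattice_lines"
    and k: "2 \<le> k" "k ^ 2 \<le> 4 * card S" and rich: "\<And>l. l \<in> A \<Longrightarrow> k \<le> card (l \<inter> S)"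
  shows "card A * k ^ 3 \<le> 512 * card S ^ 2"
proof -
  \<comment> \<open>\<open>K\<close> exceeds every difference of second coordinates in
    \<open>S\<close>, so \<open>K * fst x + snd x\<close> separates the points of
    \<open>S\<close>.\<close>
  define K where "K = 1 + 2 * (\<Sum>x\<in>S. \<bar>snd x\<bar>)"
  have bound: "\<bar>snd x - snd y\<bar> < K" if "x \<in> S" "y \<in> S" for x y
    using member_le_sum[of x S "\<lambda>x. \<bar>snd x\<bar>"] member_le_sum[of y S "\<lambda>x. \<bar>snd x\<bar>"] that fin
    by (simp add: K_def)
  define X where "X x = K * fst x + snd x" for x :: "int \<times> int"
  have inj: "x = y" if "x \<in> S" "y \<in> S" "X x = X y" for x y
  proof -
    have eq: "K * (fst x - fst y) = snd y - snd x"
      using that(3) by (simp add: X_def algebra_simps)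
    have "fst x = fst y"
    proof (rule ccontr)
      assume "fst x \<noteq> fst y"
      then have "1 \<le> \<bar>fst x - fst y\<bar>" by simp
      then have "K * 1 \<le> K * \<bar>fst x - fst y\<bar>"
        by (intro mult_left_mono) (auto simp: K_def sum_nonneg)
      also have "\<dots> = \<bar>snd y - snd x\<bar>"
        unfolding eq[symmetric] by (simp add: abs_mult K_def sum_nonneg)
      finally show False using bound[OF that(2,1)] by simp
    qed
    with eq show ?thesis by (simp add: prod_eq_iff)
  qed
  have "0 \<le> (\<Sum>x\<in>S. \<bar>snd x\<bar>)" by (simp add: sum_nonneg)
  then have K0: "K \<noteq> 0" unfolding K_def by linarith
  define \<Phi> where "\<Phi> x = (real_of_int (X x), real_of_int (snd x))" for x
  define meets where "meets l p q \<longleftrightarrow> p \<in> l \<inter> S \<and> q \<in> l \<inter> S \<and> p \<noteq> q" for l p q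
  have ex: "\<exists>m c. \<forall>z\<in>S. real_of_int (snd z) = m * real_of_int (X z) + c \<longleftrightarrow> z \<in> l" if "l \<in> A" for l
  proof -
    have "2 \<le> card (l \<inter> S)" using rich[OF that] k(1) by linarith
    then obtain p q where pq: "p \<in> l" "p \<in> S" "q \<in> l" "q \<in> S" "p \<noteq> q"
      using two_elements by (metis IntD1 IntD2)
    have l: "l = line p (q - p)"
      using lines that pq line_through unfolding lattice_lines_def by blast
    have ne: "X q \<noteq> X p" using inj pq by blast
    define m where "m = real_of_int (snd q - snd p) / real_of_int (X q - X p)"
    define c where "c = real_of_int (snd p) - m * real_of_int (X p)"
    have "real_of_int (snd z) = m * real_of_int (X z) + c \<longleftrightarrow> z \<in> l" for z
    proof -
      have "real_of_int (snd z) = m * real_of_int (X z) + c \<longleftrightarrow>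
          real_of_int (snd z - snd p) = m * real_of_int (X z - X p)"
        by (auto simp: c_def algebra_simps)
      also have "\<dots> \<longleftrightarrow> real_of_int ((snd z - snd p) * (X q - X p)) = real_of_int ((snd q - snd p) * (X z - X p))"
        using ne by (auto simp: m_def field_simps)
      also have "\<dots> \<longleftrightarrow> (snd z - snd p) * (X q - X p) = (snd q - snd p) * (X z - X p)"
        by (rule of_int_eq_iff)
      \<comment> \<open>The linear map multiplies determinants by \<open>K\<close>, so collinearity
        is unchanged.\<close>
      also have "\<dots> \<longleftrightarrow> K * cross (q - p) (z - p) = 0"
        by (auto simp: X_def cross_def algebra_simps)
      finally show ?thesis using K0 by (simp add: l line_def)
    qed
    then show ?thesis by blast
  qed
  \<comment> \<open>Slope and intercept are chosen by their incidences with \<open>S\<close> alone;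
    as each line of \<open>A\<close> has two points of \<open>S\<close>, distinct lines still get
    distinct parameters.\<close>
  define par where "par l = (SOME mc. \<forall>z\<in>S. real_of_int (snd z) = fst mc * real_of_int (X z) + snd mc \<longleftrightarrow> z \<in> l)" for l
  have par: "real_of_int (snd z) = fst (par l) * real_of_int (X z) + snd (par l) \<longleftrightarrow> z \<in> l"
    if "l \<in> A" "z \<in> S" for l z
  proof -
    from ex[OF that(1)] obtain m c
      where "\<forall>z\<in>S. real_of_int (snd z) = m * real_of_int (X z) + c \<longleftrightarrow> z \<in> l" by blast
    then have "\<exists>mc. \<forall>z\<in>S. real_of_int (snd z) = fst mc * real_of_int (X z) + snd mc \<longleftrightarrow> z \<in> l"
      by (intro exI[of _ "(m, c)"]) simp
    from someI_ex[OF this] that(2) show ?thesis unfolding par_def by blast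
  qed
  have inj_par: "inj_on par A"
  proof (rule inj_onI)
    fix l m assume lm: "l \<in> A" "m \<in> A" "par l = par m"
    then have "l \<inter> S = m \<inter> S" using par[of l] par[of m] by auto
    moreover have "2 \<le> card (l \<inter> S)" using rich[OF lm(1)] k(1) by linarith
    then obtain p q where "p \<in> l \<inter> S" "q \<in> l \<inter> S" "p \<noteq> q"
      by (rule two_elements)
    ultimately show "l = m"
      using lattice_lines_eqI[of l m p q] lines lm by blast
  qed
  have inj_\<Phi>: "inj_on \<Phi> S"
    using inj by (auto simp: \<Phi>_def intro!: inj_onI)
  have "card (par ` A) * k ^ 3 \<le> 512 * card (\<Phi> ` S) ^ 2"
  proof (rule szemeredi_trotter)
    show "inj_on fst (\<Phi> ` S)"
      using inj by (auto simp: \<Phi>_def inj_on_def)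
    show "k ^ 2 \<le> 4 * card (\<Phi> ` S)" using k by (simp add: card_image[OF inj_\<Phi>])
    fix l assume "l \<in> par ` A"
    then obtain m where m: "m \<in> A" "l = par m" by auto
    have "k \<le> card (m \<inter> S)" by (rule rich[OF m(1)])
    also have "\<dots> = card (\<Phi> ` (m \<inter> S))"
      by (rule card_image[symmetric]) (rule inj_on_subset[OF inj_\<Phi>], auto)
    also have "\<dots> \<le> card {p \<in> \<Phi> ` S. snd p = fst l * fst p + snd l}"
      using fin par m by (intro card_mono) (auto simp: \<Phi>_def)
    finally show "k \<le> card {p \<in> \<Phi> ` S. snd p = fst l * fst p + snd l}" .
  qed (use fin k in auto)
  then show ?thesis by (simp add: card_image[OF inj_\<Phi>] card_image[OF inj_par])
qed

text \<open>Lines with between \<open>2 ^ i\<close> and \<open>2 ^ Suc i\<close> points number at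
  most \<open>512 * card S ^ 2 / (2 ^ i) ^ 3\<close>, so every dyadic scale contributes the same
  amount, with constant 8 * 512 = 4096. The sum over scales is the only source of the
  logarithm.\<close>

lemma third_moment_lines:
  assumes fin: "finite S" "finite A" and lines: "A \<subseteq> lattice_lines"
    and two: "\<And>l. l \<in> A \<Longrightarrow> 2 \<le> card (l \<inter> S)"
    and poor: "\<And>l. l \<in> A \<Longrightarrow> card (l \<inter> S) ^ 2 \<le> 4 * card S"
    and J: "\<And>l. l \<in> A \<Longrightarrow> card (l \<inter> S) < 2 ^ J"
  shows "(\<Sum>l\<in>A. card (l \<inter> S) ^ 3) \<le> 4096 * J * card S ^ 2"
proof -
  define B where "B i = {l \<in> A. 2 ^ i \<le> card (l \<inter> S) \<and> card (l \<inter> S) < 2 ^ Suc i}" for i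
  have cover: "A \<subseteq> (\<Union>i\<in>{..<J}. B i)"
  proof
    fix l assume l: "l \<in> A"
    then have "1 \<le> card (l \<inter> S)" using two[of l] by linarith
    then obtain i where i: "2 ^ i \<le> card (l \<inter> S)" "card (l \<inter> S) < 2 ^ Suc i"
      using ex_power_ivl1[of 2 "card (l \<inter> S)"] by auto
    moreover have "(2::nat) ^ i < 2 ^ J" using i(1) J[OF l] by linarith
    then have "i < J" by simp
    ultimately show "l \<in> (\<Union>i\<in>{..<J}. B i)" using l by (auto simp: B_def)
  qed
  have B: "(\<Sum>l\<in>B i. card (l \<inter> S) ^ 3) \<le> 4096 * card S ^ 2" for i
  \<comment> \<open>The scale \<open>i = 0\<close> would consist of lines with a single point, which
    \<open>two\<close> excludes; the remaining scales satisfy \<open>k \<ge> 2\<close>.\<close>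
  proof (cases "i = 0 \<or> B i = {}")
    case True
    then have "B i = {}" using two by (fastforce simp: B_def)
    then show ?thesis by simp
  next
    case False
    then obtain l where l: "l \<in> B i" by auto
    have "(2 ^ i) ^ 2 \<le> card (l \<inter> S) ^ 2"
      using l by (intro power_mono) (auto simp: B_def)
    also have "\<dots> \<le> 4 * card S" using l poor by (auto simp: B_def)
    finally have k2: "(2 ^ i) ^ 2 \<le> 4 * card S" .
    have "(2::nat) ^ 1 \<le> 2 ^ i" using False by (intro power_increasing) auto
    then have *: "card (B i) * (2 ^ i) ^ 3 \<le> 512 * card S ^ 2"
      using k2 lines by (intro lattice_szemeredi_trotter) (auto simp: B_def fin)
    have "(\<Sum>l\<in>B i. card (l \<inter> S) ^ 3) \<le> (\<Sum>l\<in>B i. (2 ^ Suc i) ^ 3)"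
      by (intro sum_mono power_mono) (auto simp: B_def)
    also have "\<dots> = 8 * (card (B i) * (2 ^ i) ^ 3)"
      by (simp add: power_mult_distrib)
    also have "\<dots> \<le> 4096 * card S ^ 2" using * by simp
    finally show ?thesis .
  qed
  have "(\<Sum>l\<in>A. card (l \<inter> S) ^ 3) \<le> (\<Sum>l\<in>A. \<Sum>i<J. if l \<in> B i then card (l \<inter> S) ^ 3 else 0)"
  proof (rule sum_mono)
    fix l assume "l \<in> A"
    then obtain i where "i < J" "l \<in> B i" using cover by auto
    then show "card (l \<inter> S) ^ 3 \<le> (\<Sum>i<J. if l \<in> B i then card (l \<inter> S) ^ 3 else 0)"
      using member_le_sum[of i "{..<J}" "\<lambda>i. if l \<in> B i then card (l \<inter> S) ^ 3 else 0"] by simp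
  qed
  also have "\<dots> = (\<Sum>i<J. \<Sum>l\<in>A. if l \<in> B i then card (l \<inter> S) ^ 3 else 0)"
    by (rule sum.swap)
  also have "\<dots> = (\<Sum>i<J. \<Sum>l\<in>B i. card (l \<inter> S) ^ 3)"
    by (rule sum.cong[OF refl]) (auto simp: B_def sum.If_cases[OF fin(2)] intro!: sum.cong)
  also have "\<dots> \<le> (\<Sum>i<J. 4096 * card S ^ 2)"
    by (intro sum_mono B)
  finally show ?thesis by simp
qed

text \<open>Cauchy-Schwarz over the points bounds the square of the number of incidences by
  \<open>card S\<close> times the sum of all pairwise intersections, and distinct lines share at
  most one point. Above the threshold 2 sqrt n the contribution of distinct pairs can be absorbed,
  so no logarithm appears.\<close>

lemma sum_rich_lines:
  assumes fin: "finite S" "finite A" and lines: "A \<subseteq> lattice_lines"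
    and rich: "\<And>l. l \<in> A \<Longrightarrow> 4 * card S < card (l \<inter> S) ^ 2"
  shows "(\<Sum>l\<in>A. card (l \<inter> S)) \<le> 2 * card S"
proof -
  define I n m where "I = (\<Sum>l\<in>A. real (card (l \<inter> S)))" and "n = real (card S)" and "m = real (card A)"
  define d where "d x = real (card {l \<in> A. x \<in> l})" for x
  have card_eq: "real (card (B \<inter> S)) = (\<Sum>x\<in>S. if x \<in> B then 1 else 0)" for B
    using fin by (simp add: sum.If_cases Int_def conj_commute)
  have d_eq: "d x = (\<Sum>l\<in>A. if x \<in> l then 1 else 0)" for x
    using fin by (simp add: d_def sum.If_cases Int_def)
  have "I = (\<Sum>x\<in>S. d x)"
    unfolding I_def card_eq d_eq by (rule sum.swap)
  then have "I ^ 2 \<le> n * (\<Sum>x\<in>S. d x ^ 2)"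
    using Cauchy_Schwarz_ineq_sum[of "\<lambda>_. 1" d S] by (simp add: n_def)
  also have "(\<Sum>x\<in>S. d x ^ 2) = (\<Sum>l\<in>A. \<Sum>k\<in>A. real (card (l \<inter> k \<inter> S)))"
  proof -
    have "d x ^ 2 = (\<Sum>l\<in>A. \<Sum>k\<in>A. if x \<in> l \<inter> k then 1 else 0)" for x
      unfolding d_eq power2_eq_square sum_product by (rule sum.cong[OF refl], rule sum.cong[OF refl]) auto
    then have "(\<Sum>x\<in>S. d x ^ 2) = (\<Sum>x\<in>S. \<Sum>l\<in>A. \<Sum>k\<in>A. if x \<in> l \<inter> k then 1 else 0)" by simp
    also have "\<dots> = (\<Sum>l\<in>A. \<Sum>x\<in>S. \<Sum>k\<in>A. if x \<in> l \<inter> k then 1 else 0)" by (rule sum.swap)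
    also have "\<dots> = (\<Sum>l\<in>A. \<Sum>k\<in>A. \<Sum>x\<in>S. if x \<in> l \<inter> k then 1 else 0)"
      by (rule sum.cong[OF refl]) (rule sum.swap)
    finally show ?thesis unfolding card_eq .
  qed
  also have "(\<Sum>l\<in>A. \<Sum>k\<in>A. real (card (l \<inter> k \<inter> S))) \<le> (\<Sum>l\<in>A. \<Sum>k\<in>A. (if k = l then real (card (l \<inter> S)) else 0) + 1)"
  proof (intro sum_mono)
    fix l k assume "l \<in> A" "k \<in> A"
    then show "real (card (l \<inter> k \<inter> S)) \<le> (if k = l then real (card (l \<inter> S)) else 0) + 1"
      using card_inter_lines_le_1[of l k S] lines by auto
  qed
  also have "\<dots> = I + m ^ 2"
    using fin by (simp add: sum.distrib I_def m_def power2_eq_square)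
  finally have 1: "I ^ 2 \<le> n * (I + m ^ 2)" by (simp add: n_def mult_left_mono)
  have "(\<Sum>l\<in>A. 2 * sqrt n) \<le> I"
    unfolding I_def
  proof (rule sum_mono)
    fix l assume "l \<in> A"
    then have "real (4 * card S) \<le> real (card (l \<inter> S) ^ 2)"
      using rich by (intro of_nat_mono) (simp add: less_imp_le)
    then have "sqrt (4 * n) \<le> sqrt (real (card (l \<inter> S)) ^ 2)"
      by (intro real_sqrt_le_mono) (simp add: n_def)
    then show "2 * sqrt n \<le> real (card (l \<inter> S))"
      by (simp add: real_sqrt_mult)
  qed
  then have "2 * m * sqrt n \<le> I" by (simp add: m_def)
  then have "(2 * m * sqrt n) ^ 2 \<le> I ^ 2"
    by (intro power_mono) (auto simp: m_def n_def)
  then have 2: "4 * (n * m ^ 2) \<le> I ^ 2"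
    by (simp add: power_mult_distrib n_def algebra_simps)
  \<comment> \<open>Richness makes the term \<open>n * m ^ 2\<close> at most a quarter of
    \<open>I ^ 2\<close>; it is moved to the left.\<close>
  have "3 * (I * I) \<le> 4 * n * I"
    using 1 2 by (simp add: algebra_simps power2_eq_square)
  moreover have "0 \<le> I" "0 \<le> n" by (auto simp: I_def n_def sum_nonneg)
  ultimately have "I \<le> 2 * n"
    by (cases "I = 0") (auto simp: mult_le_cancel_right simp flip: mult.assoc)
  then have "real (\<Sum>l\<in>A. card (l \<inter> S)) \<le> real (2 * card S)"
    by (simp add: I_def n_def)
  then show ?thesis by linarith
qed

section \<open>Level sets of a weight on the lattice\<close>

lemma sum_half_powers_le:
  fixes T :: "int set"
  assumes "finite T" "\<And>s. s \<in> T \<Longrightarrow> s \<le> m"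
  shows "(\<Sum>s\<in>T. (1 / 2 :: real) ^ nat (m - s)) \<le> 2"
proof -
  have inj: "inj_on (\<lambda>s. nat (m - s)) T"
  proof (rule inj_onI)
    fix s t assume "s \<in> T" "t \<in> T" "nat (m - s) = nat (m - t)"
    then show "s = t" using assms(2)[of s] assms(2)[of t] by simp
  qed
  have "(\<Sum>s\<in>T. (1 / 2 :: real) ^ nat (m - s)) = (\<Sum>n\<in>(\<lambda>s. nat (m - s)) ` T. (1 / 2) ^ n)"
    by (simp add: sum.reindex[OF inj])
  also have "\<dots> \<le> (\<Sum>n. (1 / 2 :: real) ^ n)"
    by (rule sum_le_suminf) (auto simp: assms)
  also have "\<dots> = 2" by (simp add: suminf_geometric)
  finally show ?thesis .
qed

section \<open>Sums with exponential decay between levels\<close>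

definition decay :: "int \<Rightarrow> real"
  where "decay d = (1 / 2) ^ nat \<bar>d\<bar>"

lemma decay_nonneg [simp]: "0 \<le> decay d"
  by (simp add: decay_def)

lemma decay_minus_commute: "decay (s - t) = decay (t - s)"
  by (simp add: decay_def abs_minus_commute)

lemma decay_powr: "decay d = 2 powr - \<bar>real_of_int d\<bar>"
proof -
  have "real_of_int \<bar>d\<bar> = real (nat \<bar>d\<bar>)" by simp
  then have "2 powr \<bar>real_of_int d\<bar> = (2 :: real) ^ nat \<bar>d\<bar>"
    by (metis of_int_abs powr_realpow zero_less_numeral)
  then show ?thesis by (simp add: decay_def powr_minus power_one_over inverse_eq_divide)
qed

lemma sum_decay_le:
  assumes "finite T" shows "(\<Sum>s\<in>T. decay (s - m)) \<le> 4"
proof -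
  have "(\<Sum>s\<in>T. decay (s - m)) = (\<Sum>s\<in>{s\<in>T. s \<le> m}. decay (s - m)) + (\<Sum>s\<in>{s\<in>T. \<not> s \<le> m}. decay (s - m))"
    using assms by (subst sum.union_disjoint[symmetric]) (auto intro!: sum.cong)
  moreover have "(\<Sum>s\<in>{s\<in>T. s \<le> m}. decay (s - m)) = (\<Sum>s\<in>{s\<in>T. s \<le> m}. (1 / 2) ^ nat (m - s))"
    by (rule sum.cong[OF refl]) (simp add: decay_def)
  moreover have "\<dots> \<le> 2" by (rule sum_half_powers_le) (auto simp: assms)
  moreover have "(\<Sum>s\<in>{s\<in>T. \<not> s \<le> m}. decay (s - m)) = (\<Sum>s\<in>uminus ` {s\<in>T. \<not> s \<le> m}. (1 / 2) ^ nat (- m - s))"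
    by (subst sum.reindex) (auto simp: decay_def intro!: sum.cong)
  moreover have "\<dots> \<le> 2" by (rule sum_half_powers_le) (auto simp: assms)
  ultimately show ?thesis by linarith
qed

lemma mult3_le_cubes:
  fixes x y z :: real
  assumes "0 \<le> x" "0 \<le> y" "0 \<le> z" shows "x * y * z \<le> x ^ 3 + y ^ 3 + z ^ 3"
proof -
  have "x ^ 3 + y ^ 3 + z ^ 3 - 3 * (x * y * z) =
      (x + y + z) * ((x - y) ^ 2 + (y - z) ^ 2 + (z - x) ^ 2) / 2"
    by (simp add: power2_eq_square power3_eq_cube algebra_simps)
  moreover have "\<dots> \<ge> 0" using assms by simp
  moreover have "0 \<le> x * y * z" using assms by simp
  ultimately show ?thesis by linarith
qed

text \<open>The product of three values is at most the sum of their cubes. For each cube the two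
  other levels are summed against the decay factors, each sum being at most 4; this gives 3 *
  16.\<close>

lemma sum_decay_cubes_le:
  fixes a :: "int \<Rightarrow> real"
  assumes fin: "finite T" and a: "\<And>s. s \<in> T \<Longrightarrow> 0 \<le> a s"
  shows "(\<Sum>s\<in>T. \<Sum>t\<in>T. \<Sum>u\<in>T. decay (s - t) * decay (s - u) * (a s * a t * a u)) \<le> 48 * (\<Sum>s\<in>T. a s ^ 3)"
proof -
  define D where "D s t u = decay (s - t) * decay (s - u)" for s t u
  define A where "A = (\<Sum>s\<in>T. a s ^ 3)"
  define P where "P = (\<Sum>s\<in>T. \<Sum>t\<in>T. \<Sum>u\<in>T. D s t u * a t ^ 3)"
  have sum1: "(\<Sum>u\<in>T. decay (s - u)) \<le> 4" for s
    using sum_decay_le[OF fin, of s] by (simp add: decay_minus_commute[of s])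
  have a3: "0 \<le> a s ^ 3" if "s \<in> T" for s using a[OF that] by simp
  have 1: "(\<Sum>s\<in>T. \<Sum>t\<in>T. \<Sum>u\<in>T. D s t u * a s ^ 3) \<le> 16 * A"
    unfolding A_def sum_distrib_left
  proof (rule sum_mono)
    fix s assume s: "s \<in> T"
    have "(\<Sum>t\<in>T. \<Sum>u\<in>T. D s t u * a s ^ 3) = (\<Sum>t\<in>T. decay (s - t)) * (\<Sum>u\<in>T. decay (s - u)) * a s ^ 3"
      unfolding sum_product[of "\<lambda>t. decay (s - t)"] by (simp only: sum_distrib_right D_def)
    also have "\<dots> \<le> (4 * 4) * a s ^ 3"
      by (rule mult_right_mono[OF mult_mono[OF sum1 sum1] a3[OF s]]) (simp_all add: sum_nonneg)
    finally show "(\<Sum>t\<in>T. \<Sum>u\<in>T. D s t u * a s ^ 3) \<le> 16 * a s ^ 3" by simp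
  qed
  have 2: "P \<le> 16 * A"
  proof -
    have "P = (\<Sum>s\<in>T. \<Sum>t\<in>T. (decay (s - t) * a t ^ 3) * (\<Sum>u\<in>T. decay (s - u)))"
      unfolding P_def D_def sum_distrib_left
      by (intro sum.cong[OF refl]) (simp add: mult.commute mult.left_commute)
    also have "\<dots> \<le> (\<Sum>s\<in>T. \<Sum>t\<in>T. (decay (s - t) * a t ^ 3) * 4)"
      by (rule sum_mono, rule sum_mono, rule mult_left_mono[OF sum1]) (auto intro!: mult_nonneg_nonneg a3)
    also have "\<dots> = (\<Sum>t\<in>T. \<Sum>s\<in>T. (decay (s - t) * a t ^ 3) * 4)"
      by (rule sum.swap)
    also have "\<dots> = (\<Sum>t\<in>T. (\<Sum>s\<in>T. decay (s - t)) * (a t ^ 3 * 4))"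
      unfolding sum_distrib_right by (simp only: mult.assoc)
    also have "\<dots> \<le> (\<Sum>t\<in>T. 4 * (a t ^ 3 * 4))"
      by (rule sum_mono, rule mult_right_mono[OF sum_decay_le[OF fin]]) (simp add: a)
    also have "\<dots> = 16 * A" unfolding A_def sum_distrib_left by simp
    finally show ?thesis .
  qed
  have 3: "(\<Sum>s\<in>T. \<Sum>t\<in>T. \<Sum>u\<in>T. D s t u * a u ^ 3) = P"
    unfolding P_def
  proof (rule sum.cong[OF refl])
    fix s
    have "(\<Sum>t\<in>T. \<Sum>u\<in>T. D s t u * a u ^ 3) = (\<Sum>u\<in>T. \<Sum>t\<in>T. D s t u * a u ^ 3)"
      by (rule sum.swap)
    then show "(\<Sum>t\<in>T. \<Sum>u\<in>T. D s t u * a u ^ 3) = (\<Sum>t\<in>T. \<Sum>u\<in>T. D s t u * a t ^ 3)"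
      by (simp add: D_def mult.commute)
  qed
  have "(\<Sum>s\<in>T. \<Sum>t\<in>T. \<Sum>u\<in>T. D s t u * (a s * a t * a u)) \<le>
      (\<Sum>s\<in>T. \<Sum>t\<in>T. \<Sum>u\<in>T. D s t u * (a s ^ 3 + a t ^ 3 + a u ^ 3))"
    by (rule sum_mono, rule sum_mono, rule sum_mono, rule mult_left_mono[OF mult3_le_cubes])
      (auto simp: D_def intro!: mult_nonneg_nonneg a)
  also have "\<dots> = (\<Sum>s\<in>T. \<Sum>t\<in>T. \<Sum>u\<in>T. D s t u * a s ^ 3) + P +
      (\<Sum>s\<in>T. \<Sum>t\<in>T. \<Sum>u\<in>T. D s t u * a u ^ 3)"
    unfolding P_def by (simp only: distrib_left sum.distrib)
  also have "\<dots> \<le> 48 * A" using 1 2 3 by linarith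
  finally show ?thesis by (simp only: D_def A_def)
qed

lemma sum_by_level:
  fixes \<phi> :: "int \<Rightarrow> real"
  assumes "finite G" "finite T" "lev ` G \<subseteq> T"
  shows "(\<Sum>x\<in>G. \<phi> (lev x)) = (\<Sum>s\<in>T. card {x \<in> G. lev x = s} * \<phi> s)"
proof -
  have "(\<Sum>x\<in>G. \<phi> (lev x)) = (\<Sum>s\<in>T. \<Sum>x\<in>{x \<in> G. lev x = s}. \<phi> (lev x))"
    by (rule sum.group[symmetric, OF assms])
  also have "\<dots> = (\<Sum>s\<in>T. card {x \<in> G. lev x = s} * \<phi> s)"
    by (rule sum.cong[OF refl]) simp
  finally show ?thesis .
qed

section \<open>Level sets of a weight, rich lines and lone points\<close>

locale profile =
  fixes S :: "(int \<times> int) set" and f :: "int \<times> int \<Rightarrow> real"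
  assumes finite_S: "finite S"
    and f_pos: "x \<in> S \<Longrightarrow> 0 < f x"
    and f_zero: "x \<notin> S \<Longrightarrow> f x = 0"
begin

lemma f_nonneg: "0 \<le> f x"
  using f_pos f_zero by (cases "x \<in> S") (auto simp: less_imp_le)

definition mass :: real
  where "mass = (\<Sum>x\<in>S. f x ^ 2)"

text \<open>The base \<^term>\<open>2 ^ 12 :: real\<close> makes all the fractional powers of the profile that occur below
  integral powers of two.\<close>

definition lev :: "int \<times> int \<Rightarrow> int"
  where "lev x = \<lfloor>log 2 (f x) / 12\<rfloor>"

definition upper :: "int \<Rightarrow> (int \<times> int) set"
  where "upper s = {y \<in> S. s \<le> lev y}"

text \<open>The threshold separates the two tools: rich lines satisfy the hypothesis of
  \<open>sum_rich_lines\<close>, the others the hypothesis \<open>poor\<close> of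
  \<open>third_moment_lines\<close>. It is relative to \<open>x\<close>, since each point is
  compared with its own level set.\<close>

definition rich :: "int \<times> int \<Rightarrow> (int \<times> int) set \<Rightarrow> bool"
  where "rich x l \<longleftrightarrow> 4 * card (upper (lev x)) < card (l \<inter> upper (lev x)) ^ 2"

text \<open>Points of higher levels are counted as well, which makes the lone point of a line unique.\<close>

definition lone :: "int \<times> int \<Rightarrow> (int \<times> int) set \<Rightarrow> bool"
  where "lone x l \<longleftrightarrow> card (l \<inter> upper (lev x)) \<le> 1"

definition good :: "int \<times> int \<Rightarrow> (int \<times> int) set \<Rightarrow> bool"
  where "good x l \<longleftrightarrow> \<not> rich x l \<and> \<not> lone x l"

lemma finite_upper: "finite (upper s)"
  using finite_S by (simp add: upper_def)

lemma lev_le: "x \<in> S \<Longrightarrow> 2 powr (12 * real_of_int (lev x)) \<le> f x"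
  and lev_ge: "x \<in> S \<Longrightarrow> f x \<le> 2 ^ 12 * 2 powr (12 * real_of_int (lev x))"
proof -
  assume x: "x \<in> S"
  have l: "12 * real_of_int (lev x) \<le> log 2 (f x)" "log 2 (f x) \<le> 12 * real_of_int (lev x) + 12"
    unfolding lev_def by linarith+
  have eq: "f x = 2 powr log 2 (f x)" using f_pos[OF x] by simp
  show "2 powr (12 * real_of_int (lev x)) \<le> f x"
    using l(1) by (subst eq) (intro powr_mono; simp)
  have "f x \<le> 2 powr (12 * real_of_int (lev x) + 12)"
    using l(2) by (subst eq) (intro powr_mono; simp)
  then show "f x \<le> 2 ^ 12 * 2 powr (12 * real_of_int (lev x))"
    by (simp add: powr_add)
qed

text \<open>A point is counted in all levels below its own, but the weights decrease geometrically
  downwards, so the top level dominates up to a factor 2.\<close>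

lemma energy_levels: "(\<Sum>s\<in>lev ` S. 2 powr (24 * real_of_int s) * card (upper s)) \<le> 2 * mass"
proof -
  have "(\<Sum>s\<in>lev ` S. 2 powr (24 * real_of_int s) * card (upper s)) =
      (\<Sum>s\<in>lev ` S. \<Sum>x\<in>S. if s \<le> lev x then 2 powr (24 * real_of_int s) else 0)"
    using finite_S by (simp add: upper_def sum.If_cases Int_def mult.commute)
  also have "\<dots> = (\<Sum>x\<in>S. \<Sum>s\<in>lev ` S. if s \<le> lev x then 2 powr (24 * real_of_int s) else 0)"
    by (rule sum.swap)
  also have "\<dots> \<le> (\<Sum>x\<in>S. 2 * f x ^ 2)"
  proof (rule sum_mono)
    fix x assume x: "x \<in> S"
    define T where "T = {s \<in> lev ` S. s \<le> lev x}"
    have "(\<Sum>s\<in>lev ` S. if s \<le> lev x then 2 powr (24 * real_of_int s) else 0) = (\<Sum>s\<in>T. 2 powr (24 * real_of_int s))"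
      using finite_S by (simp add: T_def sum.If_cases Int_def)
    also have "\<dots> \<le> (\<Sum>s\<in>T. 2 powr (24 * real_of_int (lev x)) * (1 / 2) ^ nat (lev x - s))"
    proof (rule sum_mono)
      fix s assume "s \<in> T"
      then have s: "s \<le> lev x" by (simp add: T_def)
      have "2 powr (24 * real_of_int s) \<le> 2 powr (24 * real_of_int (lev x) + - real (nat (lev x - s)))"
        using s by (intro powr_mono) auto
      also have "\<dots> = 2 powr (24 * real_of_int (lev x)) * (1 / 2) ^ nat (lev x - s)"
        unfolding powr_add powr_minus by (simp add: powr_realpow power_one_over inverse_eq_divide)
      finally show "2 powr (24 * real_of_int s) \<le> 2 powr (24 * real_of_int (lev x)) * (1 / 2) ^ nat (lev x - s)" .
    qed
    also have "\<dots> \<le> 2 powr (24 * real_of_int (lev x)) * 2"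
      unfolding sum_distrib_left[symmetric]
      by (intro mult_left_mono sum_half_powers_le) (auto simp: T_def finite_S)
    also have "2 powr (24 * real_of_int (lev x)) = (2 powr (12 * real_of_int (lev x))) ^ 2"
      by (simp add: power2_eq_square flip: powr_add)
    also have "\<dots> * 2 \<le> 2 * f x ^ 2"
      using lev_le[OF x] by (simp add: power_mono)
    finally show "(\<Sum>s\<in>lev ` S. if s \<le> lev x then 2 powr (24 * real_of_int s) else 0) \<le> 2 * f x ^ 2" .
  qed
  also have "\<dots> = 2 * mass" by (simp add: mass_def sum_distrib_left)
  finally show ?thesis .
qed

text \<open>For points of one level the rich lines do not depend on the point, so
  \<open>sum_rich_lines\<close> applies level by level and \<open>energy_levels\<close> adds up. The
  exponent 26 consists of 24 for rounding a square to its level and 1 for each of these two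
  bounds.\<close>

lemma rich_incidences:
  assumes A: "finite A" "A \<subseteq> lattice_lines"
  shows "(\<Sum>x\<in>S. f x ^ 2 * card {l \<in> A. x \<in> l \<and> rich x l}) \<le> 2 ^ 26 * mass"
proof -
  define R where "R s = {l \<in> A. 4 * card (upper s) < card (l \<inter> upper s) ^ 2}" for s
  have "(\<Sum>x\<in>S. f x ^ 2 * card {l \<in> A. x \<in> l \<and> rich x l}) =
      (\<Sum>s\<in>lev ` S. \<Sum>x\<in>{x \<in> S. lev x = s}. f x ^ 2 * card {l \<in> A. x \<in> l \<and> rich x l})"
    by (rule sum.image_gen[OF finite_S])
  also have "\<dots> \<le> (\<Sum>s\<in>lev ` S. 2 ^ 24 * 2 powr (24 * real_of_int s) * (2 * card (upper s)))"
  proof (rule sum_mono)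
    fix s
    have "(\<Sum>x\<in>{x \<in> S. lev x = s}. f x ^ 2 * card {l \<in> A. x \<in> l \<and> rich x l}) \<le>
        (\<Sum>x\<in>{x \<in> S. lev x = s}. 2 ^ 24 * 2 powr (24 * real_of_int s) * (\<Sum>l\<in>R s. if x \<in> l then 1 else 0))"
    proof (rule sum_mono)
      fix x assume "x \<in> {x \<in> S. lev x = s}"
      then have x: "x \<in> S" "lev x = s" by auto
      have "f x ^ 2 \<le> (2 ^ 12 * 2 powr (12 * real_of_int (lev x))) ^ 2"
        using lev_ge[OF x(1)] f_nonneg by (rule power_mono)
      also have "\<dots> = 2 ^ 24 * 2 powr (24 * real_of_int s)"
        by (simp add: x power_mult_distrib power2_eq_square flip: powr_add)
      moreover have "{l \<in> A. x \<in> l \<and> rich x l} = {l \<in> R s. x \<in> l}"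
        by (auto simp: R_def rich_def x)
      ultimately show "f x ^ 2 * card {l \<in> A. x \<in> l \<and> rich x l} \<le>
          2 ^ 24 * 2 powr (24 * real_of_int s) * (\<Sum>l\<in>R s. if x \<in> l then 1 else 0)"
        using A by (simp add: R_def sum.If_cases Int_def mult_right_mono)
    qed
    also have "\<dots> = 2 ^ 24 * 2 powr (24 * real_of_int s) * (\<Sum>l\<in>R s. \<Sum>x\<in>{x \<in> S. lev x = s}. if x \<in> l then 1 else 0)"
      by (subst sum.swap) (simp add: sum_distrib_left)
    also have "\<dots> \<le> 2 ^ 24 * 2 powr (24 * real_of_int s) * (\<Sum>l\<in>R s. real (card (l \<inter> upper s)))"
    proof (intro mult_left_mono sum_mono)
      fix l
      have "(\<Sum>x\<in>{x \<in> S. lev x = s}. if x \<in> l then 1 else 0 :: real) = card ({x \<in> S. lev x = s} \<inter> l)"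
        using finite_S by (simp add: sum.If_cases)
      also have "\<dots> \<le> card (l \<inter> upper s)"
        using finite_upper by (intro of_nat_mono card_mono) (auto simp: upper_def)
      finally show "(\<Sum>x\<in>{x \<in> S. lev x = s}. if x \<in> l then 1 else 0) \<le> real (card (l \<inter> upper s))" .
    qed simp
    also have "\<dots> \<le> 2 ^ 24 * 2 powr (24 * real_of_int s) * (2 * card (upper s))"
    proof (intro mult_left_mono)
      have "(\<Sum>l\<in>R s. card (l \<inter> upper s)) \<le> 2 * card (upper s)"
        using A by (intro sum_rich_lines finite_upper) (auto simp: R_def)
      then have "real (\<Sum>l\<in>R s. card (l \<inter> upper s)) \<le> real (2 * card (upper s))"
        by (rule of_nat_mono)
      then show "(\<Sum>l\<in>R s. real (card (l \<inter> upper s))) \<le> real (2 * card (upper s))" by simp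
    qed simp
    finally show "(\<Sum>x\<in>{x \<in> S. lev x = s}. f x ^ 2 * card {l \<in> A. x \<in> l \<and> rich x l}) \<le>
        2 ^ 24 * 2 powr (24 * real_of_int s) * (2 * card (upper s))" .
  qed
  also have "\<dots> = 2 ^ 25 * (\<Sum>s\<in>lev ` S. 2 powr (24 * real_of_int s) * card (upper s))"
    unfolding sum_distrib_left by (rule sum.cong[OF refl]) simp
  also have "\<dots> \<le> 2 ^ 25 * (2 * mass)"
    by (intro mult_left_mono energy_levels) simp
  finally show ?thesis by simp
qed

text \<open>Of two lone points on a line, the one of lower level would also count the other.\<close>

lemma lone_unique:
  assumes "x \<in> S" "y \<in> S" "x \<in> l" "y \<in> l" "lone x l" "lone y l"
  shows "x = y"
proof -
  have *: "x = y" if "x \<in> S" "y \<in> S" "x \<in> l" "y \<in> l" "lone x l" "lev x \<le> lev y" for x y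
  proof -
    have "x \<in> l \<inter> upper (lev x)" "y \<in> l \<inter> upper (lev x)"
      using that by (auto simp: upper_def)
    moreover have "finite (l \<inter> upper (lev x))" by (simp add: finite_upper)
    ultimately show ?thesis
      using that(5) card_le_Suc0_iff_eq[of "l \<inter> upper (lev x)"] by (auto simp: lone_def)
  qed
  show ?thesis using *[of x y] *[of y x] assms by (cases "lev x \<le> lev y") auto
qed

text \<open>One side at the corner \<open>x\<close> carries the value at its far end and half,
  multiplicatively, of the smallest value of a rectangle. Taking the minimum instead of
  \<open>f x\<close> is what later penalises unequal levels.\<close>

definition weight :: "int \<times> int \<Rightarrow> int \<times> int \<Rightarrow> real"
  where "weight x y = f y * sqrt (min (f x) (f y))"

text \<open>With levels s, t, u of x, y, z, the exponent 12 (s + t + u) + 6 min s t + 6 min s u is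
  at most 16 (s + t + u) - |s - t| - |s - u|. Thus the expression is a balanced product with decay.
  Rounding costs 12 for each of three values and 6 for each of two square roots, in total
  48.\<close>

lemma weight_levels:
  assumes "x \<in> S" "y \<in> S" "z \<in> S"
  shows "f x * weight x y * weight x z \<le> 2 ^ 48 * (decay (lev x - lev y) * decay (lev x - lev z) *
    (2 powr (16 * real_of_int (lev x)) * 2 powr (16 * real_of_int (lev y)) * 2 powr (16 * real_of_int (lev z))))"
proof -
  have sq: "sqrt (min (f x) (f y)) \<le> 2 powr (6 + 6 * real_of_int (min (lev x) (lev y)))"
    if "x \<in> S" "y \<in> S" for x y
  proof -
    have "min (f x) (f y) \<le> 2 powr (12 + 12 * real_of_int (min (lev x) (lev y)))"
      using lev_ge[OF that(1)] lev_ge[OF that(2)] by (auto simp: min_def powr_add split: if_splits)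
    also have "\<dots> = (2 powr (6 + 6 * real_of_int (min (lev x) (lev y)))) ^ 2"
      by (simp add: power2_eq_square flip: powr_add)
    finally show ?thesis by (intro real_le_lsqrt) auto
  qed
  have le: "f x \<le> 2 powr (12 + 12 * real_of_int (lev x))" if "x \<in> S" for x
    using lev_ge[OF that] by (simp add: powr_add)
  have w: "weight x y \<le> 2 powr (12 + 12 * real_of_int (lev y)) * 2 powr (6 + 6 * real_of_int (min (lev x) (lev y)))"
    if "x \<in> S" "y \<in> S" for x y
    unfolding weight_def using le[OF that(2)] sq[OF that] f_nonneg by (intro mult_mono) auto
  have w0: "0 \<le> weight x y" for x y by (simp add: weight_def f_nonneg)
  have "f x * weight x y * weight x z \<le> 2 powr (12 + 12 * real_of_int (lev x)) *
      (2 powr (12 + 12 * real_of_int (lev y)) * 2 powr (6 + 6 * real_of_int (min (lev x) (lev y)))) *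
      (2 powr (12 + 12 * real_of_int (lev z)) * 2 powr (6 + 6 * real_of_int (min (lev x) (lev z))))"
    by (rule mult_mono[OF mult_mono[OF le w] w]) (simp_all add: assms w0 f_nonneg)
  also have "\<dots> = 2 powr (48 + 12 * real_of_int (lev x) + 12 * real_of_int (lev y) + 12 * real_of_int (lev z) +
      6 * real_of_int (min (lev x) (lev y)) + 6 * real_of_int (min (lev x) (lev z)))"
    by (simp add: ac_simps flip: powr_add)
  also have "\<dots> \<le> 2 powr (48 + (- \<bar>real_of_int (lev x - lev y)\<bar> + - \<bar>real_of_int (lev x - lev z)\<bar> +
      (16 * real_of_int (lev x) + 16 * real_of_int (lev y) + 16 * real_of_int (lev z))))"
    by (rule powr_mono) (simp_all add: min_def abs_if)
  also have "\<dots> = 2 ^ 48 * (decay (lev x - lev y) * decay (lev x - lev z) *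
    (2 powr (16 * real_of_int (lev x)) * 2 powr (16 * real_of_int (lev y)) * 2 powr (16 * real_of_int (lev z))))"
    by (simp only: decay_powr powr_add mult.assoc) simp
  finally show ?thesis .
qed

text \<open>The expanded square runs over triples on one line. Grouped by level it has the shape of
  \<open>sum_decay_cubes_le\<close> with the number of good points at level s times 2^(16 s), so
  only triples of equal level matter.\<close>

lemma good_line_sum:
  assumes G: "G = {x \<in> S \<inter> l. good x l}"
  shows "(\<Sum>x\<in>G. f x * (\<Sum>y\<in>G. weight x y) ^ 2) \<le>
    2 ^ 54 * (\<Sum>s\<in>lev ` S. 2 powr (48 * real_of_int s) * card {x \<in> G. lev x = s} ^ 3)"
proof -
  define T where "T = lev ` S"
  have T: "finite T" "lev ` G \<subseteq> T" using finite_S by (auto simp: T_def G)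
  have finG: "finite G" using finite_S by (simp add: G)
  define N where "N s = real (card {x \<in> G. lev x = s})" for s
  define g where "g s = 2 powr (16 * real_of_int s)" for s
  have "(\<Sum>x\<in>G. f x * (\<Sum>y\<in>G. weight x y) ^ 2) = (\<Sum>x\<in>G. \<Sum>y\<in>G. \<Sum>z\<in>G. f x * weight x y * weight x z)"
    unfolding power2_eq_square sum_product by (simp only: sum_distrib_left mult.assoc)
  also have "\<dots> \<le> (\<Sum>x\<in>G. \<Sum>y\<in>G. \<Sum>z\<in>G. 2 ^ 48 * (decay (lev x - lev y) * decay (lev x - lev z) *
      (g (lev x) * g (lev y) * g (lev z))))"
    unfolding g_def by (rule sum_mono, rule sum_mono, rule sum_mono, rule weight_levels) (auto simp: G)
  also have "\<dots> = 2 ^ 48 * (\<Sum>x\<in>G. \<Sum>y\<in>G. \<Sum>z\<in>G. decay (lev x - lev y) * decay (lev x - lev z) *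
      (g (lev x) * g (lev y) * g (lev z)))"
    by (simp only: sum_distrib_left)
  also have "(\<Sum>x\<in>G. \<Sum>y\<in>G. \<Sum>z\<in>G. decay (lev x - lev y) * decay (lev x - lev z) *
      (g (lev x) * g (lev y) * g (lev z))) =
      (\<Sum>s\<in>T. N s * (\<Sum>t\<in>T. N t * (\<Sum>u\<in>T. N u * (decay (s - t) * decay (s - u) * (g s * g t * g u)))))"
  proof -
    have "(\<Sum>z\<in>G. decay (lev x - lev y) * decay (lev x - lev z) * (g (lev x) * g (lev y) * g (lev z))) =
        (\<Sum>u\<in>T. N u * (decay (lev x - lev y) * decay (lev x - u) * (g (lev x) * g (lev y) * g u)))" for x y
      unfolding N_def
      by (rule sum_by_level[OF finG T, of "\<lambda>u. decay (lev x - lev y) * decay (lev x - u) * (g (lev x) * g (lev y) * g u)"])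
    then have "(\<Sum>y\<in>G. \<Sum>z\<in>G. decay (lev x - lev y) * decay (lev x - lev z) * (g (lev x) * g (lev y) * g (lev z))) =
        (\<Sum>y\<in>G. \<Sum>u\<in>T. N u * (decay (lev x - lev y) * decay (lev x - u) * (g (lev x) * g (lev y) * g u)))" for x
      by simp
    also have "\<dots> x = (\<Sum>t\<in>T. N t * (\<Sum>u\<in>T. N u * (decay (lev x - t) * decay (lev x - u) * (g (lev x) * g t * g u))))" for x
      unfolding N_def
      by (rule sum_by_level[OF finG T, of "\<lambda>t. \<Sum>u\<in>T. real (card {x \<in> G. lev x = u}) * (decay (lev x - t) * decay (lev x - u) * (g (lev x) * g t * g u))"])
    finally have "(\<Sum>x\<in>G. \<Sum>y\<in>G. \<Sum>z\<in>G. decay (lev x - lev y) * decay (lev x - lev z) * (g (lev x) * g (lev y) * g (lev z))) =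
        (\<Sum>x\<in>G. \<Sum>t\<in>T. N t * (\<Sum>u\<in>T. N u * (decay (lev x - t) * decay (lev x - u) * (g (lev x) * g t * g u))))"
      by simp
    also have "\<dots> = (\<Sum>s\<in>T. N s * (\<Sum>t\<in>T. N t * (\<Sum>u\<in>T. N u * (decay (s - t) * decay (s - u) * (g s * g t * g u)))))"
      unfolding N_def
      by (rule sum_by_level[OF finG T, of "\<lambda>s. \<Sum>t\<in>T. real (card {x \<in> G. lev x = t}) *
        (\<Sum>u\<in>T. real (card {x \<in> G. lev x = u}) * (decay (s - t) * decay (s - u) * (g s * g t * g u)))"])
    finally show ?thesis .
  qed
  also have "\<dots> = (\<Sum>s\<in>T. \<Sum>t\<in>T. \<Sum>u\<in>T. decay (s - t) * decay (s - u) * ((N s * g s) * (N t * g t) * (N u * g u)))"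
    by (simp add: sum_distrib_left ac_simps)
  also have "2 ^ 48 * \<dots> \<le> 2 ^ 48 * (48 * (\<Sum>s\<in>T. (N s * g s) ^ 3))"
    by (rule mult_left_mono[OF sum_decay_cubes_le[OF T(1)]]) (simp_all add: N_def g_def)
  also have "(\<Sum>s\<in>T. (N s * g s) ^ 3) = (\<Sum>s\<in>T. 2 powr (48 * real_of_int s) * N s ^ 3)"
    by (rule sum.cong[OF refl]) (simp add: power_mult_distrib g_def power3_eq_cube flip: powr_add)
  \<comment> \<open>The factor 48 is rounded up to \<open>2 ^ 6\<close>.\<close>
  also have "2 ^ 48 * (48 * \<dots>) \<le> 2 ^ 54 * \<dots>"
    by (simp add: sum_nonneg N_def)
  finally show ?thesis by (simp add: T_def N_def)
qed

end

section \<open>Rectangles\<close>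

lemma sum_squares_le_square_sum:
  fixes u :: "'a \<Rightarrow> real"
  assumes "finite A" "\<And>i. i \<in> A \<Longrightarrow> 0 \<le> u i"
  shows "(\<Sum>i\<in>A. u i ^ 2) \<le> (\<Sum>i\<in>A. u i) ^ 2"
proof -
  have "(\<Sum>i\<in>A. u i * u i) \<le> (\<Sum>i\<in>A. u i * (\<Sum>j\<in>A. u j))"
    using assms by (intro sum_mono mult_left_mono member_le_sum) auto
  then show ?thesis by (simp add: power2_eq_square sum_distrib_right)
qed

context profile begin

text \<open>A line with a good point of level s has at least two and at most 2 sqrt n points of the
  level set with n points, which is the range of \<open>third_moment_lines\<close>. Its bound, of
  order n^2, matches the square of the energy 2^(24 s) n of the level.\<close>

lemma good_lines_sum:
  assumes A: "finite A" "A \<subseteq> lattice_lines" and J: "card S < 2 ^ J"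
  shows "(\<Sum>l\<in>A. \<Sum>x\<in>{x \<in> S \<inter> l. good x l}. f x * (\<Sum>y\<in>{y \<in> S \<inter> l. good y l}. weight x y) ^ 2)
    \<le> 2 ^ 68 * J * mass ^ 2"
proof -
  define N where "N s l = card {x \<in> {x \<in> S \<inter> l. good x l}. lev x = s}" for s l
  define R where "R s = {l \<in> A. 2 \<le> card (l \<inter> upper s) \<and> card (l \<inter> upper s) ^ 2 \<le> 4 * card (upper s)}" for s
  have N: "(\<Sum>l\<in>A. real (N s l) ^ 3) \<le> 4096 * J * real (card (upper s)) ^ 2" for s
  proof -
    have "(\<Sum>l\<in>A. N s l ^ 3) \<le> (\<Sum>l\<in>A. if l \<in> R s then card (l \<inter> upper s) ^ 3 else 0)"
    proof (rule sum_mono)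
      fix l assume l: "l \<in> A"
      show "N s l ^ 3 \<le> (if l \<in> R s then card (l \<inter> upper s) ^ 3 else 0)"
      proof (cases "N s l = 0")
        case False
        then have "{x \<in> {x \<in> S \<inter> l. good x l}. lev x = s} \<noteq> {}"
          unfolding N_def by (metis card.empty)
        then obtain x where "x \<in> S" "x \<in> l" "good x l" "lev x = s" by auto
        then have "l \<in> R s"
          using l by (auto simp: R_def good_def rich_def lone_def)
        moreover have "N s l \<le> card (l \<inter> upper s)"
          unfolding N_def using finite_upper by (intro card_mono) (auto simp: upper_def)
        ultimately show ?thesis by (simp add: power_mono)
      qed simp
    qed
    also have "\<dots> = (\<Sum>l\<in>R s. card (l \<inter> upper s) ^ 3)"
      using A by (auto simp: R_def sum.If_cases intro!: sum.cong)
    also have "\<dots> \<le> 4096 * J * card (upper s) ^ 2"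
    proof (rule third_moment_lines)
      show "card (l \<inter> upper s) < 2 ^ J" for l
      proof -
        have "card (l \<inter> upper s) \<le> card S"
          by (rule card_mono[OF finite_S]) (auto simp: upper_def)
        with J show ?thesis by linarith
      qed
    qed (use A finite_upper in \<open>auto simp: R_def\<close>)
    finally have "real (\<Sum>l\<in>A. N s l ^ 3) \<le> real (4096 * J * card (upper s) ^ 2)"
      by (rule of_nat_mono)
    then show ?thesis by simp
  qed
  have "(\<Sum>l\<in>A. \<Sum>x\<in>{x \<in> S \<inter> l. good x l}. f x * (\<Sum>y\<in>{y \<in> S \<inter> l. good y l}. weight x y) ^ 2) \<le>
      (\<Sum>l\<in>A. 2 ^ 54 * (\<Sum>s\<in>lev ` S. 2 powr (48 * real_of_int s) * N s l ^ 3))"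
    unfolding N_def by (rule sum_mono) (rule good_line_sum[OF refl])
  also have "\<dots> = 2 ^ 54 * (\<Sum>s\<in>lev ` S. 2 powr (48 * real_of_int s) * (\<Sum>l\<in>A. real (N s l) ^ 3))"
    unfolding sum_distrib_left by (subst sum.swap) simp
  also have "\<dots> \<le> 2 ^ 54 * (\<Sum>s\<in>lev ` S. 2 powr (48 * real_of_int s) * (4096 * J * real (card (upper s)) ^ 2))"
    by (intro mult_left_mono sum_mono N) auto
  also have "\<dots> = 2 ^ 66 * J * (\<Sum>s\<in>lev ` S. (2 powr (24 * real_of_int s) * card (upper s)) ^ 2)"
  proof -
    have "2 powr (48 * real_of_int s) = (2 powr (24 * real_of_int s)) ^ 2" for s
      by (simp add: power2_eq_square flip: powr_add)
    then show ?thesis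
      unfolding sum_distrib_left by (intro sum.cong[OF refl]) (simp add: power_mult_distrib)
  qed
  \<comment> \<open>The levels enter through a sum of squares of energies, which is at most the
    square of the total energy; this is why summing over levels is free.\<close>
  also have "\<dots> \<le> 2 ^ 66 * J * (\<Sum>s\<in>lev ` S. 2 powr (24 * real_of_int s) * card (upper s)) ^ 2"
    by (intro mult_left_mono sum_squares_le_square_sum) (auto simp: finite_S)
  also have "\<dots> \<le> 2 ^ 66 * J * (2 * mass) ^ 2"
    by (intro mult_left_mono power_mono energy_levels) (auto intro: sum_nonneg)
  finally show ?thesis by (simp add: power_mult_distrib)
qed

lemma mass_nonneg: "0 \<le> mass"
  by (simp add: mass_def sum_nonneg)

lemma sum_inj_le_mass:
  assumes "finite I" "inj_on h I" shows "(\<Sum>i\<in>I. f (h i) ^ 2) \<le> mass"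
proof -
  have "(\<Sum>i\<in>I. f (h i) ^ 2) = (\<Sum>y\<in>h ` I. f y ^ 2)"
    by (simp add: sum.reindex[OF assms(2)])
  also have "\<dots> = (\<Sum>y\<in>h ` I \<inter> S. f y ^ 2)"
    using assms(1) by (intro sum.mono_neutral_right) (auto simp: f_zero)
  also have "\<dots> \<le> mass"
    unfolding mass_def by (rule sum_mono2[OF finite_S]) auto
  finally show ?thesis .
qed

end

section \<open>Geometry of the bilinear form\<close>

definition bform :: "int \<Rightarrow> int \<Rightarrow> int \<times> int \<Rightarrow> int \<times> int \<Rightarrow> int"
  where "bform a b \<xi> \<eta> = a * fst \<xi> * fst \<eta> + b * snd \<xi> * snd \<eta>"

lemma bform_add: "bform a b \<xi> (u + v) = bform a b \<xi> u + bform a b \<xi> v"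
  and bform_diff: "bform a b \<xi> (u - v) = bform a b \<xi> u - bform a b \<xi> v"
  and bform_minus: "bform a b \<xi> (- u) = - bform a b \<xi> u"
  and bform_minus_left: "bform a b (- \<xi>) u = - bform a b \<xi> u"
  and bform_commute: "bform a b \<xi> u = bform a b u \<xi>"
  by (simp_all add: bform_def algebra_simps)

lemma cross_perp_perp: "cross (b * snd \<xi>, - a * fst \<xi>) (b * snd \<xi>', - a * fst \<xi>') = a * b * cross \<xi> \<xi>'"
  by (simp add: cross_def algebra_simps)

lemma bform_parallel:
  assumes "cross \<xi> \<xi>' = 0" "\<xi> \<noteq> 0" "bform a b \<xi> w = 0" shows "bform a b \<xi>' w = 0"
proof -
  have "fst \<xi> * bform a b \<xi>' w = 0" "snd \<xi> * bform a b \<xi>' w = 0"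
    using assms(1,3) unfolding cross_def bform_def by algebra+
  with assms(2) show ?thesis by (auto simp: prod_eq_iff)
qed

lemma line_eqI:
  assumes "cross \<xi> \<xi>' = 0" "\<xi> \<noteq> 0" "\<xi>' \<noteq> 0" "cross \<xi> (y - x) = 0"
  shows "line x \<xi> = line y \<xi>'"
proof -
  have "cross \<xi> (z - x) = 0 \<longleftrightarrow> cross \<xi>' (z - y) = 0" for z
  proof -
    have "cross \<xi> (z - x) = cross \<xi> (z - y)" using assms(4) by (simp add: cross_diff)
    moreover have "cross \<xi> (z - y) = 0 \<longleftrightarrow> cross \<xi>' (z - y) = 0"
      using cross_trans[OF assms(1) _ assms(2), of "z - y"] cross_trans[of \<xi>' \<xi> "z - y"] assms
      by (auto simp: cross_swap)
    ultimately show ?thesis by simp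
  qed
  then show ?thesis by (simp add: line_def)
qed

lemma line_eqD:
  assumes "line x \<xi> = line x \<xi>'" shows "cross \<xi> \<xi>' = 0"
proof -
  have "x + \<xi>' \<in> line x \<xi>'" by (simp add: line_def cross_def)
  then have "x + \<xi>' \<in> line x \<xi>" using assms by simp
  then show ?thesis by (simp add: line_def)
qed

text \<open>Anisotropy makes the orthogonal complement of a direction transversal to it, so two
  nonzero orthogonal sides always span a genuine rectangle.\<close>

locale rectangles = profile +
  fixes a b :: int
  assumes anisotropic: "bform a b \<xi> \<xi> = 0 \<Longrightarrow> \<xi> = 0"
begin

abbreviation B where "B \<equiv> bform a b"

text \<open>A spanning vector of the complement of \<xi> with respect to \<open>B\<close>; by
  \<open>cross_perp\<close> the columns, which are the lines in this direction, are the level lines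
  of \<open>B \<xi>\<close>.\<close>

definition perp :: "int \<times> int \<Rightarrow> int \<times> int"
  where "perp \<xi> = (b * snd \<xi>, - a * fst \<xi>)"

lemma cross_perp: "cross (perp \<xi>) v = B \<xi> v"
  by (simp add: cross_def perp_def bform_def)

lemma ab_nonzero: "a \<noteq> 0" "b \<noteq> 0"
  using anisotropic[of "(1, 0)"] anisotropic[of "(0, 1)"] by (auto simp: bform_def zero_prod_def)

lemma perp_eq_0_iff [simp]: "perp \<xi> = 0 \<longleftrightarrow> \<xi> = 0"
  using ab_nonzero by (auto simp: perp_def prod_eq_iff)

definition row where "row x \<xi> = line x \<xi>"
definition col where "col x \<xi> = line x (perp \<xi>)"

lemma row_eqI: "cross \<xi> \<xi>' = 0 \<Longrightarrow> \<xi> \<noteq> 0 \<Longrightarrow> \<xi>' \<noteq> 0 \<Longrightarrow> cross \<xi> (y - x) = 0 \<Longrightarrow> row x \<xi> = row y \<xi>'"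
  unfolding row_def by (rule line_eqI)

lemma col_eqI:
  assumes "cross \<xi> \<xi>' = 0" "\<xi> \<noteq> 0" "\<xi>' \<noteq> 0" "B \<xi> (y - x) = 0" shows "col x \<xi> = col y \<xi>'"
proof -
  have "cross (perp \<xi>) (perp \<xi>') = a * b * cross \<xi> \<xi>'"
    by (simp only: perp_def cross_perp_perp)
  then show ?thesis
    unfolding col_def using assms by (intro line_eqI) (auto simp: cross_perp)
qed

lemma row_eq_col:
  assumes "B \<xi> \<eta> = 0" "\<xi> \<noteq> 0" "\<eta> \<noteq> 0" shows "row x \<eta> = col x \<xi>"
proof -
  have "cross (perp \<xi>) \<eta> = 0"
    using assms(1) by (simp add: cross_perp)
  then have "cross \<eta> (perp \<xi>) = 0" by (subst cross_swap)
  then show ?thesis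
    unfolding row_def col_def by (rule line_eqI) (simp_all add: assms cross_def)
qed

lemma col_eq_row:
  assumes "B \<xi> \<eta> = 0" "\<xi> \<noteq> 0" "\<eta> \<noteq> 0" shows "col x \<eta> = row x \<xi>"
  using row_eq_col[of \<eta> \<xi>] assms by (simp add: bform_commute)

lemma row_eq_iff:
  assumes "\<xi> \<noteq> 0" "\<xi>' \<noteq> 0" shows "row x \<xi> = row x \<xi>' \<longleftrightarrow> cross \<xi> \<xi>' = 0"
proof
  show "cross \<xi> \<xi>' = 0" if "row x \<xi> = row x \<xi>'"
    using that unfolding row_def by (rule line_eqD)
  show "row x \<xi> = row x \<xi>'" if "cross \<xi> \<xi>' = 0"
    using that assms by (rule row_eqI) (simp add: cross_def)
qed

lemma col_eq_iff:
  assumes "\<xi> \<noteq> 0" "\<xi>' \<noteq> 0" shows "col x \<xi> = col x \<xi>' \<longleftrightarrow> cross \<xi> \<xi>' = 0"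
proof -
  have "cross (perp \<xi>) (perp \<xi>') = a * b * cross \<xi> \<xi>'"
    by (simp only: perp_def cross_perp_perp)
  then show ?thesis
    using row_eq_iff[of "perp \<xi>" "perp \<xi>'" x] assms ab_nonzero by (simp add: row_def col_def)
qed

definition D where "D = (\<lambda>p. snd p - fst p) ` (S \<times> S) - {0}"

lemma finite_D: "finite D"
  using finite_S by (simp add: D_def)

lemma zero_notin_D [simp]: "0 \<notin> D" by (simp add: D_def)

lemma D_nonzero: "\<xi> \<in> D \<Longrightarrow> \<xi> \<noteq> 0" by auto

lemma diff_in_D:
  assumes "x \<in> S" "y \<in> S" "x \<noteq> y" shows "y - x \<in> D"
proof -
  have "y - x = snd (x, y) - fst (x, y)" "(x, y) \<in> S \<times> S" "y - x \<noteq> 0" using assms by simp_all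
  then show ?thesis unfolding D_def by blast
qed

lemma minus_D:
  assumes "\<xi> \<in> D" shows "- \<xi> \<in> D"
proof -
  obtain p where "p \<in> S \<times> S" "\<xi> = snd p - fst p" "\<xi> \<noteq> 0"
    using assms unfolding D_def by blast
  then have "fst p - snd p \<in> D" "- \<xi> = fst p - snd p"
    by (auto intro!: diff_in_D simp: mem_Times_iff)
  then show ?thesis by simp
qed

text \<open>The weight of a vertex may depend on the direction of the sides, because it will be set to zero
  where the row or the column through the vertex is exceptional.\<close>

definition rect_form :: "(int \<times> int \<Rightarrow> int \<times> int \<Rightarrow> real) \<Rightarrow> real"
  where "rect_form F = (\<Sum>\<xi>\<in>D. \<Sum>x\<in>S. \<Sum>y\<in>{y \<in> S. B \<xi> y = B \<xi> x} - {x}.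
    (F \<xi> x * F \<xi> (x + \<xi>)) * (F \<xi> y * F \<xi> (y + \<xi>)))"

text \<open>For a fixed direction, the inner sum runs over the sides starting on one column. The
  square pairs these sides independently, including each with itself, and so is open to
  Cauchy-Schwarz and to splitting of \<open>F\<close>.\<close>

definition square_form :: "(int \<times> int \<Rightarrow> int \<times> int \<Rightarrow> real) \<Rightarrow> (int \<times> int \<Rightarrow> int \<times> int \<Rightarrow> real) \<Rightarrow> real"
  where "square_form F G = (\<Sum>\<xi>\<in>D. \<Sum>c\<in>B \<xi> ` S. (\<Sum>x\<in>{x \<in> S. B \<xi> x = c}. F \<xi> x * G \<xi> (x + \<xi>)) ^ 2)"

section \<open>Splitting and diagonal bounds for square forms\<close>

lemma column_sums:
  fixes u v :: "int \<times> int \<Rightarrow> real"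
  shows "(\<Sum>c\<in>B \<xi> ` S. (\<Sum>x\<in>{x \<in> S. B \<xi> x = c}. u x) * (\<Sum>y\<in>{y \<in> S. B \<xi> y = c}. v y)) =
    (\<Sum>x\<in>S. \<Sum>y\<in>{y \<in> S. B \<xi> y = B \<xi> x}. u x * v y)"
proof -
  have "(\<Sum>c\<in>B \<xi> ` S. (\<Sum>x\<in>{x \<in> S. B \<xi> x = c}. u x) * (\<Sum>y\<in>{y \<in> S. B \<xi> y = c}. v y)) =
      (\<Sum>c\<in>B \<xi> ` S. \<Sum>x\<in>{x \<in> S. B \<xi> x = c}. \<Sum>y\<in>{y \<in> S. B \<xi> y = B \<xi> x}. u x * v y)"
    unfolding sum_product by (rule sum.cong[OF refl], rule sum.cong[OF refl]) simp
  also have "\<dots> = (\<Sum>x\<in>S. \<Sum>y\<in>{y \<in> S. B \<xi> y = B \<xi> x}. u x * v y)"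
    by (rule sum.image_gen[symmetric, OF finite_S])
  finally show ?thesis .
qed

lemma square_form_eq_rect_form: "square_form F F = rect_form F + (\<Sum>\<xi>\<in>D. \<Sum>x\<in>S. (F \<xi> x * F \<xi> (x + \<xi>)) ^ 2)"
proof -
  have "square_form F F = (\<Sum>\<xi>\<in>D. \<Sum>x\<in>S. \<Sum>y\<in>{y \<in> S. B \<xi> y = B \<xi> x}.
      (F \<xi> x * F \<xi> (x + \<xi>)) * (F \<xi> y * F \<xi> (y + \<xi>)))"
    unfolding square_form_def power2_eq_square column_sums ..
  also have "\<dots> = (\<Sum>\<xi>\<in>D. \<Sum>x\<in>S. (F \<xi> x * F \<xi> (x + \<xi>)) ^ 2 + (\<Sum>y\<in>{y \<in> S. B \<xi> y = B \<xi> x} - {x}.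
      (F \<xi> x * F \<xi> (x + \<xi>)) * (F \<xi> y * F \<xi> (y + \<xi>))))"
    using finite_S by (intro sum.cong[OF refl]) (simp add: sum.remove power2_eq_square)
  finally show ?thesis by (simp add: rect_form_def sum.distrib)
qed

text \<open>For a fixed end \<open>x\<close> the other end \<open>x + \<xi>\<close> determines
  \<xi>, so the inner sum is at most \<open>mass\<close>.\<close>

lemma diagonal_le:
  assumes "\<And>\<xi> x. 0 \<le> F \<xi> x \<and> F \<xi> x \<le> f x" "\<And>\<xi> x. 0 \<le> G \<xi> x \<and> G \<xi> x \<le> f x"
  shows "(\<Sum>\<xi>\<in>D. \<Sum>x\<in>S. (F \<xi> x * G \<xi> (x + \<xi>)) ^ 2) \<le> mass ^ 2"
proof -
  have "(\<Sum>\<xi>\<in>D. \<Sum>x\<in>S. (F \<xi> x * G \<xi> (x + \<xi>)) ^ 2) \<le> (\<Sum>\<xi>\<in>D. \<Sum>x\<in>S. (f x * f (x + \<xi>)) ^ 2)"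
    using assms f_nonneg by (intro sum_mono power_mono mult_mono) auto
  also have "\<dots> = (\<Sum>x\<in>S. f x ^ 2 * (\<Sum>\<xi>\<in>D. f (x + \<xi>) ^ 2))"
    by (subst sum.swap) (simp add: sum_distrib_left power_mult_distrib)
  also have "\<dots> \<le> (\<Sum>x\<in>S. f x ^ 2 * mass)"
    by (intro sum_mono mult_left_mono sum_inj_le_mass finite_D) auto
  also have "\<dots> = mass ^ 2"
    unfolding mass_def power2_eq_square[of "sum _ _"] sum_distrib_right ..
  finally show ?thesis .
qed

text \<open>A product of two values of \<open>F = H + g\<close> is at most
  \<open>H H + g F + F g\<close>, and the square of three terms costs a factor 3.\<close>

lemma square_form_split:
  assumes H: "\<And>\<xi> x. 0 \<le> H \<xi> x" and g: "\<And>\<xi> x. 0 \<le> g \<xi> x" and F: "\<And>\<xi> x. F \<xi> x = H \<xi> x + g \<xi> x"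
  shows "square_form F F \<le> 3 * square_form H H + 3 * square_form g F + 3 * square_form F g"
proof -
  have F0: "0 \<le> F \<xi> x" for \<xi> x using H g F by simp
  have "(\<Sum>x\<in>{x \<in> S. B \<xi> x = c}. F \<xi> x * F \<xi> (x + \<xi>)) ^ 2 \<le>
      3 * (\<Sum>x\<in>{x \<in> S. B \<xi> x = c}. H \<xi> x * H \<xi> (x + \<xi>)) ^ 2 +
      3 * (\<Sum>x\<in>{x \<in> S. B \<xi> x = c}. g \<xi> x * F \<xi> (x + \<xi>)) ^ 2 +
      3 * (\<Sum>x\<in>{x \<in> S. B \<xi> x = c}. F \<xi> x * g \<xi> (x + \<xi>)) ^ 2"
    (is "?Z ^ 2 \<le> 3 * ?X ^ 2 + 3 * ?Y ^ 2 + 3 * ?W ^ 2") for \<xi> c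
  proof -
    have "F \<xi> x * F \<xi> (x + \<xi>) \<le> H \<xi> x * H \<xi> (x + \<xi>) + g \<xi> x * F \<xi> (x + \<xi>) + F \<xi> x * g \<xi> (x + \<xi>)" for x
      using H[of \<xi> x] H[of \<xi> "x + \<xi>"] g[of \<xi> x] g[of \<xi> "x + \<xi>"] by (simp add: F algebra_simps)
    then have "?Z \<le> ?X + ?Y + ?W"
      unfolding sum.distrib[symmetric] by (rule sum_mono)
    moreover have "0 \<le> ?Z" using F0 by (intro sum_nonneg) simp
    ultimately have "?Z ^ 2 \<le> (?X + ?Y + ?W) ^ 2" by (rule power_mono)
    also have "\<dots> \<le> 3 * ?X ^ 2 + 3 * ?Y ^ 2 + 3 * ?W ^ 2"
    proof -
      have "0 \<le> (X - Y) ^ 2 + (Y - W) ^ 2 + (X - W) ^ 2" for X Y W :: real by simp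
      then have "(X + Y + W) ^ 2 \<le> 3 * X ^ 2 + 3 * Y ^ 2 + 3 * W ^ 2" for X Y W :: real
        by (simp add: power2_eq_square algebra_simps)
      then show ?thesis .
    qed
    finally show ?thesis .
  qed
  then show ?thesis
    unfolding square_form_def sum_distrib_left sum.distrib[symmetric] by (intro sum_mono)
qed

text \<open>Only two diagonally opposite corners \<open>x\<close> and \<open>y + \<xi>\<close>
  survive; together with the axes at one of them they determine the rectangle.\<close>

lemma square_form_Cauchy_Schwarz:
  "square_form F G \<le> (\<Sum>\<xi>\<in>D. \<Sum>x\<in>S. \<Sum>y\<in>{y \<in> S. B \<xi> y = B \<xi> x}. F \<xi> x ^ 2 * G \<xi> (y + \<xi>) ^ 2)"
  unfolding square_form_def column_sums[symmetric] by (intro sum_mono Cauchy_Schwarz_ineq_sum)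

text \<open>If every column carries at most one nonzero term, the square of the sum is the sum of
  the squares, so only the diagonal remains.\<close>

lemma square_form_single_le:
  assumes F: "\<And>\<xi> x. 0 \<le> F \<xi> x \<and> F \<xi> x \<le> f x" "\<And>\<xi> x. 0 \<le> G \<xi> x \<and> G \<xi> x \<le> f x"
    and single: "\<And>\<xi> x y. \<xi> \<in> D \<Longrightarrow> x \<in> S \<Longrightarrow> y \<in> S \<Longrightarrow> B \<xi> x = B \<xi> y \<Longrightarrow>
      F \<xi> x * G \<xi> (x + \<xi>) \<noteq> 0 \<Longrightarrow> F \<xi> y * G \<xi> (y + \<xi>) \<noteq> 0 \<Longrightarrow> x = y"
  shows "square_form F G \<le> mass ^ 2"
proof -
  have "square_form F G = (\<Sum>\<xi>\<in>D. \<Sum>c\<in>B \<xi> ` S. \<Sum>x\<in>{x \<in> S. B \<xi> x = c}. (F \<xi> x * G \<xi> (x + \<xi>)) ^ 2)"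
    unfolding square_form_def
  proof (rule sum.cong[OF refl], rule sum.cong[OF refl])
    fix \<xi> c assume \<xi>: "\<xi> \<in> D"
    define A where "A = {x \<in> S. B \<xi> x = c}"
    define u where "u x = F \<xi> x * G \<xi> (x + \<xi>)" for x
    have fin: "finite A" using finite_S by (simp add: A_def)
    have "(\<Sum>x\<in>A. u x) ^ 2 = (\<Sum>x\<in>A. u x ^ 2)"
    proof (cases "\<exists>x\<in>A. u x \<noteq> 0")
      case True
      then obtain x where x: "x \<in> A" "u x \<noteq> 0" by auto
      have "u y = 0" if "y \<in> A" "y \<noteq> x" for y
        using single[OF \<xi>, of x y] that x by (auto simp: A_def u_def)
      then have "(\<Sum>x\<in>A. u x) = u x" "(\<Sum>x\<in>A. u x ^ 2) = u x ^ 2"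
        using fin x by (auto simp: sum.remove[of A x])
      then show ?thesis by simp
    qed (simp add: fin)
    then show "(\<Sum>x\<in>{x \<in> S. B \<xi> x = c}. F \<xi> x * G \<xi> (x + \<xi>)) ^ 2 =
        (\<Sum>x\<in>{x \<in> S. B \<xi> x = c}. (F \<xi> x * G \<xi> (x + \<xi>)) ^ 2)"
      by (simp add: A_def u_def)
  qed
  also have "\<dots> = (\<Sum>\<xi>\<in>D. \<Sum>x\<in>S. (F \<xi> x * G \<xi> (x + \<xi>)) ^ 2)"
    by (rule sum.cong[OF refl]) (rule sum.image_gen[symmetric, OF finite_S])
  also have "\<dots> \<le> mass ^ 2" by (rule diagonal_le[OF F])
  finally show ?thesis .
qed

text \<open>The difference is parallel to \<xi> and orthogonal to it, hence zero by
  anisotropy.\<close>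

lemma parallel_eq:
  assumes "cross \<xi> \<xi>' = 0" "\<xi> \<noteq> 0" "B \<xi> (\<xi> - \<xi>') = 0" shows "\<xi> = \<xi>'"
proof -
  have "cross \<xi> (\<xi> - \<xi>') = 0" using assms(1) by (simp add: cross_def algebra_simps)
  from bform_parallel[OF this assms(2,3)] have "\<xi> - \<xi>' = 0" by (rule anisotropic)
  then show ?thesis by simp
qed

section \<open>Removal of vertices on rich lines\<close>

definition in_rich :: "int \<times> int \<Rightarrow> int \<times> int \<Rightarrow> bool"
  where "in_rich \<xi> x \<longleftrightarrow> rich x (row x \<xi>) \<or> rich x (col x \<xi>)"

definition side_lines :: "(int \<times> int) set set"
  where "side_lines = (\<lambda>p. line (fst p) (snd p)) ` (S \<times> (D \<union> perp ` D))"

lemma finite_side_lines: "finite side_lines"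
  using finite_S finite_D by (simp add: side_lines_def)

lemma side_lines_lattice_lines: "side_lines \<subseteq> lattice_lines"
proof
  fix l assume "l \<in> side_lines"
  then obtain p where "p \<in> S \<times> (D \<union> perp ` D)" "l = line (fst p) (snd p)"
    unfolding side_lines_def by blast
  then obtain x \<xi> where "l = line x \<xi>" "\<xi> \<in> D \<union> perp ` D" by (auto simp: mem_Times_iff)
  moreover from this have "\<xi> \<noteq> 0" by (metis D_nonzero UnE image_iff perp_eq_0_iff)
  ultimately show "l \<in> lattice_lines" unfolding lattice_lines_def by blast
qed

lemma row_in_side_lines: "x \<in> S \<Longrightarrow> \<xi> \<in> D \<Longrightarrow> row x \<xi> \<in> side_lines"
  unfolding side_lines_def row_def by (rule image_eqI[of _ _ "(x, \<xi>)"]) auto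

lemma col_in_side_lines: "x \<in> S \<Longrightarrow> \<xi> \<in> D \<Longrightarrow> col x \<xi> \<in> side_lines"
  unfolding side_lines_def col_def by (rule image_eqI[of _ _ "(x, perp \<xi>)"]) auto

lemma mem_row: "x \<in> row x \<xi>" and mem_col: "x \<in> col x \<xi>"
  by (simp_all add: row_def col_def line_def cross_def)

definition rich_count :: "int \<times> int \<Rightarrow> nat"
  where "rich_count x = card {l \<in> side_lines. x \<in> l \<and> rich x l}"

text \<open>A direction is exceptional through its row or through its column. Either line determines
  the other, so each rich line accounts for at most two rows; \<open>h\<close> recovers the row from
  the column.\<close>

lemma card_in_rich_rows:
  assumes x: "x \<in> S" shows "card (row x ` {\<xi> \<in> D. in_rich \<xi> x}) \<le> 2 * rich_count x"
proof -
  define Z1 Z2 where "Z1 = {\<xi> \<in> D. rich x (row x \<xi>)}" and "Z2 = {\<xi> \<in> D. rich x (col x \<xi>)}"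
  define h where "h l = row x (SOME \<xi>. \<xi> \<in> Z2 \<and> col x \<xi> = l)" for l
  have fin: "finite Z1" "finite Z2" using finite_D by (auto simp: Z1_def Z2_def)
  have finR: "finite {l \<in> side_lines. x \<in> l \<and> rich x l}" using finite_side_lines by simp
  have "{\<xi> \<in> D. in_rich \<xi> x} = Z1 \<union> Z2" by (auto simp: Z1_def Z2_def in_rich_def)
  then have "card (row x ` {\<xi> \<in> D. in_rich \<xi> x}) \<le> card (row x ` Z1) + card (row x ` Z2)"
    by (simp add: image_Un card_Un_le)
  also have "card (row x ` Z1) \<le> rich_count x"
    unfolding rich_count_def using x
    by (intro card_mono finR) (auto simp: Z1_def mem_row intro: row_in_side_lines simp del: split_paired_All)
  also have "card (row x ` Z2) \<le> rich_count x"
  proof -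
    have "row x \<xi> = h (col x \<xi>)" if "\<xi> \<in> Z2" for \<xi>
    proof -
      define \<xi>' where "\<xi>' = (SOME \<xi>'. \<xi>' \<in> Z2 \<and> col x \<xi>' = col x \<xi>)"
      have "\<xi>' \<in> Z2 \<and> col x \<xi>' = col x \<xi>"
        unfolding \<xi>'_def by (rule someI_ex) (use that in blast)
      moreover have "h (col x \<xi>) = row x \<xi>'" by (simp add: h_def \<xi>'_def)
      ultimately have \<xi>': "\<xi>' \<in> Z2" "col x \<xi>' = col x \<xi>" "h (col x \<xi>) = row x \<xi>'" by simp_all
      then have "row x \<xi>' = row x \<xi>"
        using that by (subst row_eq_iff) (auto simp: Z2_def D_nonzero col_eq_iff)
      with \<xi>' show ?thesis by simp
    qed
    then have "row x ` Z2 \<subseteq> h ` (col x ` Z2)" by auto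
    then have "card (row x ` Z2) \<le> card (h ` (col x ` Z2))"
      by (intro card_mono finite_imageI fin)
    also have "\<dots> \<le> card (col x ` Z2)" by (intro card_image_le finite_imageI fin)
    also have "\<dots> \<le> rich_count x"
      unfolding rich_count_def using x
      by (intro card_mono finR) (auto simp: Z2_def mem_col intro: col_in_side_lines simp del: split_paired_All)
    finally show ?thesis .
  qed
  finally show ?thesis by simp
qed

text \<open>Parallel directions share one row through \<open>x\<close>, and within such a class
  \<open>h\<close> tells all pairs apart, so the class contributes at most \<open>mass\<close>. The
  number of classes is controlled by \<open>card_in_rich_rows\<close>.\<close>

lemma sum_rich_directions:
  assumes x: "x \<in> S" and fin: "\<And>\<xi>. finite (Y \<xi>)"
    and inj: "\<And>\<xi> \<xi>' y y'. \<xi> \<in> D \<Longrightarrow> \<xi>' \<in> D \<Longrightarrow> cross \<xi> \<xi>' = 0 \<Longrightarrow> y \<in> Y \<xi> \<Longrightarrow> y' \<in> Y \<xi>' \<Longrightarrow>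
      h \<xi> y = h \<xi>' y' \<Longrightarrow> \<xi> = \<xi>' \<and> y = y'"
  shows "(\<Sum>\<xi>\<in>{\<xi> \<in> D. in_rich \<xi> x}. \<Sum>y\<in>Y \<xi>. f (h \<xi> y) ^ 2) \<le> 2 * rich_count x * mass"
proof -
  define Z where "Z = {\<xi> \<in> D. in_rich \<xi> x}"
  have finZ: "finite Z" using finite_D by (simp add: Z_def)
  have "(\<Sum>\<xi>\<in>Z. \<Sum>y\<in>Y \<xi>. f (h \<xi> y) ^ 2) =
      (\<Sum>l\<in>row x ` Z. \<Sum>\<xi>\<in>{\<xi> \<in> Z. row x \<xi> = l}. \<Sum>y\<in>Y \<xi>. f (h \<xi> y) ^ 2)"
    by (rule sum.image_gen[OF finZ])
  also have "\<dots> \<le> (\<Sum>l\<in>row x ` Z. mass)"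
  proof (rule sum_mono)
    fix l
    have "(\<Sum>\<xi>\<in>{\<xi> \<in> Z. row x \<xi> = l}. \<Sum>y\<in>Y \<xi>. f (h \<xi> y) ^ 2) =
        (\<Sum>p\<in>(SIGMA \<xi>:{\<xi> \<in> Z. row x \<xi> = l}. Y \<xi>). f (h (fst p) (snd p)) ^ 2)"
      using finZ fin by (subst sum.Sigma) (auto simp: case_prod_unfold)
    also have "\<dots> \<le> mass"
    proof (rule sum_inj_le_mass)
      show "inj_on (\<lambda>p. h (fst p) (snd p)) (SIGMA \<xi>:{\<xi> \<in> Z. row x \<xi> = l}. Y \<xi>)"
      proof (rule inj_onI)
        fix p p' assume p: "p \<in> (SIGMA \<xi>:{\<xi> \<in> Z. row x \<xi> = l}. Y \<xi>)" "p' \<in> (SIGMA \<xi>:{\<xi> \<in> Z. row x \<xi> = l}. Y \<xi>)"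
          and eq: "h (fst p) (snd p) = h (fst p') (snd p')"
        have D: "fst p \<in> D" "fst p' \<in> D" and Y: "snd p \<in> Y (fst p)" "snd p' \<in> Y (fst p')"
          and row: "row x (fst p) = row x (fst p')"
          using p by (auto simp: Z_def)
        from row have "cross (fst p) (fst p') = 0"
          using D D_nonzero row_eq_iff by blast
        from inj[OF D this Y eq] show "p = p'" by (simp add: prod_eq_iff)
      qed
    qed (use finZ fin in auto)
    finally show "(\<Sum>\<xi>\<in>{\<xi> \<in> Z. row x \<xi> = l}. \<Sum>y\<in>Y \<xi>. f (h \<xi> y) ^ 2) \<le> mass" .
  qed
  also have "\<dots> = card (row x ` Z) * mass" by simp
  also have "\<dots> \<le> (2 * rich_count x) * mass"
  proof (rule mult_right_mono[OF _ mass_nonneg])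
    show "real (card (row x ` Z)) \<le> 2 * rich_count x"
      using of_nat_mono[OF card_in_rich_rows[OF x], where 'a = real] by (simp add: Z_def)
  qed
  finally show ?thesis by (simp add: Z_def)
qed

lemma sum_rich_count: "(\<Sum>x\<in>S. f x ^ 2 * (2 * rich_count x * mass)) \<le> 2 ^ 27 * mass ^ 2"
proof -
  have "(\<Sum>x\<in>S. f x ^ 2 * (2 * rich_count x * mass)) = 2 * mass * (\<Sum>x\<in>S. f x ^ 2 * rich_count x)"
    unfolding sum_distrib_left by (rule sum.cong[OF refl]) simp
  also have "\<dots> \<le> 2 * mass * (2 ^ 26 * mass)"
    unfolding rich_count_def
    by (intro mult_left_mono rich_incidences finite_side_lines side_lines_lattice_lines) (simp add: mass_nonneg)
  finally show ?thesis by (simp add: power2_eq_square)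
qed

text \<open>After Cauchy-Schwarz the exceptional corner is \<open>x\<close> and the opposite one
  \<open>y + \<xi>\<close>. With the axes at \<open>x\<close> fixed, the opposite corner determines
  the rectangle, which is the injectivity required by \<open>sum_rich_directions\<close>.\<close>

lemma square_form_rich_left:
  assumes g: "\<And>\<xi> x. g \<xi> x = (if in_rich \<xi> x then f x else 0)" and G: "\<And>\<xi> x. 0 \<le> G \<xi> x \<and> G \<xi> x \<le> f x"
  shows "square_form g G \<le> 2 ^ 27 * mass ^ 2"
proof -
  have "square_form g G \<le> (\<Sum>\<xi>\<in>D. \<Sum>x\<in>S. \<Sum>y\<in>{y \<in> S. B \<xi> y = B \<xi> x}. g \<xi> x ^ 2 * G \<xi> (y + \<xi>) ^ 2)"
    by (rule square_form_Cauchy_Schwarz)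
  also have "\<dots> \<le> (\<Sum>\<xi>\<in>D. \<Sum>x\<in>S. \<Sum>y\<in>{y \<in> S. B \<xi> y = B \<xi> x}. g \<xi> x ^ 2 * f (y + \<xi>) ^ 2)"
    using G by (intro sum_mono mult_left_mono power_mono) auto
  also have "\<dots> = (\<Sum>x\<in>S. \<Sum>\<xi>\<in>D. if in_rich \<xi> x then f x ^ 2 * (\<Sum>y\<in>{y \<in> S. B \<xi> y = B \<xi> x}. f (y + \<xi>) ^ 2) else 0)"
    by (subst sum.swap) (rule sum.cong[OF refl], rule sum.cong[OF refl], simp add: g sum_distrib_left)
  also have "\<dots> = (\<Sum>x\<in>S. f x ^ 2 * (\<Sum>\<xi>\<in>{\<xi> \<in> D. in_rich \<xi> x}. \<Sum>y\<in>{y \<in> S. B \<xi> y = B \<xi> x}. f (y + \<xi>) ^ 2))"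
    using finite_D by (intro sum.cong[OF refl]) (simp add: sum.If_cases sum_distrib_left Int_def)
  also have "\<dots> \<le> (\<Sum>x\<in>S. f x ^ 2 * (2 * rich_count x * mass))"
  proof (intro sum_mono mult_left_mono)
    fix x assume x: "x \<in> S"
    show "(\<Sum>\<xi>\<in>{\<xi> \<in> D. in_rich \<xi> x}. \<Sum>y\<in>{y \<in> S. B \<xi> y = B \<xi> x}. f (y + \<xi>) ^ 2) \<le> 2 * rich_count x * mass"
    proof (rule sum_rich_directions[OF x])
      fix \<xi> \<xi>' y y'
      assume D: "\<xi> \<in> D" "\<xi>' \<in> D" and par: "cross \<xi> \<xi>' = 0"
        and y: "y \<in> {y \<in> S. B \<xi> y = B \<xi> x}" "y' \<in> {y \<in> S. B \<xi>' y = B \<xi>' x}" and eq: "y + \<xi> = y' + \<xi>'"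
      have "B \<xi>' (y' - x) = 0" using y by (simp add: bform_diff)
      then have "B \<xi> (y' - x) = 0"
        using bform_parallel[of \<xi>' \<xi>] par D D_nonzero by (metis cross_swap)
      then have "B \<xi> (y' - y) = 0" using y by (simp add: bform_diff)
      moreover have "\<xi> - \<xi>' = y' - y" using eq by (simp add: algebra_simps)
      ultimately have "\<xi> = \<xi>'" using parallel_eq[OF par D_nonzero[OF D(1)]] by simp
      with eq show "\<xi> = \<xi>' \<and> y = y'" by simp
    qed (use finite_S in simp)
  qed simp
  also have "\<dots> \<le> 2 ^ 27 * mass ^ 2" by (rule sum_rich_count)
  finally show ?thesis .
qed

lemma square_form_rich_right:
  assumes g: "\<And>\<xi> x. g \<xi> x = (if in_rich \<xi> x then f x else 0)" and F: "\<And>\<xi> x. 0 \<le> F \<xi> x \<and> F \<xi> x \<le> f x"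
  shows "square_form F g \<le> 2 ^ 27 * mass ^ 2"
proof -
  \<comment> \<open>Now the exceptional corner is the far one, \<open>z = y + \<xi>\<close>. The sum
    is reorganised around \<open>z\<close>, and \<open>x\<close> becomes the opposite corner that
    has to determine the rectangle.\<close>
  define \<Phi> where "\<Phi> \<xi> z = g \<xi> z ^ 2 * (\<Sum>x\<in>{x \<in> S. B \<xi> (x + \<xi>) = B \<xi> z}. f x ^ 2)" for \<xi> z
  have \<Phi>0: "0 \<le> \<Phi> \<xi> z" for \<xi> z by (simp add: \<Phi>_def sum_nonneg)
  have "square_form F g \<le> (\<Sum>\<xi>\<in>D. \<Sum>x\<in>S. \<Sum>y\<in>{y \<in> S. B \<xi> y = B \<xi> x}. F \<xi> x ^ 2 * g \<xi> (y + \<xi>) ^ 2)"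
    by (rule square_form_Cauchy_Schwarz)
  also have "\<dots> \<le> (\<Sum>\<xi>\<in>D. \<Sum>x\<in>S. \<Sum>y\<in>{y \<in> S. B \<xi> y = B \<xi> x}. f x ^ 2 * g \<xi> (y + \<xi>) ^ 2)"
    using F by (intro sum_mono mult_right_mono power_mono) auto
  also have "\<dots> = (\<Sum>\<xi>\<in>D. \<Sum>x\<in>S. \<Sum>y\<in>S. if B \<xi> y = B \<xi> x then f x ^ 2 * g \<xi> (y + \<xi>) ^ 2 else 0)"
    using finite_S by (simp add: sum.If_cases Int_def)
  also have "\<dots> = (\<Sum>\<xi>\<in>D. \<Sum>y\<in>S. \<Sum>x\<in>S. if B \<xi> y = B \<xi> x then f x ^ 2 * g \<xi> (y + \<xi>) ^ 2 else 0)"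
    by (rule sum.cong[OF refl]) (rule sum.swap)
  also have "\<dots> = (\<Sum>\<xi>\<in>D. \<Sum>y\<in>S. \<Phi> \<xi> (y + \<xi>))"
    using finite_S
    by (intro sum.cong[OF refl]) (auto simp: \<Phi>_def sum.If_cases Int_def sum_distrib_left bform_add mult.commute intro!: sum.cong)
  also have "\<dots> \<le> (\<Sum>\<xi>\<in>D. \<Sum>z\<in>S. \<Phi> \<xi> z)"
  proof (rule sum_mono)
    fix \<xi>
    have "(\<Sum>y\<in>S. \<Phi> \<xi> (y + \<xi>)) = (\<Sum>z\<in>(\<lambda>y. y + \<xi>) ` S. \<Phi> \<xi> z)"
      by (subst sum.reindex) (auto simp: inj_on_def)
    also have "\<dots> = (\<Sum>z\<in>(\<lambda>y. y + \<xi>) ` S \<inter> S. \<Phi> \<xi> z)"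
      using finite_S by (intro sum.mono_neutral_right) (auto simp: \<Phi>_def g f_zero)
    also have "\<dots> \<le> (\<Sum>z\<in>S. \<Phi> \<xi> z)"
      by (rule sum_mono2[OF finite_S]) (auto simp: \<Phi>0)
    finally show "(\<Sum>y\<in>S. \<Phi> \<xi> (y + \<xi>)) \<le> (\<Sum>z\<in>S. \<Phi> \<xi> z)" .
  qed
  also have "\<dots> = (\<Sum>z\<in>S. \<Sum>\<xi>\<in>D. if in_rich \<xi> z then f z ^ 2 * (\<Sum>x\<in>{x \<in> S. B \<xi> (x + \<xi>) = B \<xi> z}. f x ^ 2) else 0)"
    by (subst sum.swap) (rule sum.cong[OF refl], rule sum.cong[OF refl], simp add: g \<Phi>_def)
  also have "\<dots> = (\<Sum>z\<in>S. f z ^ 2 * (\<Sum>\<xi>\<in>{\<xi> \<in> D. in_rich \<xi> z}. \<Sum>x\<in>{x \<in> S. B \<xi> (x + \<xi>) = B \<xi> z}. f x ^ 2))"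
    using finite_D by (intro sum.cong[OF refl]) (simp add: sum.If_cases sum_distrib_left Int_def)
  also have "\<dots> \<le> (\<Sum>z\<in>S. f z ^ 2 * (2 * rich_count z * mass))"
  proof (intro sum_mono mult_left_mono)
    fix z assume z: "z \<in> S"
    show "(\<Sum>\<xi>\<in>{\<xi> \<in> D. in_rich \<xi> z}. \<Sum>x\<in>{x \<in> S. B \<xi> (x + \<xi>) = B \<xi> z}. f x ^ 2) \<le> 2 * rich_count z * mass"
    proof (rule sum_rich_directions[OF z, where h = "\<lambda>\<xi> x. x"])
      fix \<xi> \<xi>' x x'
      assume D: "\<xi> \<in> D" "\<xi>' \<in> D" and par: "cross \<xi> \<xi>' = 0"
        and x: "x \<in> {x \<in> S. B \<xi> (x + \<xi>) = B \<xi> z}" "x' \<in> {x \<in> S. B \<xi>' (x + \<xi>') = B \<xi>' z}" and eq: "x = x'"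
      have "B \<xi>' (x + \<xi>' - z) = 0" using x eq by (simp add: bform_diff)
      then have "B \<xi> (x + \<xi>' - z) = 0"
        using bform_parallel[of \<xi>' \<xi>] par D D_nonzero by (metis cross_swap)
      then have "B \<xi> (\<xi> - \<xi>') = 0" using x by (simp add: bform_diff bform_add)
      with eq show "\<xi> = \<xi>' \<and> x = x'" using parallel_eq[OF par D_nonzero[OF D(1)]] by simp
    qed (use finite_S in simp)
  qed simp
  also have "\<dots> \<le> 2 ^ 27 * mass ^ 2" by (rule sum_rich_count)
  finally show ?thesis .
qed

text \<open>A rectangle, given by a corner and the two sides at it.\<close>

definition rects :: "((int \<times> int) \<times> (int \<times> int) \<times> (int \<times> int)) set"
  where "rects = {(x, \<xi>, \<eta>). \<xi> \<in> D \<and> \<eta> \<in> D \<and> B \<xi> \<eta> = 0 \<and> x \<in> S \<and> x + \<xi> \<in> S \<and> x + \<eta> \<in> S \<and> x + \<xi> + \<eta> \<in> S}"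

text \<open>The second column point is replaced by the side \<open>\<eta> = y - x\<close>, which
  makes both sides of the rectangle play the same part; terms with a vertex outside \<open>S\<close>
  vanish.\<close>

lemma rect_form_eq_rects:
  assumes F: "\<And>\<xi> x. x \<notin> S \<Longrightarrow> F \<xi> x = 0"
  shows "rect_form F = (\<Sum>(x, \<xi>, \<eta>)\<in>rects. F \<xi> x * F \<xi> (x + \<xi>) * F \<xi> (x + \<eta>) * F \<xi> (x + \<xi> + \<eta>))"
proof -
  define P where "P = (SIGMA \<xi>:D. SIGMA x:S. {y \<in> S. B \<xi> y = B \<xi> x} - {x})"
  define t where "t = (\<lambda>(\<xi>, x, y). (F \<xi> x * F \<xi> (x + \<xi>)) * (F \<xi> y * F \<xi> (y + \<xi>)))"
  have fin: "finite P" unfolding P_def using finite_D finite_S by (intro finite_SigmaI) auto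
  have "rect_form F = (\<Sum>p\<in>P. t p)"
    unfolding rect_form_def P_def t_def using finite_S finite_D
    by (simp add: sum.Sigma[symmetric] finite_SigmaI)
  also have "\<dots> = (\<Sum>p\<in>{p \<in> P. fst (snd p) + fst p \<in> S \<and> snd (snd p) + fst p \<in> S}. t p)"
  proof (rule sum.mono_neutral_right[OF fin])
    show "\<forall>p\<in>P - {p \<in> P. fst (snd p) + fst p \<in> S \<and> snd (snd p) + fst p \<in> S}. t p = 0"
    proof
      fix p assume "p \<in> P - {p \<in> P. fst (snd p) + fst p \<in> S \<and> snd (snd p) + fst p \<in> S}"
      then have "fst (snd p) + fst p \<notin> S \<or> snd (snd p) + fst p \<notin> S" by blast
      then show "t p = 0" by (auto simp: t_def case_prod_unfold F)
    qed
  qed blast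
  also have "\<dots> = (\<Sum>p\<in>rects. case p of (x, \<xi>, \<eta>) \<Rightarrow> F \<xi> x * F \<xi> (x + \<xi>) * F \<xi> (x + \<eta>) * F \<xi> (x + \<xi> + \<eta>))"
  proof (rule sum.reindex_bij_witness[of _ "\<lambda>p. (fst (snd p), fst p, fst p + snd (snd p))"
        "\<lambda>p. (fst (snd p), fst p, snd (snd p) - fst (snd p))"])
    fix p assume p: "p \<in> {p \<in> P. fst (snd p) + fst p \<in> S \<and> snd (snd p) + fst p \<in> S}"
    obtain \<xi> x y where pe: "p = (\<xi>, x, y)" by (cases p)
    have *: "\<xi> \<in> D" "x \<in> S" "y \<in> S" "B \<xi> y = B \<xi> x" "y \<noteq> x" "x + \<xi> \<in> S" "y + \<xi> \<in> S"
      using p by (simp_all add: pe P_def)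
    show "(fst (snd (fst (snd p), fst p, snd (snd p) - fst (snd p))), fst (fst (snd p), fst p, snd (snd p) - fst (snd p)),
        fst (fst (snd p), fst p, snd (snd p) - fst (snd p)) + snd (snd (fst (snd p), fst p, snd (snd p) - fst (snd p)))) = p"
      by (simp add: pe)
    have "x + \<xi> + (y - x) = y + \<xi>" by simp
    then show "(fst (snd p), fst p, snd (snd p) - fst (snd p)) \<in> rects"
      using * diff_in_D[of x y] by (simp add: pe rects_def bform_diff add.commute)
    show "(case (fst (snd p), fst p, snd (snd p) - fst (snd p)) of (x, \<xi>, \<eta>) \<Rightarrow>
        F \<xi> x * F \<xi> (x + \<xi>) * F \<xi> (x + \<eta>) * F \<xi> (x + \<xi> + \<eta>)) = t p"
      by (simp add: pe t_def ac_simps)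
  next
    fix p assume p: "p \<in> rects"
    obtain x \<xi> \<eta> where pe: "p = (x, \<xi>, \<eta>)" by (cases p)
    show "(fst (snd (fst (snd p), fst p, fst p + snd (snd p))), fst (fst (snd p), fst p, fst p + snd (snd p)),
        snd (snd (fst (snd p), fst p, fst p + snd (snd p))) - fst (snd (fst (snd p), fst p, fst p + snd (snd p)))) = p"
      by (simp add: pe)
    show "(fst (snd p), fst p, fst p + snd (snd p)) \<in> {p \<in> P. fst (snd p) + fst p \<in> S \<and> snd (snd p) + fst p \<in> S}"
      using p D_nonzero[of \<eta>] by (simp add: pe P_def rects_def bform_add ac_simps)
  qed
  finally show ?thesis .
qed

section \<open>Rectangles with good vertices and their corners\<close>

lemma rects_iff:
  "(x, \<xi>, \<eta>) \<in> rects \<longleftrightarrow> \<xi> \<in> D \<and> \<eta> \<in> D \<and> B \<xi> \<eta> = 0 \<and> x \<in> S \<and> x + \<xi> \<in> S \<and> x + \<eta> \<in> S \<and> x + \<xi> + \<eta> \<in> S"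
  by (simp add: rects_def)

lemma sum_rects_involution:
  assumes "\<And>x \<xi> \<eta>. (x, \<xi>, \<eta>) \<in> rects \<Longrightarrow> h (x, \<xi>, \<eta>) \<in> rects \<and> h (h (x, \<xi>, \<eta>)) = (x, \<xi>, \<eta>)"
  shows "(\<Sum>p\<in>rects. g (h p)) = (\<Sum>p\<in>rects. g p)"
proof -
  have h: "h p \<in> rects" "h (h p) = p" if "p \<in> rects" for p
    using assms[of "fst p" "fst (snd p)" "snd (snd p)"] that by simp_all
  show ?thesis
    by (rule sum.reindex_bij_witness[of _ h h]) (use h in simp_all)
qed

text \<open>Reading each rectangle from its other side exchanges rows and columns. This later turns
  a condition on rows into one on columns.\<close>

lemma rect_form_swap:
  assumes F: "\<And>\<xi> x. x \<notin> S \<Longrightarrow> F \<xi> x = 0" and F': "\<And>\<xi> x. x \<notin> S \<Longrightarrow> F' \<xi> x = 0"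
    and eq: "\<And>\<xi> \<eta> x. \<xi> \<in> D \<Longrightarrow> \<eta> \<in> D \<Longrightarrow> B \<xi> \<eta> = 0 \<Longrightarrow> F \<xi> x = F' \<eta> x"
  shows "rect_form F = rect_form F'"
proof -
  define g where "g G = (\<lambda>(x, \<xi>, \<eta>). G \<xi> x * G \<xi> (x + \<xi>) * G \<xi> (x + \<eta>) * G \<xi> (x + \<xi> + \<eta>))"
    for G :: "int \<times> int \<Rightarrow> int \<times> int \<Rightarrow> real"
  define h where "h = (\<lambda>(x, \<xi>, \<eta>). (x, \<eta>, \<xi>) :: (int \<times> int) \<times> (int \<times> int) \<times> (int \<times> int))"
  have "rect_form F = (\<Sum>p\<in>rects. g F p)" unfolding g_def by (rule rect_form_eq_rects) (rule F)
  also have "\<dots> = (\<Sum>p\<in>rects. g F' (h p))"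
  proof (rule sum.cong[OF refl])
    fix p assume p: "p \<in> rects"
    obtain x \<xi> \<eta> where pe: "p = (x, \<xi>, \<eta>)" by (cases p)
    have "F \<xi> v = F' \<eta> v" for v using p by (intro eq) (simp_all add: pe rects_iff)
    then show "g F p = g F' (h p)" by (simp add: pe g_def h_def ac_simps)
  qed
  also have "\<dots> = (\<Sum>p\<in>rects. g F' p)"
    by (rule sum_rects_involution) (simp add: h_def rects_iff bform_commute ac_simps)
  also have "\<dots> = rect_form F'" unfolding g_def by (rule rect_form_eq_rects[symmetric]) (rule F')
  finally show ?thesis .
qed

definition kern :: "int \<times> int \<Rightarrow> int \<times> int \<Rightarrow> real"
  where "kern x \<xi> = (if good x (row x \<xi>) \<and> good (x + \<xi>) (row x \<xi>) then weight x (x + \<xi>) else 0)"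

definition corner :: "int \<times> int \<Rightarrow> int \<times> int \<Rightarrow> int \<times> int \<Rightarrow> real"
  where "corner x \<xi> \<eta> = f x * kern x \<xi> * kern x \<eta>"

definition good_part :: "int \<times> int \<Rightarrow> int \<times> int \<Rightarrow> real"
  where "good_part \<xi> x = (if good x (row x \<xi>) \<and> good x (col x \<xi>) then f x else 0)"

lemma weight_nonneg: "0 \<le> weight x y"
  by (simp add: weight_def f_nonneg)

lemma kern_nonneg: "0 \<le> kern x \<xi>"
  by (simp add: kern_def weight_nonneg)

lemma corner_nonneg: "0 \<le> corner x \<xi> \<eta>"
  by (simp add: corner_def kern_nonneg f_nonneg)

lemma row_minus: "\<xi> \<noteq> 0 \<Longrightarrow> row x (- \<xi>) = row x \<xi>"
  by (rule row_eqI) (auto simp: cross_def)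

lemma row_shift: "\<xi> \<noteq> 0 \<Longrightarrow> row (x + \<xi>) \<xi> = row x \<xi>"
  by (rule row_eqI[symmetric]) (auto simp: cross_def)

text \<open>The value \<open>f u\<close> is split into two equal square roots, each bounded by the
  minimum at the ends of one side at \<open>x\<close>.\<close>

lemma weight_product_le:
  assumes "f u \<le> f x" "f u \<le> f y" "f u \<le> f z"
  shows "f u * (f x * f y * f z) \<le> f x * weight x y * weight x z"
proof -
  have "sqrt (f u) * sqrt (f u) \<le> sqrt (min (f x) (f y)) * sqrt (min (f x) (f z))"
    using assms f_nonneg by (intro mult_mono) auto
  then have "f u * (f x * f y * f z) \<le> (sqrt (min (f x) (f y)) * sqrt (min (f x) (f z))) * (f x * f y * f z)"
    using f_nonneg by (intro mult_right_mono) auto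
  then show ?thesis by (simp add: weight_def ac_simps)
qed

text \<open>The smallest of the four values is dropped; the opposite corner then carries the weights.\<close>

lemma four_corners:
  assumes \<xi>: "\<xi> \<in> D" and \<eta>: "\<eta> \<in> D" and orth: "B \<xi> \<eta> = 0"
  shows "good_part \<xi> x * good_part \<xi> (x + \<xi>) * good_part \<xi> (x + \<eta>) * good_part \<xi> (x + \<xi> + \<eta>) \<le>
    corner x \<xi> \<eta> + corner (x + \<xi>) (- \<xi>) \<eta> + corner (x + \<eta>) \<xi> (- \<eta>) + corner (x + \<xi> + \<eta>) (- \<xi>) (- \<eta>)"
proof (cases "good_part \<xi> x = 0 \<or> good_part \<xi> (x + \<xi>) = 0 \<or> good_part \<xi> (x + \<eta>) = 0 \<or> good_part \<xi> (x + \<xi> + \<eta>) = 0")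
  case True
  then have "good_part \<xi> x * good_part \<xi> (x + \<xi>) * good_part \<xi> (x + \<eta>) * good_part \<xi> (x + \<xi> + \<eta>) = 0" by auto
  moreover have "0 \<le> corner x \<xi> \<eta> + corner (x + \<xi>) (- \<xi>) \<eta> + corner (x + \<eta>) \<xi> (- \<eta>) + corner (x + \<xi> + \<eta>) (- \<xi>) (- \<eta>)"
    by (intro add_nonneg_nonneg corner_nonneg)
  ultimately show ?thesis by (simp only:)
next
  case False
  have nz: "\<xi> \<noteq> 0" "\<eta> \<noteq> 0" using \<xi> \<eta> D_nonzero by auto
  define y z w where "y = x + \<xi>" and "z = x + \<eta>" and "w = x + \<xi> + \<eta>"
  define R R' C C' where "R = row x \<xi>" and "R' = row z \<xi>" and "C = row x \<eta>" and "C' = row y \<eta>"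
  \<comment> \<open>By orthogonality each column in direction \<xi> is a row in direction \<eta>.
    The eight conditions on the vertices thus concern the four side lines and are the ones tested by
    \<open>kern\<close>.\<close>
  have col: "col v \<xi> = row v \<eta>" for v using row_eq_col[OF orth nz] by simp
  have rows: "row y \<xi> = R" "row w \<xi> = R'" "row z \<eta> = C" "row w \<eta> = C'"
    using row_shift[OF nz(1), of x] row_shift[OF nz(1), of z] row_shift[OF nz(2), of x] row_shift[OF nz(2), of y]
    by (simp_all add: R_def R'_def C_def C'_def y_def z_def w_def ac_simps)
  have g: "good x R" "good x C" "good y R" "good y C'" "good z R'" "good z C" "good w R'" "good w C'"
    using False unfolding good_part_def col w_def[symmetric] unfolding y_def[symmetric] z_def[symmetric] rows
      R_def[symmetric] R'_def[symmetric] C_def[symmetric] C'_def[symmetric]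
    by (auto split: if_splits)
  have F: "good_part \<xi> x = f x" "good_part \<xi> y = f y" "good_part \<xi> z = f z" "good_part \<xi> w = f w"
    unfolding good_part_def col rows R_def[symmetric] R'_def[symmetric] C_def[symmetric] C'_def[symmetric]
    using g by simp_all
  have diffs: "x + \<xi> = y" "x + \<eta> = z" "y + - \<xi> = x" "y + \<eta> = w" "z + \<xi> = w" "z + - \<eta> = x"
    "w + - \<xi> = z" "w + - \<eta> = y" "x + \<xi> + \<eta> = w"
    by (simp_all add: y_def z_def w_def)
  have kern: "kern x \<xi> = weight x y" "kern x \<eta> = weight x z" "kern y (- \<xi>) = weight y x" "kern y \<eta> = weight y w"
    "kern z \<xi> = weight z w" "kern z (- \<eta>) = weight z x" "kern w (- \<xi>) = weight w z" "kern w (- \<eta>) = weight w y"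
    unfolding kern_def diffs row_minus[OF nz(1)] row_minus[OF nz(2)] rows
      R_def[symmetric] R'_def[symmetric] C_def[symmetric] C'_def[symmetric]
    using g by simp_all
  have corners: "corner x \<xi> \<eta> = f x * weight x y * weight x z" "corner y (- \<xi>) \<eta> = f y * weight y x * weight y w"
    "corner z \<xi> (- \<eta>) = f z * weight z w * weight z x" "corner w (- \<xi>) (- \<eta>) = f w * weight w z * weight w y"
    by (simp_all add: corner_def kern)
  have "f x * f y * f z * f w \<le> f x * weight x y * weight x z + f y * weight y x * weight y w +
      f z * weight z w * weight z x + f w * weight w z * weight w y"
  proof -
    have nonneg: "0 \<le> f x * weight x y * weight x z" for x y z by (simp add: f_nonneg weight_nonneg)
    consider "f w \<le> f x" "f w \<le> f y" "f w \<le> f z" | "f z \<le> f y" "f z \<le> f x" "f z \<le> f w"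
      | "f y \<le> f z" "f y \<le> f w" "f y \<le> f x" | "f x \<le> f w" "f x \<le> f z" "f x \<le> f y" by linarith
    then show ?thesis
    proof cases
      case 1 then show ?thesis
        using weight_product_le[of w x y z] nonneg[of y x w] nonneg[of z w x] nonneg[of w z y] by (simp add: ac_simps)
    next
      case 2 then show ?thesis
        using weight_product_le[of z y x w] nonneg[of x y z] nonneg[of z w x] nonneg[of w z y] by (simp add: ac_simps)
    next
      case 3 then show ?thesis
        using weight_product_le[of y z w x] nonneg[of x y z] nonneg[of y x w] nonneg[of w z y] by (simp add: ac_simps)
    next
      case 4 then show ?thesis
        using weight_product_le[of x w z y] nonneg[of x y z] nonneg[of y x w] nonneg[of z w x] by (simp add: ac_simps)
    qed
  qed
  then show ?thesis unfolding diffs F corners .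
qed

text \<open>Moving the base point to another corner and reversing the sides there is an involution
  of \<open>rects\<close>, so all four corners contribute equally.\<close>

lemma sum_corners_rects:
  "(\<Sum>(x, \<xi>, \<eta>)\<in>rects. corner (x + \<xi>) (- \<xi>) \<eta>) = (\<Sum>(x, \<xi>, \<eta>)\<in>rects. corner x \<xi> \<eta>)"
  "(\<Sum>(x, \<xi>, \<eta>)\<in>rects. corner (x + \<eta>) \<xi> (- \<eta>)) = (\<Sum>(x, \<xi>, \<eta>)\<in>rects. corner x \<xi> \<eta>)"
  "(\<Sum>(x, \<xi>, \<eta>)\<in>rects. corner (x + \<xi> + \<eta>) (- \<xi>) (- \<eta>)) = (\<Sum>(x, \<xi>, \<eta>)\<in>rects. corner x \<xi> \<eta>)"
proof -
  define g where "g = (\<lambda>(x, \<xi>, \<eta>). corner x \<xi> \<eta>)"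
  have "(\<Sum>p\<in>rects. g ((\<lambda>(x, \<xi>, \<eta>). (x + \<xi>, - \<xi>, \<eta>)) p)) = (\<Sum>p\<in>rects. g p)"
    by (rule sum_rects_involution) (simp add: rects_iff minus_D bform_minus_left ac_simps)
  then show "(\<Sum>(x, \<xi>, \<eta>)\<in>rects. corner (x + \<xi>) (- \<xi>) \<eta>) = (\<Sum>(x, \<xi>, \<eta>)\<in>rects. corner x \<xi> \<eta>)"
    by (simp add: g_def case_prod_unfold)
  have "(\<Sum>p\<in>rects. g ((\<lambda>(x, \<xi>, \<eta>). (x + \<eta>, \<xi>, - \<eta>)) p)) = (\<Sum>p\<in>rects. g p)"
    by (rule sum_rects_involution) (simp add: rects_iff minus_D bform_minus ac_simps)
  then show "(\<Sum>(x, \<xi>, \<eta>)\<in>rects. corner (x + \<eta>) \<xi> (- \<eta>)) = (\<Sum>(x, \<xi>, \<eta>)\<in>rects. corner x \<xi> \<eta>)"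
    by (simp add: g_def case_prod_unfold)
  have "(\<Sum>p\<in>rects. g ((\<lambda>(x, \<xi>, \<eta>). (x + \<xi> + \<eta>, - \<xi>, - \<eta>)) p)) = (\<Sum>p\<in>rects. g p)"
    by (rule sum_rects_involution) (simp add: rects_iff minus_D bform_minus bform_minus_left ac_simps)
  then show "(\<Sum>(x, \<xi>, \<eta>)\<in>rects. corner (x + \<xi> + \<eta>) (- \<xi>) (- \<eta>)) = (\<Sum>(x, \<xi>, \<eta>)\<in>rects. corner x \<xi> \<eta>)"
    by (simp add: g_def case_prod_unfold)
qed

lemma rect_form_good_le_corners: "rect_form good_part \<le> 4 * (\<Sum>(x, \<xi>, \<eta>)\<in>rects. corner x \<xi> \<eta>)"
proof -
  have "rect_form good_part = (\<Sum>(x, \<xi>, \<eta>)\<in>rects. good_part \<xi> x * good_part \<xi> (x + \<xi>) * good_part \<xi> (x + \<eta>) * good_part \<xi> (x + \<xi> + \<eta>))"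
    by (rule rect_form_eq_rects) (simp add: good_part_def f_zero)
  also have "\<dots> \<le> (\<Sum>(x, \<xi>, \<eta>)\<in>rects. corner x \<xi> \<eta> + corner (x + \<xi>) (- \<xi>) \<eta> +
      corner (x + \<eta>) \<xi> (- \<eta>) + corner (x + \<xi> + \<eta>) (- \<xi>) (- \<eta>))"
  proof (rule sum_mono)
    fix p assume p: "p \<in> rects"
    obtain x \<xi> \<eta> where "p = (x, \<xi>, \<eta>)" by (cases p) auto
    with p four_corners[of \<xi> \<eta> x] show
      "(case p of (x, \<xi>, \<eta>) \<Rightarrow> good_part \<xi> x * good_part \<xi> (x + \<xi>) * good_part \<xi> (x + \<eta>) * good_part \<xi> (x + \<xi> + \<eta>)) \<le>
      (case p of (x, \<xi>, \<eta>) \<Rightarrow> corner x \<xi> \<eta> + corner (x + \<xi>) (- \<xi>) \<eta> +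
      corner (x + \<eta>) \<xi> (- \<eta>) + corner (x + \<xi> + \<eta>) (- \<xi>) (- \<eta>))"
      by (simp add: rects_def)
  qed
  also have "\<dots> = 4 * (\<Sum>(x, \<xi>, \<eta>)\<in>rects. corner x \<xi> \<eta>)"
    using sum_corners_rects by (simp add: case_prod_unfold sum.distrib)
  finally show ?thesis .
qed

section \<open>From orthogonal sides to collinear triples\<close>

definition ksum :: "int \<times> int \<Rightarrow> (int \<times> int) set \<Rightarrow> real"
  where "ksum x l = (\<Sum>\<xi>\<in>{\<xi> \<in> D. row x \<xi> = l}. kern x \<xi>)"

lemma ksum_nonneg: "0 \<le> ksum x l"
  by (simp add: ksum_def sum_nonneg kern_nonneg)

text \<open>The sum depends only on the partition of \<open>D\<close> into parallel classes, so
  labelling the classes by rows or by columns gives the same value.\<close>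

lemma sum_squares_parallel:
  assumes r: "\<And>\<xi> \<xi>'. \<xi> \<in> D \<Longrightarrow> \<xi>' \<in> D \<Longrightarrow> r \<xi> = r \<xi>' \<longleftrightarrow> cross \<xi> \<xi>' = 0"
  shows "(\<Sum>m\<in>r ` D. (\<Sum>\<xi>\<in>{\<xi> \<in> D. r \<xi> = m}. k \<xi>) ^ 2) =
    (\<Sum>\<xi>\<in>D. \<Sum>\<xi>'\<in>{\<xi>' \<in> D. cross \<xi> \<xi>' = 0}. k \<xi> * k \<xi>' :: real)"
proof -
  have "(\<Sum>m\<in>r ` D. (\<Sum>\<xi>\<in>{\<xi> \<in> D. r \<xi> = m}. k \<xi>) ^ 2) =
      (\<Sum>m\<in>r ` D. \<Sum>\<xi>\<in>{\<xi> \<in> D. r \<xi> = m}. \<Sum>\<xi>'\<in>{\<xi>' \<in> D. cross \<xi> \<xi>' = 0}. k \<xi> * k \<xi>')"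
    unfolding power2_eq_square sum_product
  proof (rule sum.cong[OF refl], rule sum.cong[OF refl])
    fix m \<xi> assume \<xi>: "\<xi> \<in> {\<xi> \<in> D. r \<xi> = m}"
    have "r \<xi>' = m \<longleftrightarrow> cross \<xi> \<xi>' = 0" if "\<xi>' \<in> D" for \<xi>'
      using r[of \<xi> \<xi>'] that \<xi> by auto
    then have "{\<xi>' \<in> D. r \<xi>' = m} = {\<xi>' \<in> D. cross \<xi> \<xi>' = 0}"
      by (intro Collect_cong conj_cong refl)
    then show "(\<Sum>\<xi>'\<in>{\<xi>' \<in> D. r \<xi>' = m}. k \<xi> * k \<xi>') = (\<Sum>\<xi>'\<in>{\<xi>' \<in> D. cross \<xi> \<xi>' = 0}. k \<xi> * k \<xi>')"
      by simp
  qed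
  also have "\<dots> = (\<Sum>\<xi>\<in>D. \<Sum>\<xi>'\<in>{\<xi>' \<in> D. cross \<xi> \<xi>' = 0}. k \<xi> * k \<xi>')"
    by (rule sum.image_gen[symmetric, OF finite_D])
  finally show ?thesis .
qed

text \<open>A pair of orthogonal sides couples two line sums at \<open>x\<close>. The inequality of
  the two means separates them, leaving squares of sums over one line: pairs of points collinear
  with \<open>x\<close> replace orthogonal pairs.\<close>

lemma orthogonal_kernels_le:
  "(\<Sum>\<xi>\<in>D. \<Sum>\<eta>\<in>{\<eta> \<in> D. B \<xi> \<eta> = 0}. kern x \<xi> * kern x \<eta>) \<le> (\<Sum>l\<in>row x ` D. ksum x l ^ 2)"
proof -
  define csum where "csum m = (\<Sum>\<xi>\<in>{\<xi> \<in> D. col x \<xi> = m}. kern x \<xi>)" for m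
  have orth: "{\<eta> \<in> D. B \<xi> \<eta> = 0} = {\<eta> \<in> D. row x \<eta> = col x \<xi>}" if \<xi>: "\<xi> \<in> D" for \<xi>
  proof -
    have "B \<xi> \<eta> = 0 \<longleftrightarrow> row x \<eta> = col x \<xi>" if \<eta>: "\<eta> \<in> D" for \<eta>
    proof
      show "row x \<eta> = col x \<xi>" if "B \<xi> \<eta> = 0"
        using row_eq_col[OF that] \<xi> \<eta> D_nonzero by blast
      show "B \<xi> \<eta> = 0" if "row x \<eta> = col x \<xi>"
      proof -
        from that have "cross \<eta> (perp \<xi>) = 0" unfolding row_def col_def by (rule line_eqD)
        then have "cross (perp \<xi>) \<eta> = 0" by (subst cross_swap)
        then show ?thesis by (simp add: cross_perp)
      qed
    qed
    then show ?thesis by (intro Collect_cong conj_cong refl)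
  qed
  have "(\<Sum>\<xi>\<in>D. \<Sum>\<eta>\<in>{\<eta> \<in> D. B \<xi> \<eta> = 0}. kern x \<xi> * kern x \<eta>) = (\<Sum>\<xi>\<in>D. kern x \<xi> * ksum x (col x \<xi>))"
    by (rule sum.cong[OF refl]) (simp add: orth ksum_def sum_distrib_left)
  also have "\<dots> = (\<Sum>m\<in>col x ` D. \<Sum>\<xi>\<in>{\<xi> \<in> D. col x \<xi> = m}. kern x \<xi> * ksum x (col x \<xi>))"
    by (rule sum.image_gen[OF finite_D])
  also have "\<dots> = (\<Sum>m\<in>col x ` D. csum m * ksum x m)"
    unfolding csum_def sum_distrib_right by (rule sum.cong[OF refl], rule sum.cong[OF refl]) simp
  also have "\<dots> \<le> (\<Sum>m\<in>col x ` D. csum m ^ 2 / 2 + ksum x m ^ 2 / 2)"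
  proof (rule sum_mono)
    fix m
    have "0 \<le> (csum m - ksum x m) ^ 2" by simp
    then show "csum m * ksum x m \<le> csum m ^ 2 / 2 + ksum x m ^ 2 / 2"
      by (simp add: power2_eq_square algebra_simps)
  qed
  also have "\<dots> = (\<Sum>m\<in>col x ` D. csum m ^ 2) / 2 + (\<Sum>m\<in>col x ` D. ksum x m ^ 2) / 2"
    by (simp add: sum.distrib sum_divide_distrib)
  finally have 1: "(\<Sum>\<xi>\<in>D. \<Sum>\<eta>\<in>{\<eta> \<in> D. B \<xi> \<eta> = 0}. kern x \<xi> * kern x \<eta>) \<le>
    (\<Sum>m\<in>col x ` D. csum m ^ 2) / 2 + (\<Sum>m\<in>col x ` D. ksum x m ^ 2) / 2" .
  have 2: "(\<Sum>m\<in>col x ` D. csum m ^ 2) = (\<Sum>l\<in>row x ` D. ksum x l ^ 2)"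
  proof -
    have "(\<Sum>m\<in>col x ` D. csum m ^ 2) = (\<Sum>\<xi>\<in>D. \<Sum>\<xi>'\<in>{\<xi>' \<in> D. cross \<xi> \<xi>' = 0}. kern x \<xi> * kern x \<xi>')"
      unfolding csum_def by (rule sum_squares_parallel) (rule col_eq_iff[OF D_nonzero D_nonzero])
    also have "\<dots> = (\<Sum>l\<in>row x ` D. ksum x l ^ 2)"
      unfolding ksum_def by (rule sum_squares_parallel[symmetric]) (rule row_eq_iff[OF D_nonzero D_nonzero])
    finally show ?thesis .
  qed
  \<comment> \<open>A column that is not also a row in a direction of \<open>D\<close> has an empty
    sum \<open>ksum\<close>.\<close>
  have 3: "(\<Sum>m\<in>col x ` D. ksum x m ^ 2) \<le> (\<Sum>l\<in>row x ` D. ksum x l ^ 2)"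
  proof -
    have "(\<Sum>m\<in>col x ` D. ksum x m ^ 2) = (\<Sum>m\<in>col x ` D \<inter> row x ` D. ksum x m ^ 2)"
    proof (rule sum.mono_neutral_right)
      show "\<forall>m\<in>col x ` D - col x ` D \<inter> row x ` D. ksum x m ^ 2 = 0"
      proof
        fix m assume "m \<in> col x ` D - col x ` D \<inter> row x ` D"
        then have "{\<xi> \<in> D. row x \<xi> = m} = {}" by blast
        then show "ksum x m ^ 2 = 0" unfolding ksum_def by (simp only: sum.empty) simp
      qed
    qed (use finite_D in auto)
    also have "\<dots> \<le> (\<Sum>l\<in>row x ` D. ksum x l ^ 2)"
      using finite_D by (intro sum_mono2) auto
    finally show ?thesis .
  qed
  show ?thesis using 1 2 3 by linarith
qed

lemma ksum_le:
  "ksum x l \<le> (if good x l then \<Sum>y\<in>{y \<in> S \<inter> l. good y l}. weight x y else 0)"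
proof (cases "good x l")
  case True
  define Z where "Z = {\<xi> \<in> D. row x \<xi> = l \<and> good (x + \<xi>) l \<and> x + \<xi> \<in> S}"
  have "ksum x l = (\<Sum>\<xi>\<in>Z. kern x \<xi>)"
    unfolding ksum_def
  proof (rule sum.mono_neutral_right)
    show "\<forall>\<xi>\<in>{\<xi> \<in> D. row x \<xi> = l} - Z. kern x \<xi> = 0"
      by (auto simp: Z_def kern_def weight_def f_zero)
  qed (use finite_D in \<open>auto simp: Z_def\<close>)
  also have "\<dots> \<le> (\<Sum>\<xi>\<in>Z. weight x (x + \<xi>))"
    by (rule sum_mono) (simp add: kern_def weight_nonneg)
  also have "\<dots> = (\<Sum>y\<in>(\<lambda>\<xi>. x + \<xi>) ` Z. weight x y)"
    by (simp add: sum.reindex inj_on_def)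
  also have "\<dots> \<le> (\<Sum>y\<in>{y \<in> S \<inter> l. good y l}. weight x y)"
  proof (rule sum_mono2)
    show "(\<lambda>\<xi>. x + \<xi>) ` Z \<subseteq> {y \<in> S \<inter> l. good y l}"
    proof
      fix y assume "y \<in> (\<lambda>\<xi>. x + \<xi>) ` Z"
      then obtain \<xi> where \<xi>: "\<xi> \<in> Z" "y = x + \<xi>" by blast
      have "x + \<xi> \<in> row x \<xi>" by (simp add: row_def line_def cross_def)
      with \<xi> show "y \<in> {y \<in> S \<inter> l. good y l}" by (simp add: Z_def)
    qed
  qed (use finite_S weight_nonneg in auto)
  finally show ?thesis using True by simp
next
  case False
  then have "ksum x l = 0"
    unfolding ksum_def by (intro sum.neutral) (auto simp: kern_def)
  with False show ?thesis by simp
qed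

text \<open>Once both other points of a corner lie on one line with \<open>x\<close>, the order of
  summation is exchanged so that the line is outermost, and \<open>good_lines_sum\<close>
  applies.\<close>

lemma sum_corners_le:
  assumes J: "card S < 2 ^ J"
  shows "(\<Sum>(x, \<xi>, \<eta>)\<in>rects. corner x \<xi> \<eta>) \<le> 2 ^ 68 * real J * mass ^ 2"
proof -
  define W where "W x l = (\<Sum>y\<in>{y \<in> S \<inter> l. good y l}. weight x y)" for x l
  have W0: "0 \<le> W x l" for x l by (simp add: W_def sum_nonneg weight_nonneg)
  define P where "P = (SIGMA x:S. SIGMA \<xi>:D. {\<eta> \<in> D. B \<xi> \<eta> = 0})"
  have finP: "finite P" unfolding P_def using finite_S finite_D by (intro finite_SigmaI) auto
  have "(\<Sum>(x, \<xi>, \<eta>)\<in>rects. corner x \<xi> \<eta>) \<le> (\<Sum>(x, \<xi>, \<eta>)\<in>P. corner x \<xi> \<eta>)"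
    by (rule sum_mono2[OF finP]) (auto simp: P_def rects_def corner_nonneg)
  also have "\<dots> = (\<Sum>x\<in>S. f x * (\<Sum>\<xi>\<in>D. \<Sum>\<eta>\<in>{\<eta> \<in> D. B \<xi> \<eta> = 0}. kern x \<xi> * kern x \<eta>))"
    unfolding P_def using finite_S finite_D
    by (simp add: sum.Sigma[symmetric] finite_SigmaI corner_def sum_distrib_left mult.assoc)
  also have "\<dots> \<le> (\<Sum>x\<in>S. f x * (\<Sum>l\<in>row x ` D. ksum x l ^ 2))"
    by (intro sum_mono mult_left_mono orthogonal_kernels_le f_nonneg)
  also have "\<dots> \<le> (\<Sum>x\<in>S. \<Sum>l\<in>side_lines. if x \<in> l \<and> good x l then f x * W x l ^ 2 else 0)"
  proof (rule sum_mono)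
    fix x assume x: "x \<in> S"
    have "f x * (\<Sum>l\<in>row x ` D. ksum x l ^ 2) \<le> (\<Sum>l\<in>row x ` D. if x \<in> l \<and> good x l then f x * W x l ^ 2 else 0)"
      unfolding sum_distrib_left
    proof (rule sum_mono)
      fix l assume "l \<in> row x ` D"
      then have "x \<in> l" using mem_row by blast
      have "ksum x l ^ 2 \<le> (if good x l then W x l else 0) ^ 2"
        using ksum_le[of x l] unfolding W_def by (intro power_mono ksum_nonneg)
      then have "f x * ksum x l ^ 2 \<le> f x * (if good x l then W x l else 0) ^ 2"
        by (rule mult_left_mono) (rule f_nonneg)
      then show "f x * ksum x l ^ 2 \<le> (if x \<in> l \<and> good x l then f x * W x l ^ 2 else 0)"
        using \<open>x \<in> l\<close> by (simp split: if_splits)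
    qed
    also have "\<dots> \<le> (\<Sum>l\<in>side_lines. if x \<in> l \<and> good x l then f x * W x l ^ 2 else 0)"
    proof (rule sum_mono2[OF finite_side_lines])
      show "row x ` D \<subseteq> side_lines" by (rule image_subsetI) (rule row_in_side_lines[OF x])
    qed (simp add: f_nonneg)
    finally show "f x * (\<Sum>l\<in>row x ` D. ksum x l ^ 2) \<le>
      (\<Sum>l\<in>side_lines. if x \<in> l \<and> good x l then f x * W x l ^ 2 else 0)" .
  qed
  also have "\<dots> = (\<Sum>l\<in>side_lines. \<Sum>x\<in>S. if x \<in> l \<and> good x l then f x * W x l ^ 2 else 0)"
    by (rule sum.swap)
  also have "\<dots> = (\<Sum>l\<in>side_lines. \<Sum>x\<in>{x \<in> S \<inter> l. good x l}. f x * W x l ^ 2)"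
  proof (rule sum.cong[OF refl])
    fix l
    have "{x \<in> S. x \<in> l \<and> good x l} = {x \<in> S \<inter> l. good x l}" by blast
    then show "(\<Sum>x\<in>S. if x \<in> l \<and> good x l then f x * W x l ^ 2 else 0) =
        (\<Sum>x\<in>{x \<in> S \<inter> l. good x l}. f x * W x l ^ 2)"
      using finite_S by (simp add: sum.If_cases Int_def conj_assoc)
  qed
  also have "\<dots> \<le> 2 ^ 68 * real J * mass ^ 2"
    unfolding W_def by (rule good_lines_sum[OF finite_side_lines side_lines_lattice_lines J])
  finally show ?thesis .
qed

section \<open>Removal of lone vertices and the bound for all rectangles\<close>

lemma rect_form_le_square_form: "rect_form F \<le> square_form F F"
  unfolding square_form_eq_rect_form by (simp add: sum_nonneg)

lemma square_form_le_rect_form: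
  assumes "\<And>\<xi> x. 0 \<le> F \<xi> x \<and> F \<xi> x \<le> f x" shows "square_form F F \<le> rect_form F + mass ^ 2"
  unfolding square_form_eq_rect_form using diagonal_le[of F F] assms by simp

text \<open>A column holds at most one lone vertex. Hence each of the two mixed forms produced by
  the splitting has at most one nonzero term per column and costs \<open>mass ^ 2\<close>.\<close>

lemma square_form_remove_lone:
  assumes H: "\<And>\<xi> x. 0 \<le> H \<xi> x" and g: "\<And>\<xi> x. 0 \<le> g \<xi> x"
    and F: "\<And>\<xi> x. F \<xi> x = H \<xi> x + g \<xi> x" "\<And>\<xi> x. F \<xi> x \<le> f x"
    and lone: "\<And>\<xi> x. g \<xi> x \<noteq> 0 \<Longrightarrow> x \<in> S \<and> lone x (col x \<xi>)"
  shows "square_form F F \<le> 3 * square_form H H + 6 * mass ^ 2"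
proof -
  have F': "0 \<le> F \<xi> x \<and> F \<xi> x \<le> f x" for \<xi> x using H g F by simp
  have g': "0 \<le> g \<xi> x \<and> g \<xi> x \<le> f x" for \<xi> x using H[of \<xi> x] g[of \<xi> x] F(1)[of \<xi> x] F(2)[of \<xi> x] by simp
  have single: "x = y" if "\<xi> \<in> D" "B \<xi> x = B \<xi> y" "g \<xi> x \<noteq> 0" "g \<xi> y \<noteq> 0" for \<xi> x y
  proof -
    have "col x \<xi> = col y \<xi>"
      using that D_nonzero by (intro col_eqI) (auto simp: cross_def bform_diff)
    then show ?thesis
      using lone[OF that(3)] lone[OF that(4)] lone_unique[of x y "col x \<xi>"] mem_col[of x \<xi>] mem_col[of y \<xi>] by simp
  qed
  have "square_form g F \<le> mass ^ 2"
  proof (rule square_form_single_le[OF g' F'])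
    fix \<xi> x y assume "\<xi> \<in> D" "B \<xi> x = B \<xi> y" "g \<xi> x * F \<xi> (x + \<xi>) \<noteq> 0" "g \<xi> y * F \<xi> (y + \<xi>) \<noteq> 0"
    then show "x = y" by (intro single[of \<xi>]) simp_all
  qed
  moreover have "square_form F g \<le> mass ^ 2"
  proof (rule square_form_single_le[OF F' g'])
    fix \<xi> x y assume "\<xi> \<in> D" "B \<xi> x = B \<xi> y" "F \<xi> x * g \<xi> (x + \<xi>) \<noteq> 0" "F \<xi> y * g \<xi> (y + \<xi>) \<noteq> 0"
    then have "x + \<xi> = y + \<xi>" by (intro single[of \<xi>]) (simp_all add: bform_add)
    then show "x = y" by simp
  qed
  ultimately show ?thesis using square_form_split[of H g F, OF H g F(1)] by simp
qed

theorem rectangle_bound: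
  assumes J: "card S < 2 ^ J" "1 \<le> J"
  shows "rect_form (\<lambda>\<xi>. f) \<le> 2 ^ 76 * real J * mass ^ 2"
proof -
  define F1 where "F1 \<xi> x = (if in_rich \<xi> x then 0 else f x)" for \<xi> x
  define F2 where "F2 \<xi> x = (if in_rich \<xi> x \<or> lone x (col x \<xi>) then 0 else f x)" for \<xi> x
  define F3 where "F3 \<xi> x = (if in_rich \<xi> x \<or> lone x (row x \<xi>) then 0 else f x)" for \<xi> x
  define g1 where "g1 \<xi> x = (if in_rich \<xi> x then f x else 0)" for \<xi> x
  have "square_form (\<lambda>\<xi>. f) (\<lambda>\<xi>. f) \<le> 3 * square_form F1 F1 + 3 * square_form g1 (\<lambda>\<xi>. f) + 3 * square_form (\<lambda>\<xi>. f) g1"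
    by (rule square_form_split) (auto simp: F1_def g1_def f_nonneg)
  moreover have "square_form g1 (\<lambda>\<xi>. f) \<le> 2 ^ 27 * mass ^ 2"
    by (rule square_form_rich_left) (simp_all add: g1_def f_nonneg)
  moreover have "square_form (\<lambda>\<xi>. f) g1 \<le> 2 ^ 27 * mass ^ 2"
    by (rule square_form_rich_right) (simp_all add: g1_def f_nonneg)
  moreover have "square_form F1 F1 \<le> 3 * square_form F2 F2 + 6 * mass ^ 2"
  proof (rule square_form_remove_lone[where g = "\<lambda>\<xi> x. if \<not> in_rich \<xi> x \<and> lone x (col x \<xi>) then f x else 0"])
    show "(if \<not> in_rich \<xi> x \<and> lone x (col x \<xi>) then f x else 0) \<noteq> 0 \<Longrightarrow> x \<in> S \<and> lone x (col x \<xi>)" for \<xi> x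
      using f_zero[of x] by (auto split: if_splits)
  qed (simp_all add: F1_def F2_def f_nonneg)
  moreover have "square_form F2 F2 \<le> rect_form F2 + mass ^ 2"
    by (rule square_form_le_rect_form) (simp add: F2_def f_nonneg)
  \<comment> \<open>So far lone vertices have been removed from columns only. Exchanging the sides
    turns this into removal from rows, so the same lemma can be applied once more;
    \<open>in_rich\<close> is symmetric in row and column and survives the exchange.\<close>
  moreover have "rect_form F2 = rect_form F3"
  proof (rule rect_form_swap)
    fix \<xi> \<eta> x assume D: "\<xi> \<in> D" "\<eta> \<in> D" and orth: "B \<xi> \<eta> = 0"
    have "row x \<eta> = col x \<xi>" "col x \<eta> = row x \<xi>"
      using row_eq_col[OF orth] col_eq_row[OF orth] D D_nonzero by blast+
    then show "F2 \<xi> x = F3 \<eta> x" by (simp add: F2_def F3_def in_rich_def disj_commute)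
  qed (simp_all add: F2_def F3_def f_zero)
  moreover have "square_form F3 F3 \<le> 3 * square_form good_part good_part + 6 * mass ^ 2"
  proof (rule square_form_remove_lone[where g = "\<lambda>\<xi> x. if \<not> in_rich \<xi> x \<and> \<not> lone x (row x \<xi>) \<and> lone x (col x \<xi>) then f x else 0"])
    show "(if \<not> in_rich \<xi> x \<and> \<not> lone x (row x \<xi>) \<and> lone x (col x \<xi>) then f x else 0) \<noteq> 0 \<Longrightarrow>
        x \<in> S \<and> lone x (col x \<xi>)" for \<xi> x
      using f_zero[of x] by (auto split: if_splits)
  qed (auto simp: F3_def good_part_def good_def in_rich_def f_nonneg)
  moreover have "square_form good_part good_part \<le> rect_form good_part + mass ^ 2"
    by (rule square_form_le_rect_form) (simp add: good_part_def f_nonneg)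
  moreover have "rect_form good_part \<le> 4 * (2 ^ 68 * real J * mass ^ 2)"
    using rect_form_good_le_corners sum_corners_le[OF J(1)] by linarith
  moreover have "rect_form F3 \<le> square_form F3 F3" "rect_form (\<lambda>\<xi>. f) \<le> square_form (\<lambda>\<xi>. f) (\<lambda>\<xi>. f)" by (rule rect_form_le_square_form)+
  \<comment> \<open>The factor 108 is 27 from three splittings times 4 from the corners; the
    remaining terms amount to \<open>6 * 2 ^ 27 + 108\<close>, which is below
    \<open>2 ^ 30\<close>.\<close>
  ultimately have "rect_form (\<lambda>\<xi>. f) \<le> 108 * (2 ^ 68 * (real J * mass ^ 2)) + 2 ^ 30 * mass ^ 2"
    by (simp, use zero_le_power2[of mass] in linarith)
  also have "\<dots> \<le> 108 * (2 ^ 68 * (real J * mass ^ 2)) + 2 ^ 30 * (real J * mass ^ 2)"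
    using J(2) mult_right_mono[of 1 "real J" "mass ^ 2"] by simp
  also have "\<dots> \<le> 2 ^ 76 * (real J * mass ^ 2)"
  proof -
    have "0 \<le> real J * mass ^ 2" by simp
    then show ?thesis by simp
  qed
  finally show ?thesis by simp
qed

end

section \<open>Parallelograms with long sides\<close>

text \<open>Measured from the least element in units of \<open>m\<close>, the elements become
  distinct integers between 0 and \<open>2 * R div m\<close>.\<close>

lemma card_residue_class_le:
  fixes T :: "int set" and m R :: int
  assumes T: "\<And>t. t \<in> T \<Longrightarrow> \<bar>t\<bar> \<le> R" and m: "0 < m" and R: "0 \<le> R"
    and dvd: "\<And>s t. s \<in> T \<Longrightarrow> t \<in> T \<Longrightarrow> m dvd s - t"
  shows "int (card T) \<le> 2 * R div m + 1"
proof (cases "T = {}")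
  case False
  have fin: "finite T"
    by (rule finite_subset[of _ "{-R..R}"]) (use T in \<open>auto simp: abs_le_iff\<close>, use T in force)
  define t0 where "t0 = Min T"
  have t0: "t0 \<in> T" "\<And>t. t \<in> T \<Longrightarrow> t0 \<le> t" using fin False by (auto simp: t0_def)
  have "card T \<le> card {0..2 * R div m}"
  proof (rule card_inj_on_le[where f = "\<lambda>t. (t - t0) div m"])
    show "inj_on (\<lambda>t. (t - t0) div m) T"
    proof (rule inj_onI)
      fix s t assume st: "s \<in> T" "t \<in> T" and eq: "(s - t0) div m = (t - t0) div m"
      have "s - t0 = m * ((s - t0) div m)" using dvd[OF st(1) t0(1)] by simp
      also have "\<dots> = m * ((t - t0) div m)" by (simp only: eq)
      also have "\<dots> = t - t0" using dvd[OF st(2) t0(1)] by simp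
      finally show "s = t" by simp
    qed
    show "(\<lambda>t. (t - t0) div m) ` T \<subseteq> {0..2 * R div m}"
    proof
      fix u assume "u \<in> (\<lambda>t. (t - t0) div m) ` T"
      then obtain t where t: "t \<in> T" "u = (t - t0) div m" by auto
      have "t - t0 \<le> 2 * R" using T[OF t(1)] T[OF t0(1)] by linarith
      then show "u \<in> {0..2 * R div m}"
        using t t0(2)[OF t(1)] m by (simp add: zdiv_mono1 pos_imp_zdiv_nonneg_iff)
    qed
  qed simp
  moreover have "0 \<le> 2 * R div m" using R m by (simp add: pos_imp_zdiv_nonneg_iff)
  ultimately show ?thesis by simp
qed (use R m in \<open>simp add: pos_imp_zdiv_nonneg_iff\<close>)

definition sup_norm :: "int \<times> int \<Rightarrow> int"
  where "sup_norm v = max \<bar>fst v\<bar> \<bar>snd v\<bar>"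

lemma finite_sup_norm_le: "finite {\<eta>. sup_norm \<eta> \<le> R}"
proof (rule finite_subset)
  show "{\<eta>. sup_norm \<eta> \<le> R} \<subseteq> {-R..R} \<times> {-R..R}"
  proof
    fix \<eta> assume "\<eta> \<in> {\<eta>. sup_norm \<eta> \<le> R}"
    then show "\<eta> \<in> {-R..R} \<times> {-R..R}" by (cases \<eta>) (auto simp: sup_norm_def abs_le_iff)
  qed
qed simp

text \<open>In \<open>p * fst \<eta> + q * snd \<eta> = \<sigma>\<close> the second coordinate
  determines the first and is fixed modulo \<open>\<bar>p\<bar> div g\<close>. Since the larger
  coordinate of \<xi> enters \<open>p\<close>, the allowed range for it has length of order at most
  \<open>\<bar>p\<bar>\<close>, so there are at most \<open>2 * g + 1\<close> solutions.\<close>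

lemma card_bform_fibre_le_aux:
  assumes ab: "a \<noteq> 0" "b \<noteq> 0" and \<xi>: "\<xi> \<noteq> 0" and dom: "\<bar>snd \<xi>\<bar> \<le> \<bar>fst \<xi>\<bar>"
  shows "int (card {\<eta>. sup_norm \<eta> \<le> sup_norm \<xi> \<and> bform a b \<xi> \<eta> = \<sigma>}) \<le> 3 * gcd (a * fst \<xi>) (b * snd \<xi>)"
proof -
  define p q g m where "p = a * fst \<xi>" and "q = b * snd \<xi>" and "g = gcd p q" and "m = \<bar>p\<bar> div g"
  define R where "R = \<bar>fst \<xi>\<bar>"
  define A where "A = {\<eta>. sup_norm \<eta> \<le> sup_norm \<xi> \<and> bform a b \<xi> \<eta> = \<sigma>}"
  have R: "sup_norm \<xi> = R" "0 < R"
    using dom \<xi> by (auto simp: sup_norm_def R_def prod_eq_iff)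
  have p: "p \<noteq> 0" using ab R(2) by (auto simp: p_def R_def)
  have "0 < g" using p by (simp add: g_def)
  then have g: "0 < g" "1 \<le> g" by simp_all
  have mg: "m * g = \<bar>p\<bar>" by (simp add: m_def g_def)
  have "0 < m * g" using mg p by simp
  then have m: "0 < m" using g(1) by (rule zero_less_mult_pos2)
  have eq: "p * fst \<eta> + q * snd \<eta> = \<sigma>" if "\<eta> \<in> A" for \<eta>
    using that by (simp add: A_def bform_def p_def q_def)
  have inj: "inj_on snd A"
  proof (rule inj_onI)
    fix \<eta> \<eta>' assume \<eta>: "\<eta> \<in> A" "\<eta>' \<in> A" and snd: "snd \<eta> = snd \<eta>'"
    have "p * fst \<eta> = p * fst \<eta>'"
      using eq[OF \<eta>(1)] eq[OF \<eta>(2)] unfolding snd by linarith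
    with p snd show "\<eta> = \<eta>'" by (simp add: prod_eq_iff)
  qed
  have "int (card (snd ` A)) \<le> 2 * R div m + 1"
  proof (rule card_residue_class_le[OF _ m])
    show "\<bar>t\<bar> \<le> R" if "t \<in> snd ` A" for t
      using that R(1) by (auto simp: A_def sup_norm_def)
    fix s t assume "s \<in> snd ` A" "t \<in> snd ` A"
    then obtain \<eta> \<eta>' where st: "\<eta> \<in> A" "s = snd \<eta>" "\<eta>' \<in> A" "t = snd \<eta>'" by blast
    have "\<exists>p' q'. p = p' * g \<and> q = q' * g \<and> coprime p' q'"
      unfolding g_def by (rule gcd_coprime_exists) (use p in simp)
    then obtain p' q' where pq: "p = p' * g" "q = q' * g" and cop: "coprime p' q'" by blast
    have "m * g = \<bar>p'\<bar> * g" unfolding mg pq(1) using g by (simp add: abs_mult)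
    then have m': "m = \<bar>p'\<bar>" using g by simp
    have "p * (fst \<eta> - fst \<eta>') = q * (t - s)"
      using eq[OF st(1)] eq[OF st(3)] by (simp add: st algebra_simps)
    then have "g * (p' * (fst \<eta> - fst \<eta>')) = g * (q' * (t - s))"
      unfolding pq by (simp only: ac_simps)
    then have "p' * (fst \<eta> - fst \<eta>') = q' * (t - s)" using g by simp
    then have "p' dvd q' * (t - s)" by (intro dvdI[of _ _ "fst \<eta> - fst \<eta>'"]) (rule sym)
    then have "p' dvd t - s" using cop by (simp add: coprime_dvd_mult_right_iff)
    then show "m dvd s - t" unfolding m' by (simp add: dvd_diff_commute)
  qed (use R in simp)
  then have card: "int (card A) \<le> 2 * R div m + 1" by (simp add: card_image[OF inj])
  \<comment> \<open>The shorter side is confined to size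
    \<open>R = \<bar>fst \<xi>\<bar> \<le> \<bar>p\<bar> = m * g\<close>; this is where the order of
    the two lengths matters.\<close>
  have "1 * R \<le> \<bar>a\<bar> * R" using ab(1) R(2) by (intro mult_right_mono) auto
  then have "R \<le> \<bar>p\<bar>" by (simp add: R_def p_def abs_mult)
  then have "2 * R \<le> m * (2 * g)" using mg by simp
  then have "2 * R div m \<le> (m * (2 * g)) div m" using m by (intro zdiv_mono1)
  then have "2 * R div m \<le> 2 * g" using m by simp
  with card g(2) show ?thesis by (simp add: A_def g_def p_def q_def)
qed

lemma card_bform_fibre_le:
  assumes ab: "a \<noteq> 0" "b \<noteq> 0" and \<xi>: "\<xi> \<noteq> 0"
  shows "int (card {\<eta>. sup_norm \<eta> \<le> sup_norm \<xi> \<and> bform a b \<xi> \<eta> = \<sigma>}) \<le> 3 * gcd (a * fst \<xi>) (b * snd \<xi>)"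
proof (cases "\<bar>snd \<xi>\<bar> \<le> \<bar>fst \<xi>\<bar>")
  case True
  then show ?thesis by (rule card_bform_fibre_le_aux[OF assms])
next
  case False
  define \<xi>' where "\<xi>' = prod.swap \<xi>"
  have swap_mem: "\<eta> \<in> prod.swap ` X \<longleftrightarrow> prod.swap \<eta> \<in> X" for \<eta> :: "int \<times> int" and X
  proof
    assume "prod.swap \<eta> \<in> X"
    then have "prod.swap (prod.swap \<eta>) \<in> prod.swap ` X" by (rule imageI)
    then show "\<eta> \<in> prod.swap ` X" by simp
  qed auto
  have "{\<eta>. sup_norm \<eta> \<le> sup_norm \<xi> \<and> bform a b \<xi> \<eta> = \<sigma>} =
      prod.swap ` {\<eta>. sup_norm \<eta> \<le> sup_norm \<xi>' \<and> bform b a \<xi>' \<eta> = \<sigma>}"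
  proof (rule set_eqI)
    fix \<eta>
    have "sup_norm \<eta> \<le> sup_norm \<xi> \<and> bform a b \<xi> \<eta> = \<sigma> \<longleftrightarrow>
        sup_norm (prod.swap \<eta>) \<le> sup_norm \<xi>' \<and> bform b a \<xi>' (prod.swap \<eta>) = \<sigma>"
      by (simp add: sup_norm_def bform_def \<xi>'_def max.commute add.commute)
    then show "\<eta> \<in> {\<eta>. sup_norm \<eta> \<le> sup_norm \<xi> \<and> bform a b \<xi> \<eta> = \<sigma>} \<longleftrightarrow>
        \<eta> \<in> prod.swap ` {\<eta>. sup_norm \<eta> \<le> sup_norm \<xi>' \<and> bform b a \<xi>' \<eta> = \<sigma>}"
      unfolding swap_mem by simp
  qed
  then have "card {\<eta>. sup_norm \<eta> \<le> sup_norm \<xi> \<and> bform a b \<xi> \<eta> = \<sigma>} =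
      card {\<eta>. sup_norm \<eta> \<le> sup_norm \<xi>' \<and> bform b a \<xi>' \<eta> = \<sigma>}"
    by (simp add: card_image)
  moreover have "int (card {\<eta>. sup_norm \<eta> \<le> sup_norm \<xi>' \<and> bform b a \<xi>' \<eta> = \<sigma>}) \<le>
      3 * gcd (b * fst \<xi>') (a * snd \<xi>')"
    using False ab \<xi> by (intro card_bform_fibre_le_aux) (auto simp: \<xi>'_def prod_eq_iff)
  ultimately show ?thesis by (simp add: \<xi>'_def gcd.commute)
qed

text \<open>A common divisor makes the fibres larger but the values rarer: values are multiples of
  \<open>g\<close>, so at most \<open>2 * (int M div g)\<close> nonzero ones are in range, each with
  at most \<open>3 * g\<close> solutions. The value 0 escapes this balance and is treated
  apart.\<close>

lemma card_bform_nonzero_le: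
  assumes ab: "a \<noteq> 0" "b \<noteq> 0" and \<xi>: "\<xi> \<noteq> 0"
  shows "card {\<eta>. sup_norm \<eta> \<le> sup_norm \<xi> \<and> bform a b \<xi> \<eta> \<noteq> 0 \<and> \<bar>bform a b \<xi> \<eta>\<bar> \<le> int M} \<le> 6 * M"
proof -
  define g where "g = gcd (a * fst \<xi>) (b * snd \<xi>)"
  have g: "0 < g" using ab \<xi> by (auto simp: g_def prod_eq_iff)
  define E where "E \<sigma> = {\<eta>. sup_norm \<eta> \<le> sup_norm \<xi> \<and> bform a b \<xi> \<eta> = \<sigma>}" for \<sigma>
  have finE: "finite (E \<sigma>)" for \<sigma>
    by (rule finite_subset[OF _ finite_sup_norm_le[of "sup_norm \<xi>"]]) (auto simp: E_def)
  define U where "U = {- (int M div g)..int M div g} - {0}"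
  have k0: "0 \<le> int M div g" using g by (simp add: pos_imp_zdiv_nonneg_iff)
  have cU: "int (card U) = 2 * (int M div g)"
    using k0 by (simp add: U_def card_Diff_singleton)
  have "{\<eta>. sup_norm \<eta> \<le> sup_norm \<xi> \<and> bform a b \<xi> \<eta> \<noteq> 0 \<and> \<bar>bform a b \<xi> \<eta>\<bar> \<le> int M} \<subseteq> (\<Union>u\<in>U. E (g * u))"
  proof
    fix \<eta> assume \<eta>: "\<eta> \<in> {\<eta>. sup_norm \<eta> \<le> sup_norm \<xi> \<and> bform a b \<xi> \<eta> \<noteq> 0 \<and> \<bar>bform a b \<xi> \<eta>\<bar> \<le> int M}"
    have "g dvd bform a b \<xi> \<eta>" 
      unfolding bform_def g_def by (rule dvd_add[OF dvd_mult2[OF gcd_dvd1] dvd_mult2[OF gcd_dvd2]])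
    then obtain u where u: "bform a b \<xi> \<eta> = g * u" by (rule dvdE)
    have "\<bar>u\<bar> * g \<le> int M" using \<eta> g by (simp add: u abs_mult mult.commute)
    then have "\<bar>u\<bar> * g div g \<le> int M div g" using g by (rule zdiv_mono1)
    then have "\<bar>u\<bar> \<le> int M div g" using g by simp
    moreover have "u \<noteq> 0" using \<eta> u by auto
    ultimately have "u \<in> U" by (auto simp: U_def)
    with \<eta> u show "\<eta> \<in> (\<Union>u\<in>U. E (g * u))" by (auto simp: E_def)
  qed
  then have "card {\<eta>. sup_norm \<eta> \<le> sup_norm \<xi> \<and> bform a b \<xi> \<eta> \<noteq> 0 \<and> \<bar>bform a b \<xi> \<eta>\<bar> \<le> int M} \<le> card (\<Union>u\<in>U. E (g * u))"
    by (intro card_mono finite_UN_I finE) (auto simp: U_def)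
  also have "\<dots> \<le> (\<Sum>u\<in>U. card (E (g * u)))"
    by (rule card_UN_le) (simp add: U_def)
  finally have "int (card {\<eta>. sup_norm \<eta> \<le> sup_norm \<xi> \<and> bform a b \<xi> \<eta> \<noteq> 0 \<and> \<bar>bform a b \<xi> \<eta>\<bar> \<le> int M}) \<le> (\<Sum>u\<in>U. int (card (E (g * u))))"
    unfolding of_nat_sum[symmetric] by (rule of_nat_mono)
  also have "\<dots> \<le> (\<Sum>u\<in>U. 3 * g)"
    unfolding E_def g_def by (intro sum_mono card_bform_fibre_le ab \<xi>)
  also have "\<dots> = 6 * ((int M div g) * g)" by (simp add: cU)
  also have "\<dots> \<le> 6 * int M"
    using pos_mod_sign[OF g, of "int M"] minus_mod_eq_div_mult[of "int M" g] by linarith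
  finally show ?thesis by linarith
qed

section \<open>Counting parallelograms by their longer side\<close>

definition quads :: "(int \<times> int) set \<Rightarrow> (int \<times> int \<Rightarrow> int \<times> int \<Rightarrow> bool) \<Rightarrow>
    ((int \<times> int) \<times> (int \<times> int) \<times> (int \<times> int)) set"
  where "quads S Rel = {(x, \<xi>, \<eta>). x \<in> S \<and> x + \<xi> \<in> S \<and> x + \<eta> \<in> S \<and> x + \<xi> + \<eta> \<in> S \<and> Rel \<xi> \<eta>}"

definition quad_prod :: "(int \<times> int \<Rightarrow> real) \<Rightarrow> (int \<times> int) \<times> (int \<times> int) \<times> (int \<times> int) \<Rightarrow> real"
  where "quad_prod f = (\<lambda>(x, \<xi>, \<eta>). f x * f (x + \<xi>) * f (x + \<eta>) * f (x + \<xi> + \<eta>))"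

lemma quads_iff: "(x, \<xi>, \<eta>) \<in> quads S Rel \<longleftrightarrow>
    x \<in> S \<and> x + \<xi> \<in> S \<and> x + \<eta> \<in> S \<and> x + \<xi> + \<eta> \<in> S \<and> Rel \<xi> \<eta>"
  by (simp add: quads_def)

lemma finite_quads: assumes "finite S" shows "finite (quads S Rel)"
proof (rule finite_subset)
  show "quads S Rel \<subseteq> (\<lambda>(x, y, z). (x, y - x, z - x)) ` (S \<times> S \<times> S)"
  proof
    fix p assume p: "p \<in> quads S Rel"
    obtain x \<xi> \<eta> where pe: "p = (x, \<xi>, \<eta>)" by (cases p)
    have "p = (\<lambda>(x, y, z). (x, y - x, z - x)) (x, x + \<xi>, x + \<eta>)" by (simp add: pe)
    moreover have "(x, x + \<xi>, x + \<eta>) \<in> S \<times> S \<times> S" using p by (simp add: pe quads_iff)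
    ultimately show "p \<in> (\<lambda>(x, y, z). (x, y - x, z - x)) ` (S \<times> S \<times> S)" by (rule image_eqI)
  qed
qed (use assms in simp)

text \<open>By symmetry \<eta> may be taken as the shorter side, at the price of a factor 2. The
  product is split into the two opposite sides parallel to \<xi>; each of them is an arbitrary pair
  of points with at most \<open>K\<close> choices of \<eta>.\<close>

lemma quad_sum_le:
  fixes K :: nat
  assumes S: "finite S" and f: "\<And>x. 0 \<le> f x" and sym: "\<And>\<xi> \<eta>. Rel \<xi> \<eta> \<Longrightarrow> Rel \<eta> \<xi>"
    and K: "\<And>x y. x \<in> S \<Longrightarrow> y \<in> S \<Longrightarrow> card {\<eta>. sup_norm \<eta> \<le> sup_norm (y - x) \<and> Rel (y - x) \<eta>} \<le> K"
  shows "(\<Sum>p\<in>quads S Rel. quad_prod f p) \<le> 2 * real K * (\<Sum>x\<in>S. f x ^ 2) ^ 2"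
proof -
  define g where "g = quad_prod f"
  define H where "H \<xi> = {\<eta>. sup_norm \<eta> \<le> sup_norm \<xi> \<and> Rel \<xi> \<eta>}" for \<xi>
  define Q where "Q = quads S Rel"
  define Q1 where "Q1 = {p \<in> Q. sup_norm (snd (snd p)) \<le> sup_norm (fst (snd p))}"
  define Q2 where "Q2 = {p \<in> Q. sup_norm (fst (snd p)) \<le> sup_norm (snd (snd p))}"
  have fin: "finite Q" "finite Q1" "finite Q2" using finite_quads[OF S] by (auto simp: Q_def Q1_def Q2_def)
  have finH: "finite (H \<xi>)" for \<xi>
    by (rule finite_subset[OF _ finite_sup_norm_le[of "sup_norm \<xi>"]]) (auto simp: H_def)
  have g0: "0 \<le> g p" for p by (simp add: g_def quad_prod_def f case_prod_unfold)
  define P where "P = (SIGMA x:S. SIGMA y:S. H (y - x))"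
  have finP: "finite P" unfolding P_def using S finH by (intro finite_SigmaI) auto
  define h where "h q = (f (fst q) * f (fst (snd q))) ^ 2"
    for q :: "(int \<times> int) \<times> (int \<times> int) \<times> (int \<times> int)"
  have P_sum: "(\<Sum>q\<in>P. h q) \<le> real K * (\<Sum>x\<in>S. f x ^ 2) ^ 2"
  proof -
    have "(\<Sum>q\<in>P. h q) = (\<Sum>(x, y, \<eta>)\<in>P. (f x * f y) ^ 2)"
      by (simp add: h_def case_prod_unfold)
    also have "\<dots> = (\<Sum>x\<in>S. \<Sum>y\<in>S. real (card (H (y - x))) * (f x * f y) ^ 2)"
      unfolding P_def using S finH by (simp add: sum.Sigma[symmetric] finite_SigmaI)
    also have "\<dots> \<le> (\<Sum>x\<in>S. \<Sum>y\<in>S. real K * (f x * f y) ^ 2)"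
      using K by (intro sum_mono mult_right_mono) (simp_all add: H_def)
    also have "\<dots> = real K * (\<Sum>x\<in>S. f x ^ 2) ^ 2"
      unfolding power2_eq_square[of "\<Sum>x\<in>S. f x ^ 2"] sum_product
      by (simp add: sum_distrib_left power_mult_distrib)
    finally show ?thesis .
  qed
  have inj_sum: "(\<Sum>p\<in>Q1. h (\<phi> p)) \<le> real K * (\<Sum>x\<in>S. f x ^ 2) ^ 2"
    if "inj_on \<phi> Q1" "\<And>p. p \<in> Q1 \<Longrightarrow> \<phi> p \<in> P" for \<phi>
  proof -
    have "(\<Sum>p\<in>Q1. h (\<phi> p)) = (\<Sum>q\<in>\<phi> ` Q1. h q)" by (simp add: sum.reindex[OF that(1)])
    also have "\<dots> \<le> (\<Sum>q\<in>P. h q)"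
      using that(2) by (intro sum_mono2[OF finP]) (auto simp: h_def)
    finally show ?thesis using P_sum by linarith
  qed
  define \<phi>1 where "\<phi>1 p = (fst p, fst p + fst (snd p), snd (snd p))"
    for p :: "(int \<times> int) \<times> (int \<times> int) \<times> (int \<times> int)"
  define \<phi>2 where "\<phi>2 p = (fst p + snd (snd p), fst p + fst (snd p) + snd (snd p), snd (snd p))"
    for p :: "(int \<times> int) \<times> (int \<times> int) \<times> (int \<times> int)"
  have 1: "(\<Sum>p\<in>Q1. h (\<phi>1 p)) \<le> real K * (\<Sum>x\<in>S. f x ^ 2) ^ 2"
  proof (rule inj_sum)
    show "inj_on \<phi>1 Q1" by (rule inj_onI) (simp add: \<phi>1_def prod_eq_iff)
    fix p assume p: "p \<in> Q1"
    obtain x \<xi> \<eta> where pe: "p = (x, \<xi>, \<eta>)" by (cases p)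
    show "\<phi>1 p \<in> P" using p by (simp add: pe \<phi>1_def P_def Q1_def Q_def quads_iff H_def)
  qed
  have 2: "(\<Sum>p\<in>Q1. h (\<phi>2 p)) \<le> real K * (\<Sum>x\<in>S. f x ^ 2) ^ 2"
  proof (rule inj_sum)
    show "inj_on \<phi>2 Q1" by (rule inj_onI) (simp add: \<phi>2_def prod_eq_iff)
    fix p assume p: "p \<in> Q1"
    obtain x \<xi> \<eta> where pe: "p = (x, \<xi>, \<eta>)" by (cases p)
    show "\<phi>2 p \<in> P" using p by (simp add: pe \<phi>2_def P_def Q1_def Q_def quads_iff H_def)
  qed
  \<comment> \<open>The maps \<open>\<phi>1\<close> and \<open>\<phi>2\<close> record one of the two
    longer sides together with \<eta>, which determines the parallelogram.\<close>
  have "(\<Sum>p\<in>Q1. g p) \<le> (\<Sum>p\<in>Q1. h (\<phi>1 p) / 2 + h (\<phi>2 p) / 2)"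
  proof (rule sum_mono)
    fix p assume "p \<in> Q1"
    obtain x \<xi> \<eta> where pe: "p = (x, \<xi>, \<eta>)" by (cases p)
    have "2 * ((f x * f (x + \<xi>)) * (f (x + \<eta>) * f (x + \<xi> + \<eta>))) \<le>
        (f x * f (x + \<xi>)) ^ 2 + (f (x + \<eta>) * f (x + \<xi> + \<eta>)) ^ 2"
      using sum_squares_bound[of "f x * f (x + \<xi>)" "f (x + \<eta>) * f (x + \<xi> + \<eta>)"] by simp
    then show "g p \<le> h (\<phi>1 p) / 2 + h (\<phi>2 p) / 2"
      by (simp add: pe g_def quad_prod_def h_def \<phi>1_def \<phi>2_def mult.assoc)
  qed
  then have Q1: "(\<Sum>p\<in>Q1. g p) \<le> real K * (\<Sum>x\<in>S. f x ^ 2) ^ 2"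
    using 1 2 by (simp add: sum.distrib sum_divide_distrib[symmetric])
  have Q2: "(\<Sum>p\<in>Q2. g p) = (\<Sum>p\<in>Q1. g p)"
  proof (rule sum.reindex_bij_witness[of _ "\<lambda>p. (fst p, snd (snd p), fst (snd p))" "\<lambda>p. (fst p, snd (snd p), fst (snd p))"])
    fix p assume p: "p \<in> Q2"
    obtain x \<xi> \<eta> where pe: "p = (x, \<xi>, \<eta>)" by (cases p)
    show "(fst p, snd (snd p), fst (snd p)) \<in> Q1"
      using p sym by (simp add: pe Q1_def Q2_def Q_def quads_iff ac_simps)
    show "g (fst p, snd (snd p), fst (snd p)) = g p"
      by (simp add: pe g_def quad_prod_def ac_simps)
  next
    fix p assume p: "p \<in> Q1"
    obtain x \<xi> \<eta> where pe: "p = (x, \<xi>, \<eta>)" by (cases p)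
    show "(fst p, snd (snd p), fst (snd p)) \<in> Q2"
      using p sym by (simp add: pe Q1_def Q2_def Q_def quads_iff ac_simps)
  qed simp_all
  have "Q = Q1 \<union> Q2" by (auto simp: Q1_def Q2_def simp del: split_paired_All)
  then have "(\<Sum>p\<in>Q. g p) \<le> (\<Sum>p\<in>Q1. g p) + (\<Sum>p\<in>Q2. g p)"
    using sum.union_inter[OF fin(2,3), of g] sum_nonneg[of "Q1 \<inter> Q2" g] g0 by simp
  with Q1 Q2 show ?thesis by (simp add: g_def Q_def)
qed

lemma bform_zero_left [simp]: "bform a b 0 \<eta> = 0" and bform_zero_right [simp]: "bform a b \<eta> 0 = 0"
  by (simp_all add: bform_def)

lemma sup_norm_le_0_iff: "sup_norm v \<le> 0 \<longleftrightarrow> v = 0"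
  by (auto simp: sup_norm_def prod_eq_iff)

lemma sup_norm_zero [simp]: "sup_norm 0 = 0"
  by (simp add: sup_norm_def)

text \<open>The fibre over 0 has at most \<open>3 * g\<close> elements, and \<open>g\<close> is at
  most \<open>2 * (\<bar>a\<bar> + \<bar>b\<bar>) * N\<close> in the box. For \<xi> = 0 the only
  shorter side is 0, whence the final 1.\<close>

lemma quad_sum_box_le:
  assumes ab: "a \<noteq> 0" "b \<noteq> 0" and f: "\<And>x. 0 \<le> f x"
  shows "(\<Sum>p\<in>quads (freq_box N) (\<lambda>\<xi> \<eta>. \<bar>bform a b \<xi> \<eta>\<bar> \<le> int M). quad_prod f p) \<le>
    2 * real (6 * M + 6 * nat (\<bar>a\<bar> + \<bar>b\<bar>) * N + 1) * (\<Sum>x\<in>freq_box N. f x ^ 2) ^ 2"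
proof (rule quad_sum_le[OF finite_freq_box f])
  fix x y assume xy: "x \<in> freq_box N" "y \<in> freq_box N"
  define \<xi> where "\<xi> = y - x"
  have \<xi>N: "\<bar>fst \<xi>\<bar> \<le> 2 * int N" "\<bar>snd \<xi>\<bar> \<le> 2 * int N"
    using xy by (auto simp: \<xi>_def freq_box_def mem_Times_iff)
  have "card {\<eta>. sup_norm \<eta> \<le> sup_norm \<xi> \<and> \<bar>bform a b \<xi> \<eta>\<bar> \<le> int M} \<le> 6 * M + 6 * nat (\<bar>a\<bar> + \<bar>b\<bar>) * N + 1"
  proof (cases "\<xi> = 0")
    case True
    then have "{\<eta>. sup_norm \<eta> \<le> sup_norm \<xi> \<and> \<bar>bform a b \<xi> \<eta>\<bar> \<le> int M} \<subseteq> {0}"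
      using sup_norm_le_0_iff by fastforce
    then have "card {\<eta>. sup_norm \<eta> \<le> sup_norm \<xi> \<and> \<bar>bform a b \<xi> \<eta>\<bar> \<le> int M} \<le> card {0 :: int \<times> int}"
      by (intro card_mono) auto
    then show ?thesis by simp
  next
    case False
    define g where "g = gcd (a * fst \<xi>) (b * snd \<xi>)"
    define X where "X = {\<eta>. sup_norm \<eta> \<le> sup_norm \<xi> \<and> bform a b \<xi> \<eta> \<noteq> 0 \<and> \<bar>bform a b \<xi> \<eta>\<bar> \<le> int M}"
    define Y where "Y = {\<eta>. sup_norm \<eta> \<le> sup_norm \<xi> \<and> bform a b \<xi> \<eta> = 0}"
    have g: "g \<le> 2 * ((\<bar>a\<bar> + \<bar>b\<bar>) * int N)"
    proof -
      have le: "\<bar>c\<bar> * \<bar>t\<bar> \<le> 2 * ((\<bar>a\<bar> + \<bar>b\<bar>) * int N)" if "\<bar>c\<bar> \<le> \<bar>a\<bar> + \<bar>b\<bar>" "\<bar>t\<bar> \<le> 2 * int N" for c t :: int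
      proof -
        have "\<bar>c\<bar> * \<bar>t\<bar> \<le> (\<bar>a\<bar> + \<bar>b\<bar>) * (2 * int N)" using that by (intro mult_mono) auto
        then show ?thesis by simp
      qed
      show ?thesis
      proof (cases "fst \<xi> = 0")
        case True
        then have "g = \<bar>b\<bar> * \<bar>snd \<xi>\<bar>" by (simp add: g_def abs_mult)
        with le[of b "snd \<xi>"] \<xi>N show ?thesis by simp
      next
        case nz: False
        have "g dvd a * fst \<xi>" by (simp add: g_def)
        then have "g \<le> \<bar>a * fst \<xi>\<bar>" using nz ab by (intro zdvd_imp_le) auto
        also have "\<dots> = \<bar>a\<bar> * \<bar>fst \<xi>\<bar>" by (rule abs_mult)
        finally show ?thesis using le[of a "fst \<xi>"] \<xi>N by simp
      qed
    qed
    have finXY: "finite (X \<union> Y)"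
      by (rule finite_subset[OF _ finite_sup_norm_le[of "sup_norm \<xi>"]]) (auto simp: X_def Y_def)
    have "card {\<eta>. sup_norm \<eta> \<le> sup_norm \<xi> \<and> \<bar>bform a b \<xi> \<eta>\<bar> \<le> int M} \<le> card (X \<union> Y)"
      by (rule card_mono[OF finXY]) (auto simp: X_def Y_def)
    also have "\<dots> \<le> card X + card Y" by (rule card_Un_le)
    finally have "int (card {\<eta>. sup_norm \<eta> \<le> sup_norm \<xi> \<and> \<bar>bform a b \<xi> \<eta>\<bar> \<le> int M}) \<le> int (card X) + int (card Y)"
      by linarith
    moreover have "card X \<le> 6 * M" unfolding X_def by (rule card_bform_nonzero_le[OF ab False])
    moreover have "int (card Y) \<le> 3 * g" unfolding Y_def g_def by (rule card_bform_fibre_le[OF ab False])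
    moreover have "int (nat (\<bar>a\<bar> + \<bar>b\<bar>) * N) = (\<bar>a\<bar> + \<bar>b\<bar>) * int N" by simp
    ultimately show ?thesis using g by linarith
  qed
  then show "card {\<eta>. sup_norm \<eta> \<le> sup_norm (y - x) \<and> \<bar>bform a b (y - x) \<eta>\<bar> \<le> int M} \<le>
      6 * M + 6 * nat (\<bar>a\<bar> + \<bar>b\<bar>) * N + 1"
    by (simp add: \<xi>_def)
qed (simp add: bform_commute)

text \<open>Nonzero values are counted by longer sides (\<open>R1\<close>) and give
  \<open>12 * M\<close>, degenerate parallelograms (\<open>R2\<close>) give 2, and what is left
  (\<open>R3\<close>) are the rectangles of \<open>rectangle_bound\<close>, on the set where
  \<open>f\<close> is positive.\<close>

lemma quad_sum_box_anisotropic_le: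
  assumes ani: "\<And>\<xi>. bform a b \<xi> \<xi> = 0 \<Longrightarrow> \<xi> = 0" and f: "\<And>x. 0 \<le> f x" "\<And>x. x \<notin> freq_box N \<Longrightarrow> f x = 0"
    and J: "card (freq_box N) < 2 ^ J" "1 \<le> J"
  shows "(\<Sum>p\<in>quads (freq_box N) (\<lambda>\<xi> \<eta>. \<bar>bform a b \<xi> \<eta>\<bar> \<le> int M). quad_prod f p) \<le>
    (12 * real M + 2 + 2 ^ 76 * real J) * (\<Sum>x\<in>freq_box N. f x ^ 2) ^ 2"
proof -
  define S where "S = {x \<in> freq_box N. 0 < f x}"
  interpret rectangles S f a b
    using ani f finite_freq_box by unfold_locales (auto simp: S_def less_le)
  have mass: "mass = (\<Sum>x\<in>freq_box N. f x ^ 2)"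
    unfolding mass_def using finite_freq_box f by (intro sum.mono_neutral_left) (auto simp: S_def less_le)
  define R1 where "R1 \<xi> \<eta> \<longleftrightarrow> B \<xi> \<eta> \<noteq> 0 \<and> \<bar>B \<xi> \<eta>\<bar> \<le> int M" for \<xi> \<eta>
  define R2 where "R2 \<xi> \<eta> \<longleftrightarrow> \<xi> = 0 \<or> \<eta> = 0" for \<xi> \<eta> :: "int \<times> int"
  define R3 where "R3 \<xi> \<eta> \<longleftrightarrow> B \<xi> \<eta> = 0 \<and> \<xi> \<noteq> 0 \<and> \<eta> \<noteq> 0" for \<xi> \<eta>
  have g0: "0 \<le> quad_prod f p" for p by (simp add: quad_prod_def f case_prod_unfold)
  have 1: "(\<Sum>p\<in>quads (freq_box N) R1. quad_prod f p) \<le> 2 * real (6 * M) * (\<Sum>x\<in>freq_box N. f x ^ 2) ^ 2"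
  proof (rule quad_sum_le[OF finite_freq_box f(1)])
    fix x y :: "int \<times> int"
    show "card {\<eta>. sup_norm \<eta> \<le> sup_norm (y - x) \<and> R1 (y - x) \<eta>} \<le> 6 * M"
    proof (cases "y - x = 0")
      case True
      then have "{\<eta>. sup_norm \<eta> \<le> sup_norm (y - x) \<and> R1 (y - x) \<eta>} = {}" by (simp add: R1_def)
      then show ?thesis by (simp only: card.empty)
    next
      case False
      then show ?thesis unfolding R1_def by (rule card_bform_nonzero_le[OF ab_nonzero])
    qed
  qed (simp add: R1_def bform_commute)
  have 2: "(\<Sum>p\<in>quads (freq_box N) R2. quad_prod f p) \<le> 2 * real 1 * (\<Sum>x\<in>freq_box N. f x ^ 2) ^ 2"
  proof (rule quad_sum_le[OF finite_freq_box f(1)])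
    fix x y :: "int \<times> int"
    have "{\<eta>. sup_norm \<eta> \<le> sup_norm (y - x) \<and> R2 (y - x) \<eta>} \<subseteq> {0}"
    proof
      fix \<eta> assume "\<eta> \<in> {\<eta>. sup_norm \<eta> \<le> sup_norm (y - x) \<and> R2 (y - x) \<eta>}"
      then have "sup_norm \<eta> \<le> 0 \<or> \<eta> = 0" by (auto simp: R2_def)
      then show "\<eta> \<in> {0}" by (simp add: sup_norm_le_0_iff)
    qed
    then have "card {\<eta>. sup_norm \<eta> \<le> sup_norm (y - x) \<and> R2 (y - x) \<eta>} \<le> card {0 :: int \<times> int}"
      by (intro card_mono) simp_all
    then show "card {\<eta>. sup_norm \<eta> \<le> sup_norm (y - x) \<and> R2 (y - x) \<eta>} \<le> 1" by simp
  qed (auto simp: R2_def)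
  have 3: "(\<Sum>p\<in>quads (freq_box N) R3. quad_prod f p) \<le> 2 ^ 76 * real J * (\<Sum>x\<in>freq_box N. f x ^ 2) ^ 2"
  proof -
    have "(\<Sum>p\<in>quads (freq_box N) R3. quad_prod f p) = (\<Sum>p\<in>rects. quad_prod f p)"
    proof (rule sum.mono_neutral_right[OF finite_quads[OF finite_freq_box]])
      show "rects \<subseteq> quads (freq_box N) R3"
      proof
        fix p assume p: "p \<in> rects"
        obtain x \<xi> \<eta> where pe: "p = (x, \<xi>, \<eta>)" by (cases p)
        have sub: "z \<in> freq_box N" if "z \<in> S" for z using that by (simp add: S_def)
        then show "p \<in> quads (freq_box N) R3"
          using p D_nonzero[of \<xi>] D_nonzero[of \<eta>] by (simp add: pe rects_iff quads_iff R3_def sub)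
      qed
      show "\<forall>p\<in>quads (freq_box N) R3 - rects. quad_prod f p = 0"
      proof (rule ballI, rule ccontr)
        fix p assume p: "p \<in> quads (freq_box N) R3 - rects" and nz: "quad_prod f p \<noteq> 0"
        obtain x \<xi> \<eta> where pe: "p = (x, \<xi>, \<eta>)" by (cases p)
        have "f x \<noteq> 0" "f (x + \<xi>) \<noteq> 0" "f (x + \<eta>) \<noteq> 0" "f (x + \<xi> + \<eta>) \<noteq> 0"
          using nz by (simp_all add: pe quad_prod_def)
        then have S: "x \<in> S" "x + \<xi> \<in> S" "x + \<eta> \<in> S" "x + \<xi> + \<eta> \<in> S" using f_zero by blast+
        have "\<xi> \<noteq> 0" "\<eta> \<noteq> 0" "B \<xi> \<eta> = 0" using p by (simp_all add: pe quads_iff R3_def)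
        moreover from this have "\<xi> \<in> D" "\<eta> \<in> D"
          using diff_in_D[OF S(1,2)] diff_in_D[OF S(1,3)] by simp_all
        ultimately have "p \<in> rects" using S by (simp add: pe rects_iff)
        with p show False by simp
      qed
    qed
    also have "\<dots> = rect_form (\<lambda>\<xi>. f)"
      unfolding quad_prod_def by (rule rect_form_eq_rects[symmetric]) (rule f_zero)
    also have "\<dots> \<le> 2 ^ 76 * real J * mass ^ 2"
    proof (rule rectangle_bound[OF _ J(2)])
      have "card S \<le> card (freq_box N)" by (rule card_mono[OF finite_freq_box]) (auto simp: S_def)
      with J(1) show "card S < 2 ^ J" by linarith
    qed
    finally show ?thesis by (simp add: mass)
  qed
  have "(\<Sum>p\<in>quads (freq_box N) (\<lambda>\<xi> \<eta>. \<bar>B \<xi> \<eta>\<bar> \<le> int M). quad_prod f p) \<le>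
      (\<Sum>p\<in>quads (freq_box N) R1 \<union> (quads (freq_box N) R2 \<union> quads (freq_box N) R3). quad_prod f p)"
  proof (rule sum_mono2)
    show "quads (freq_box N) (\<lambda>\<xi> \<eta>. \<bar>B \<xi> \<eta>\<bar> \<le> int M) \<subseteq> quads (freq_box N) R1 \<union> (quads (freq_box N) R2 \<union> quads (freq_box N) R3)"
    proof
      fix p assume p: "p \<in> quads (freq_box N) (\<lambda>\<xi> \<eta>. \<bar>B \<xi> \<eta>\<bar> \<le> int M)"
      obtain x \<xi> \<eta> where pe: "p = (x, \<xi>, \<eta>)" by (cases p)
      from p show "p \<in> quads (freq_box N) R1 \<union> (quads (freq_box N) R2 \<union> quads (freq_box N) R3)"
        unfolding pe Un_iff quads_iff R1_def R2_def R3_def by blast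
    qed
  qed (simp_all add: finite_quads finite_freq_box g0)
  also have "\<dots> \<le> (\<Sum>p\<in>quads (freq_box N) R1. quad_prod f p) +
      ((\<Sum>p\<in>quads (freq_box N) R2. quad_prod f p) + (\<Sum>p\<in>quads (freq_box N) R3. quad_prod f p))"
  proof -
    have un: "(\<Sum>p\<in>X \<union> Y. quad_prod f p) \<le> (\<Sum>p\<in>X. quad_prod f p) + (\<Sum>p\<in>Y. quad_prod f p)"
      if "finite X" "finite Y" for X Y
      using sum.union_inter[OF that, of "quad_prod f"] sum_nonneg[of "X \<inter> Y" "quad_prod f"] g0 by simp
    show ?thesis
      using un[of "quads (freq_box N) R1" "quads (freq_box N) R2 \<union> quads (freq_box N) R3"]
        un[of "quads (freq_box N) R2" "quads (freq_box N) R3"] by (simp add: finite_quads finite_freq_box)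
  qed
  finally show ?thesis using 1 2 3 by (simp add: algebra_simps)
qed

section \<open>From resonances to the Strichartz estimate\<close>

lemma lebesgue_on_borel:
  fixes F :: "'a::euclidean_space \<Rightarrow> 'b::{banach, second_countable_topology}"
  assumes A: "A \<in> sets borel" and F: "F \<in> borel_measurable borel"
  shows integrable_lebesgue_on_borel: "integrable (lebesgue_on A) F \<longleftrightarrow> integrable lborel (\<lambda>x. indicator A x *\<^sub>R F x)"
    and integral_lebesgue_on_borel: "(LINT x|lebesgue_on A. F x) = (LINT x|lborel. indicator A x *\<^sub>R F x)"
proof -
  show "integrable (lebesgue_on A) F \<longleftrightarrow> integrable lborel (\<lambda>x. indicator A x *\<^sub>R F x)"
    using A F by (subst integrable_restrict_space) (auto simp: integrable_completion)
  show "(LINT x|lebesgue_on A. F x) = (LINT x|lborel. indicator A x *\<^sub>R F x)"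
    using A F by (subst integral_restrict_space) (auto simp: integral_completion)
qed

section \<open>Orthogonality of characters in space and time\<close>

definition space_time_char :: "int \<Rightarrow> int \<times> int \<Rightarrow> real \<times> (real \<times> real) \<Rightarrow> complex"
  where "space_time_char n k p = cis (real_of_int n * fst p) * fourier_char k (snd p)"

definition cell :: "(real \<times> (real \<times> real)) set"
  where "cell = {0..<2 * pi} \<times> torus_domain"

lemma cell_borel [measurable]: "cell \<in> sets borel"
  unfolding cell_def by (intro borel_Times) simp_all

lemma space_time_char:
  shows integrable_space_time_char: "integrable lborel (\<lambda>p. indicator cell p *\<^sub>R space_time_char n k p)"
    and integral_space_time_char: "(LINT p|lborel. indicator cell p *\<^sub>R space_time_char n k p) =
      (if n = 0 \<and> k = 0 then (2 * pi) ^ 3 else 0)"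
proof -
  define g where "g t = indicator {0..<2 * pi} t *\<^sub>R cis (real_of_int n * t)" for t
  define h where "h x = indicator torus_domain x *\<^sub>R fourier_char k x" for x
  have eq: "indicator cell p *\<^sub>R space_time_char n k p = g (fst p) * h (snd p)" for p
    by (cases p) (auto simp: g_def h_def cell_def space_time_char_def indicator_def)
  have g: "integrable lborel g" unfolding g_def by (rule integrable_cis_interval)
  have h: "integrable lborel h"
    unfolding h_def using integrable_fourier_char integrable_torus_iff[OF fourier_char_measurable] by blast
  have int_g: "(LINT t|lborel. g t) = (if n = 0 then 2 * pi else 0)"
    unfolding g_def by (rule integral_cis_interval)
  have int_h: "(LINT x|lborel. h x) = (if k = 0 then (2 * pi)\<^sup>2 else 0)"
    unfolding h_def using integral_fourier_char[of k] integral_torus[OF fourier_char_measurable, of k] by simp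
  have int: "integrable (lborel \<Otimes>\<^sub>M lborel) (\<lambda>p. g (fst p) * h (snd p))"
    using lborel_pair.Fubini_integrable[of "\<lambda>p. g (fst p) * h (snd p)"]
      borel_measurable_integrable[OF g] borel_measurable_integrable[OF h] g h
    by (simp add: norm_mult)
  show "integrable lborel (\<lambda>p. indicator cell p *\<^sub>R space_time_char n k p)"
    using int by (simp add: eq lborel_prod)
  have "(LINT p|lborel. indicator cell p *\<^sub>R space_time_char n k p) =
      (LINT p|(lborel \<Otimes>\<^sub>M lborel). g (fst p) * h (snd p))"
    by (simp add: eq lborel_prod)
  also have "\<dots> = (LINT x|lborel. (LINT t|lborel. g t * h x))"
    using lborel_pair.integral_snd[of "\<lambda>t x. g t * h x"] int by (simp add: case_prod_unfold)
  also have "\<dots> = (LINT t|lborel. g t) * (LINT x|lborel. h x)" by simp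
  finally show "(LINT p|lborel. indicator cell p *\<^sub>R space_time_char n k p) =
      (if n = 0 \<and> k = 0 then (2 * pi) ^ 3 else 0)"
    by (auto simp: int_g int_h power2_eq_square power3_eq_cube)
qed

lemma space_time_char_mult_cnj:
  "space_time_char n k p * cnj (space_time_char m l p) = space_time_char (n - m) (k - l) p"
proof -
  have "space_time_char n k p * cnj (space_time_char m l p) =
      (cis (real_of_int n * fst p) * cnj (cis (real_of_int m * fst p))) *
      (fourier_char k (snd p) * cnj (fourier_char l (snd p)))"
    by (simp add: space_time_char_def)
  also have "\<dots> = space_time_char (n - m) (k - l) p"
    unfolding fourier_char_mult_cnj by (simp add: space_time_char_def cis_cnj cis_mult algebra_simps)
  finally show ?thesis .
qed

text \<open>Different indices may carry the same frequency; orthogonality then leaves all pairs of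
  indices with equal frequencies, and these are the resonances.\<close>

lemma integral_norm_trig_sum_le:
  fixes d :: "'i \<Rightarrow> complex" and n :: "'i \<Rightarrow> int" and k :: "'i \<Rightarrow> int \<times> int"
  assumes I: "finite I"
  defines "v \<equiv> \<lambda>p. \<Sum>i\<in>I. d i * space_time_char (n i) (k i) p"
  shows "integrable lborel (\<lambda>p. indicator cell p * (norm (v p))\<^sup>2)"
    and "(LINT p|lborel. indicator cell p * (norm (v p))\<^sup>2) \<le>
      (2 * pi) ^ 3 * (\<Sum>i\<in>I. \<Sum>j\<in>I. if n i = n j \<and> k i = k j then norm (d i) * norm (d j) else 0)"
proof -
  define G where "G p = (\<Sum>i\<in>I. \<Sum>j\<in>I. (d i * cnj (d j)) * (indicator cell p *\<^sub>R space_time_char (n i - n j) (k i - k j) p))" for p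
  have G_eq: "G p = complex_of_real (indicator cell p * (norm (v p))\<^sup>2)" for p
  proof -
    have "G p = (\<Sum>i\<in>I. \<Sum>j\<in>I. indicator cell p *\<^sub>R ((d i * space_time_char (n i) (k i) p) * cnj (d j * space_time_char (n j) (k j) p)))"
      unfolding G_def space_time_char_mult_cnj[symmetric] by (simp add: scaleR_conv_of_real ac_simps)
    also have "\<dots> = indicator cell p *\<^sub>R (v p * cnj (v p))"
      unfolding v_def cnj_sum sum_product scaleR_sum_right ..
    also have "\<dots> = complex_of_real (indicator cell p * (norm (v p))\<^sup>2)"
      unfolding complex_norm_square[symmetric] by (simp add: scaleR_conv_of_real)
    finally show ?thesis .
  qed
  have intG: "integrable lborel G"
    unfolding G_def by (intro Bochner_Integration.integrable_sum integrable_mult_right integrable_space_time_char)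
  have eqG: "G = (\<lambda>p. complex_of_real (indicator cell p * (norm (v p))\<^sup>2))" using G_eq by auto
  show "integrable lborel (\<lambda>p. indicator cell p * (norm (v p))\<^sup>2)"
    using intG unfolding eqG by (simp only: complex_of_real_integrable_eq)
  have "complex_of_real (LINT p|lborel. indicator cell p * (norm (v p))\<^sup>2) = (LINT p|lborel. G p)"
    unfolding eqG by (rule integral_complex_of_real[symmetric])
  also have "\<dots> = (\<Sum>i\<in>I. \<Sum>j\<in>I. (d i * cnj (d j)) * (LINT p|lborel. indicator cell p *\<^sub>R space_time_char (n i - n j) (k i - k j) p))"
  proof -
    have int1: "integrable lborel (\<lambda>p. (d i * cnj (d j)) * (indicator cell p *\<^sub>R space_time_char (n i - n j) (k i - k j) p))" for i j
      by (rule integrable_mult_right[OF integrable_space_time_char])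
    show ?thesis
      unfolding G_def Bochner_Integration.integral_sum[OF Bochner_Integration.integrable_sum[OF int1]]
        Bochner_Integration.integral_sum[OF int1] integral_mult_right_zero ..
  qed
  also have "\<dots> = (\<Sum>i\<in>I. \<Sum>j\<in>I. (d i * cnj (d j)) * (if n i = n j \<and> k i = k j then (2 * pi) ^ 3 else 0))"
    unfolding integral_space_time_char by simp
  finally have eq: "complex_of_real (LINT p|lborel. indicator cell p * (norm (v p))\<^sup>2) = \<dots>" .
  have "(LINT p|lborel. indicator cell p * (norm (v p))\<^sup>2) \<le>
      norm (complex_of_real (LINT p|lborel. indicator cell p * (norm (v p))\<^sup>2))" by simp
  also have "\<dots> \<le> (\<Sum>i\<in>I. \<Sum>j\<in>I. norm ((d i * cnj (d j)) * (if n i = n j \<and> k i = k j then (2 * pi) ^ 3 else 0)))"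
    unfolding eq by (rule order_trans[OF norm_sum sum_mono[OF norm_sum]])
  also have "\<dots> = (2 * pi) ^ 3 * (\<Sum>i\<in>I. \<Sum>j\<in>I. if n i = n j \<and> k i = k j then norm (d i) * norm (d j) else 0)"
    unfolding sum_distrib_left
    by (rule sum.cong[OF refl], rule sum.cong[OF refl]) (simp add: norm_mult norm_power)
  finally show "(LINT p|lborel. indicator cell p * (norm (v p))\<^sup>2) \<le>
      (2 * pi) ^ 3 * (\<Sum>i\<in>I. \<Sum>j\<in>I. if n i = n j \<and> k i = k j then norm (d i) * norm (d j) else 0)" .
qed

text \<open>All phases stay below 1, hence below pi / 3, so each term has real part at least 1 /
  2.\<close>

lemma Dirichlet_sum_ge:
  assumes "0 < M" "0 \<le> t" "t \<le> 1 / real M"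
  shows "real M / 2 \<le> norm (\<Sum>j<M. cis (real j * t))"
proof -
  have "real M / 2 = (\<Sum>j<M. 1 / 2 :: real)" by simp
  also have "\<dots> \<le> (\<Sum>j<M. Re (cis (real j * t)))"
  proof (rule sum_mono)
    fix j assume "j \<in> {..<M}"
    then have "real j * t \<le> real M * (1 / real M)"
      using assms by (intro mult_mono) auto
    then have "real j * t \<le> pi / 3" using assms(1) pi_gt3 by simp
    then have "cos (pi / 3) \<le> cos (real j * t)"
      using assms(2) by (intro cos_monotone_0_pi_le) auto
    then show "1 / 2 \<le> Re (cis (real j * t))" by (simp add: cos_60)
  qed
  also have "\<dots> = Re (\<Sum>j<M. cis (real j * t))" by simp
  also have "\<dots> \<le> norm (\<Sum>j<M. cis (real j * t))" by (rule complex_Re_le_cmod)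
  finally show ?thesis .
qed

section \<open>Resonances of the wave\<close>

definition qform :: "int \<Rightarrow> int \<Rightarrow> int \<times> int \<Rightarrow> int"
  where "qform a b k = a * (fst k)\<^sup>2 + b * (snd k)\<^sup>2"

definition wave :: "int \<Rightarrow> int \<Rightarrow> nat \<Rightarrow> (int \<times> int \<Rightarrow> complex) \<Rightarrow> real \<times> (real \<times> real) \<Rightarrow> complex"
  where "wave a b N c p = (\<Sum>k\<in>freq_box N. c k * space_time_char (- qform a b k) k p)"

lemma space_time_char_add:
  "space_time_char n k p * space_time_char m l p = space_time_char (n + m) (k + l) p"
  by (simp add: space_time_char_def fourier_char_def cis_mult algebra_simps)

lemma card_diff_eq_le:
  fixes \<tau> :: int
  shows "card {q \<in> {..<M} \<times> {..<M}. int (fst q) - int (snd q) = \<tau>} \<le> (if \<bar>\<tau>\<bar> < int M then M else 0)"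
proof (cases "\<bar>\<tau>\<bar> < int M")
  case True
  have "card {q \<in> {..<M} \<times> {..<M}. int (fst q) - int (snd q) = \<tau>} \<le> card {..<M}"
    by (rule card_inj_on_le[where f = snd]) (auto simp: inj_on_def)
  with True show ?thesis by simp
next
  case False
  then have "{q \<in> {..<M} \<times> {..<M}. int (fst q) - int (snd q) = \<tau>} = {}" by auto
  then have "card {q \<in> {..<M} \<times> {..<M}. int (fst q) - int (snd q) = \<tau>} = 0" by (simp only: card.empty)
  then show ?thesis by linarith
qed

lemma qform_parallelogram:
  "qform a b x + qform a b (x + \<xi> + \<eta>) - (qform a b (x + \<xi>) + qform a b (x + \<eta>)) = 2 * bform a b \<xi> \<eta>"
  by (simp add: qform_def bform_def power2_eq_square algebra_simps)

text \<open>Equal space-time frequencies mean that two pairs of lattice points have equal sums and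
  values \<open>Q\<close> differing by less than \<open>M\<close>; at most \<open>M\<close> pairs of
  Dirichlet indices realise a given difference. Pairs with equal sums are the diagonals of a
  parallelogram, and the difference of \<open>Q\<close> is twice the form on its sides.\<close>

lemma resonance_sum_le:
  fixes e :: "int \<times> int \<Rightarrow> real" and M :: nat and a b :: int
  assumes X: "finite X" and e: "\<And>x. 0 \<le> e x"
  defines "I \<equiv> {..<M} \<times> X \<times> X"
  defines "n \<equiv> \<lambda>i. int (fst i) - (qform a b (fst (snd i)) + qform a b (snd (snd i)))"
  defines "k \<equiv> \<lambda>i. fst (snd i) + snd (snd i)"
  defines "d \<equiv> \<lambda>i. e (fst (snd i)) * e (snd (snd i))"
  shows "(\<Sum>i\<in>I. \<Sum>j\<in>I. if n i = n j \<and> k i = k j then d i * d j else 0) \<le>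
    real M * (\<Sum>p\<in>quads X (\<lambda>\<xi> \<eta>. \<bar>bform a b \<xi> \<eta>\<bar> \<le> int M). quad_prod e p)"
proof -
  define W where "W = X \<times> X"
  define Q where "Q w = qform a b (fst w) + qform a b (snd w)" for w
  define s where "s w = fst w + snd w" for w :: "(int \<times> int) \<times> (int \<times> int)"
  define E where "E w = e (fst w) * e (snd w)" for w
  define Z where "Z = {p \<in> W \<times> W. s (fst p) = s (snd p) \<and> \<bar>Q (fst p) - Q (snd p)\<bar> < int M}"
  have finW: "finite W" using X by (simp add: W_def)
  have E0: "0 \<le> E w" for w by (simp add: E_def e)
  have "(\<Sum>i\<in>I. \<Sum>j\<in>I. if n i = n j \<and> k i = k j then d i * d j else 0) =
      (\<Sum>i\<in>{..<M}. \<Sum>w\<in>W. \<Sum>j\<in>{..<M}. \<Sum>w'\<in>W. if int i - Q w = int j - Q w' \<and> s w = s w' then E w * E w' else 0)"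
    unfolding I_def W_def[symmetric] n_def k_def d_def
    by (simp add: sum.cartesian_product' Q_def s_def E_def cong: if_cong)
  also have "\<dots> = (\<Sum>w\<in>W. \<Sum>i\<in>{..<M}. \<Sum>w'\<in>W. \<Sum>j\<in>{..<M}. if int i - Q w = int j - Q w' \<and> s w = s w' then E w * E w' else 0)"
    by (subst sum.swap) (rule sum.cong[OF refl], rule sum.cong[OF refl], rule sum.swap)
  also have "\<dots> = (\<Sum>w\<in>W. \<Sum>w'\<in>W. \<Sum>i\<in>{..<M}. \<Sum>j\<in>{..<M}. if int i - Q w = int j - Q w' \<and> s w = s w' then E w * E w' else 0)"
    by (rule sum.cong[OF refl]) (rule sum.swap)
  also have "\<dots> \<le> (\<Sum>w\<in>W. \<Sum>w'\<in>W. if s w = s w' \<and> \<bar>Q w - Q w'\<bar> < int M then real M * (E w * E w') else 0)"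
  proof (rule sum_mono, rule sum_mono)
    fix w w'
    show "(\<Sum>i\<in>{..<M}. \<Sum>j\<in>{..<M}. if int i - Q w = int j - Q w' \<and> s w = s w' then E w * E w' else 0) \<le>
        (if s w = s w' \<and> \<bar>Q w - Q w'\<bar> < int M then real M * (E w * E w') else 0)"
    proof (cases "s w = s w'")
      case True
      have "(\<Sum>i\<in>{..<M}. \<Sum>j\<in>{..<M}. if int i - Q w = int j - Q w' \<and> s w = s w' then E w * E w' else 0) =
          (\<Sum>q\<in>{..<M} \<times> {..<M}. if int (fst q) - int (snd q) = Q w - Q w' then E w * E w' else 0)"
        unfolding sum.cartesian_product case_prod_unfold
      proof (rule sum.cong[OF refl])
        fix q
        have "int (fst q) - Q w = int (snd q) - Q w' \<longleftrightarrow> int (fst q) - int (snd q) = Q w - Q w'" by linarith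
        then show "(if int (fst q) - Q w = int (snd q) - Q w' \<and> s w = s w' then E w * E w' else 0) =
            (if int (fst q) - int (snd q) = Q w - Q w' then E w * E w' else 0)" using True by simp
      qed
      also have "\<dots> = real (card {q \<in> {..<M} \<times> {..<M}. int (fst q) - int (snd q) = Q w - Q w'}) * (E w * E w')"
        by (simp add: sum.If_cases Int_def)
      also have "\<dots> \<le> real (if \<bar>Q w - Q w'\<bar> < int M then M else 0) * (E w * E w')"
        by (rule mult_right_mono[OF of_nat_mono[OF card_diff_eq_le]]) (simp add: E0)
      finally show ?thesis using True by (cases "\<bar>Q w - Q w'\<bar> < int M") simp_all
    qed simp
  qed
  also have "\<dots> = (\<Sum>p\<in>W \<times> W. if s (fst p) = s (snd p) \<and> \<bar>Q (fst p) - Q (snd p)\<bar> < int M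
      then real M * (E (fst p) * E (snd p)) else 0)"
    by (simp add: sum.cartesian_product case_prod_unfold)
  also have "\<dots> = (\<Sum>p\<in>Z. real M * (E (fst p) * E (snd p)))"
    unfolding Z_def by (rule sum.inter_filter[symmetric]) (simp add: finW)
  also have "\<dots> = real M * (\<Sum>p\<in>Z. E (fst p) * E (snd p))" by (rule sum_distrib_left[symmetric])
  also have "\<dots> \<le> real M * (\<Sum>p\<in>quads X (\<lambda>\<xi> \<eta>. \<bar>bform a b \<xi> \<eta>\<bar> \<le> int M). quad_prod e p)"
  proof (rule mult_left_mono)
    \<comment> \<open>The first pair becomes the diagonal from x to x + \<xi> + \<eta>, the second
      the diagonal from x + \<xi> to x + \<eta>; equality of the sums restores the fourth
      corner.\<close>
    define \<phi> where "\<phi> p = (fst (fst p), fst (snd p) - fst (fst p), snd (snd p) - fst (fst p))"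
      for p :: "((int \<times> int) \<times> (int \<times> int)) \<times> ((int \<times> int) \<times> (int \<times> int))"
    have Z: "fst (fst p) + (fst (snd p) - fst (fst p)) + (snd (snd p) - fst (fst p)) = snd (fst p)" if "p \<in> Z" for p
    proof -
      have "fst (fst p) + snd (fst p) = fst (snd p) + snd (snd p)" using that by (simp add: Z_def s_def)
      then have "snd (fst p) = fst (snd p) + snd (snd p) - fst (fst p)" by (metis add_diff_cancel_left')
      then show ?thesis by simp
    qed
    have inj: "inj_on \<phi> Z"
    proof (rule inj_onI)
      fix p q assume pq: "p \<in> Z" "q \<in> Z" "\<phi> p = \<phi> q"
      have "fst (fst p) = fst (fst q)" using pq(3) by (simp add: \<phi>_def)
      moreover from this have "fst (snd p) = fst (snd q)" "snd (snd p) = snd (snd q)"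
        using pq(3) by (simp_all add: \<phi>_def)
      moreover from calculation have "snd (fst p) = snd (fst q)" using Z[OF pq(1)] Z[OF pq(2)] by simp
      ultimately show "p = q" by (simp add: prod_eq_iff)
    qed
    have "(\<Sum>p\<in>Z. E (fst p) * E (snd p)) = (\<Sum>p\<in>Z. quad_prod e (\<phi> p))"
    proof (rule sum.cong[OF refl])
      fix p assume "p \<in> Z"
      from Z[OF this] show "E (fst p) * E (snd p) = quad_prod e (\<phi> p)"
        by (simp only: quad_prod_def \<phi>_def E_def prod.case) (simp add: ac_simps)
    qed
    also have "\<dots> = (\<Sum>p\<in>\<phi> ` Z. quad_prod e p)" by (simp add: sum.reindex[OF inj])
    also have "\<dots> \<le> (\<Sum>p\<in>quads X (\<lambda>\<xi> \<eta>. \<bar>bform a b \<xi> \<eta>\<bar> \<le> int M). quad_prod e p)"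
    proof (rule sum_mono2[OF finite_quads[OF X]])
      show "\<phi> ` Z \<subseteq> quads X (\<lambda>\<xi> \<eta>. \<bar>bform a b \<xi> \<eta>\<bar> \<le> int M)"
      proof (rule image_subsetI)
        fix p assume p: "p \<in> Z"
        define x \<xi> \<eta> where "x = fst (fst p)" and "\<xi> = fst (snd p) - fst (fst p)" and "\<eta> = snd (snd p) - fst (fst p)"
        have pts: "fst (snd p) = x + \<xi>" "snd (snd p) = x + \<eta>" "snd (fst p) = x + \<xi> + \<eta>"
          using Z[OF p] by (simp_all add: x_def \<xi>_def \<eta>_def)
        have "Q (fst p) - Q (snd p) = 2 * bform a b \<xi> \<eta>"
          unfolding Q_def pts x_def[symmetric] by (rule qform_parallelogram)
        moreover have "\<bar>Q (fst p) - Q (snd p)\<bar> < int M" using p by (simp add: Z_def)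
        ultimately have "\<bar>bform a b \<xi> \<eta>\<bar> \<le> int M" by linarith
        moreover have "x \<in> X" "x + \<xi> \<in> X" "x + \<eta> \<in> X" "x + \<xi> + \<eta> \<in> X"
          using p unfolding pts(3)[symmetric] unfolding pts(1,2)[symmetric] by (simp_all add: Z_def W_def mem_Times_iff x_def)
        ultimately show "\<phi> p \<in> quads X (\<lambda>\<xi> \<eta>. \<bar>bform a b \<xi> \<eta>\<bar> \<le> int M)"
          by (simp add: \<phi>_def quads_iff x_def \<xi>_def \<eta>_def)
      qed
    qed (simp add: quad_prod_def e case_prod_unfold)
    finally show "(\<Sum>p\<in>Z. E (fst p) * E (snd p)) \<le> (\<Sum>p\<in>quads X (\<lambda>\<xi> \<eta>. \<bar>bform a b \<xi> \<eta>\<bar> \<le> int M). quad_prod e p)" .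
  qed simp
  finally show ?thesis .
qed

text \<open>Multiplying the square of the wave by a Dirichlet sum in time localises it to the frequencies
  \<^term>\<open>\<bar>bform a b \<xi> \<eta>\<bar> \<le> int M\<close>, while the Dirichlet sum is comparable to \<^term>\<open>M\<close> on the short
  time interval.\<close>

lemma integral_wave_le:
  assumes M: "0 < M" and T: "0 \<le> T" "T \<le> 1 / real M"
  shows "(LINT p|lborel. indicator ({0..T} \<times> torus_domain) p * norm (wave a b N c p) ^ 4) \<le>
    32 * pi ^ 3 / real M * (\<Sum>p\<in>quads (freq_box N) (\<lambda>\<xi> \<eta>. \<bar>bform a b \<xi> \<eta>\<bar> \<le> int M). quad_prod (\<lambda>k. norm (c k)) p)"
proof -
  define X where "X = freq_box N"
  define I where "I = {..<M} \<times> X \<times> X"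
  define d where "d i = c (fst (snd i)) * c (snd (snd i))" for i :: "nat \<times> (int \<times> int) \<times> (int \<times> int)"
  define n where "n i = int (fst i) - (qform a b (fst (snd i)) + qform a b (snd (snd i)))"
    for i :: "nat \<times> (int \<times> int) \<times> (int \<times> int)"
  define k where "k i = fst (snd i) + snd (snd i)" for i :: "nat \<times> (int \<times> int) \<times> (int \<times> int)"
  define v where "v p = (\<Sum>i\<in>I. d i * space_time_char (n i) (k i) p)" for p
  have finX: "finite X" by (simp add: X_def)
  then have finI: "finite I" by (simp add: I_def)
  have v_eq: "v p = (\<Sum>j<M. cis (real j * fst p)) * (wave a b N c p)\<^sup>2" for p
  proof -
    have char0: "cis (real j * fst p) = space_time_char (int j) 0 p" for j
      by (simp add: space_time_char_def fourier_char_def)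
    define u where "u x = c x * space_time_char (- qform a b x) x p" for x
    have "(\<Sum>j<M. cis (real j * fst p)) * (wave a b N c p)\<^sup>2 = (\<Sum>j<M. space_time_char (int j) 0 p) * (\<Sum>x\<in>X. \<Sum>y\<in>X. u x * u y)"
      by (simp add: char0 wave_def u_def X_def power2_eq_square sum_product)
    also have "\<dots> = (\<Sum>j<M. \<Sum>x\<in>X. \<Sum>y\<in>X. space_time_char (int j) 0 p * (u x * u y))"
      unfolding sum_product by (simp only: sum_distrib_left)
    also have "\<dots> = (\<Sum>j<M. \<Sum>x\<in>X. \<Sum>y\<in>X. (c x * c y) * space_time_char (int j - (qform a b x + qform a b y)) (x + y) p)"
    proof (rule sum.cong[OF refl], rule sum.cong[OF refl], rule sum.cong[OF refl])
      fix j x y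
      have "space_time_char (int j) 0 p * (u x * u y) = (c x * c y) *
          (space_time_char (int j) 0 p * (space_time_char (- qform a b x) x p * space_time_char (- qform a b y) y p))"
        by (simp only: u_def ac_simps)
      also have "\<dots> = (c x * c y) * space_time_char (int j - (qform a b x + qform a b y)) (x + y) p"
      proof -
        have "int j + (- qform a b x + - qform a b y) = int j - (qform a b x + qform a b y)" by simp
        then show ?thesis unfolding space_time_char_add by (simp only: add_0_left)
      qed
      finally show "space_time_char (int j) 0 p * (u x * u y) =
        (c x * c y) * space_time_char (int j - (qform a b x + qform a b y)) (x + y) p" .
    qed
    also have "\<dots> = v p"
      unfolding v_def I_def using finX
      by (simp add: sum.cartesian_product case_prod_unfold d_def n_def k_def)
    finally show ?thesis by simp
  qed
  define Z where "Z = (\<Sum>p\<in>quads (freq_box N) (\<lambda>\<xi> \<eta>. \<bar>bform a b \<xi> \<eta>\<bar> \<le> int M). quad_prod (\<lambda>k. norm (c k)) p)"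
  have resonances: "(\<Sum>i\<in>I. \<Sum>j\<in>I. if n i = n j \<and> k i = k j then norm (d i) * norm (d j) else 0) \<le> real M * Z"
    using resonance_sum_le[OF finX, where e = "\<lambda>k. norm (c k)" and M = M and a = a and b = b]
    unfolding I_def n_def k_def d_def Z_def X_def norm_mult by simp
  note int = integral_norm_trig_sum_le[OF finI, of d n k, folded v_def]
  \<comment> \<open>The time interval has to lie inside one period, over which the characters are
    orthogonal.\<close>
  have T1: "T < 2 * pi"
  proof -
    have "1 / real M \<le> 1" using M by simp
    with T(2) pi_gt3 show ?thesis by linarith
  qed
  have "(LINT p|lborel. indicator ({0..T} \<times> torus_domain) p * norm (wave a b N c p) ^ 4) \<le>
      (LINT p|lborel. 4 / real M ^ 2 * (indicator cell p * (norm (v p))\<^sup>2))"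
  proof (rule integral_mono')
    show "integrable lborel (\<lambda>p. 4 / real M ^ 2 * (indicator cell p * (norm (v p))\<^sup>2))"
      by (rule integrable_mult_right[OF int(1)])
    fix p :: "real \<times> (real \<times> real)"
    show "0 \<le> 4 / real M ^ 2 * (indicator cell p * (norm (v p))\<^sup>2)" by simp
    show "indicator ({0..T} \<times> torus_domain) p * norm (wave a b N c p) ^ 4 \<le>
        4 / real M ^ 2 * (indicator cell p * (norm (v p))\<^sup>2)"
    proof (cases "p \<in> {0..T} \<times> torus_domain")
      case True
      then have t: "0 \<le> fst p" "fst p \<le> T" and cell: "p \<in> cell"
        using T1 by (auto simp: cell_def mem_Times_iff)
      have "(real M / 2)\<^sup>2 \<le> (norm (\<Sum>j<M. cis (real j * fst p)))\<^sup>2"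
        using t T by (intro power_mono Dirichlet_sum_ge M) auto
      then have "1 \<le> 4 / real M ^ 2 * (norm (\<Sum>j<M. cis (real j * fst p)))\<^sup>2"
        using M by (simp add: field_simps power2_eq_square)
      then have "1 * norm (wave a b N c p) ^ 4 \<le> (4 / real M ^ 2 * (norm (\<Sum>j<M. cis (real j * fst p)))\<^sup>2) * norm (wave a b N c p) ^ 4"
        by (rule mult_right_mono) simp
      also have "\<dots> = 4 / real M ^ 2 * (norm (v p))\<^sup>2"
        by (simp add: v_eq norm_mult norm_power power_mult_distrib flip: power_mult)
      finally show ?thesis using True cell by simp
    qed simp
  qed
  also have "\<dots> = 4 / real M ^ 2 * (LINT p|lborel. indicator cell p * (norm (v p))\<^sup>2)"
    by simp
  also have "\<dots> \<le> 4 / real M ^ 2 * ((2 * pi) ^ 3 *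
      (\<Sum>i\<in>I. \<Sum>j\<in>I. if n i = n j \<and> k i = k j then norm (d i) * norm (d j) else 0))"
    by (rule mult_left_mono[OF int(2)]) simp
  also have "\<dots> \<le> 4 / real M ^ 2 * ((2 * pi) ^ 3 * (real M * Z))"
    by (intro mult_left_mono resonances) simp_all
  \<comment> \<open>The constant is 4 from the lower bound \<open>M / 2\<close> on the Dirichlet sum
    times the volume \<open>(2 * pi) ^ 3\<close> of \<open>cell\<close>; one of the two factors
    \<open>1 / M\<close> cancels against the resonances.\<close>
  also have "\<dots> = 32 * pi ^ 3 / real M * Z"
    using M by (simp add: power_mult_distrib power2_eq_square)
  finally show ?thesis by (simp add: Z_def)
qed

section \<open>The propagator as a wave, its norms, and Bessel's inequality\<close>

lemma propagator_eq_wave: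
  "propagator a b t (sharp_proj N \<phi>) x = wave a b N (fourier_coeff \<phi>) (t, x)"
  unfolding propagator_sharp_proj wave_def
proof (rule sum.cong[OF refl])
  fix k
  have "- t * real_of_int (a * (fst k)\<^sup>2 + b * (snd k)\<^sup>2) = real_of_int (- qform a b k) * t"
    by (simp add: qform_def algebra_simps)
  then show "cis (- t * real_of_int (a * (fst k)\<^sup>2 + b * (snd k)\<^sup>2)) * fourier_coeff \<phi> k * fourier_char k x =
      fourier_coeff \<phi> k * space_time_char (- qform a b k) k (t, x)"
    by (simp only: space_time_char_def fst_conv snd_conv ac_simps)
qed

lemma continuous_on_wave: "continuous_on UNIV (wave a b N c)"
  unfolding wave_def space_time_char_def fourier_char_def by (intro continuous_intros)

lemma wave_measurable: "wave a b N c \<in> borel_measurable borel"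
  by (rule borel_measurable_continuous_onI[OF continuous_on_wave])

lemma wave_integrable:
  "integrable lborel (\<lambda>p. indicator ({0..T} \<times> torus_domain) p *\<^sub>R norm (wave a b N c p) ^ 4)"
proof -
  have "integrable lborel (\<lambda>p. indicator ({0..T} \<times> ({0..2 * pi} \<times> {0..2 * pi})) p *\<^sub>R norm (wave a b N c p) ^ 4)"
    by (rule borel_integrable_compact)
       (auto intro!: compact_Times continuous_intros continuous_on_subset[OF continuous_on_wave])
  then have "set_integrable lborel ({0..T} \<times> ({0..2 * pi} \<times> {0..2 * pi})) (\<lambda>p. norm (wave a b N c p) ^ 4)"
    by (simp add: set_integrable_def)
  then have "set_integrable lborel ({0..T} \<times> torus_domain) (\<lambda>p. norm (wave a b N c p) ^ 4)"
    by (rule set_integrable_subset) (auto simp: torus_domain_def intro!: borel_Times)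
  then show ?thesis by (simp add: set_integrable_def)
qed

lemma norm_powr_4: "norm z powr 4 = norm (z :: complex) ^ 4"
  using powr_realpow[of "norm z" 4] by (cases "z = 0") simp_all

lemma
  shows in_Lp_wave: "in_Lp 4 (time_torus T) (wave a b N c)"
    and Lp_norm_wave: "Lp_norm 4 (time_torus T) (wave a b N c) =
      (LINT p|lborel. indicator ({0..T} \<times> torus_domain) p * norm (wave a b N c p) ^ 4) powr (1 / 4)"
proof -
  have A: "{0..T} \<times> torus_domain \<in> sets borel" by (intro borel_Times) simp_all
  have F: "(\<lambda>p. norm (wave a b N c p) ^ 4) \<in> borel_measurable borel"
    using wave_measurable[of a b N c] by measurable
  have "wave a b N c \<in> borel_measurable (time_torus T)"
    unfolding time_torus_def
    by (intro measurable_restrict_space1 measurable_completion) (simp add: wave_measurable)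
  then show "in_Lp 4 (time_torus T) (wave a b N c)"
    unfolding in_Lp_def norm_powr_4 time_torus_def integrable_lebesgue_on_borel[OF A F]
    using wave_integrable by blast
  show "Lp_norm 4 (time_torus T) (wave a b N c) =
      (LINT p|lborel. indicator ({0..T} \<times> torus_domain) p * norm (wave a b N c p) ^ 4) powr (1 / 4)"
    unfolding Lp_norm_def norm_powr_4 time_torus_def integral_lebesgue_on_borel[OF A F] by simp
qed

lemma norm_powr_2: "norm z powr 2 = (norm (z :: complex))\<^sup>2"
  using powr_realpow[of "norm z" 2] by (cases "z = 0") simp_all

text \<open>The square of the distance from \<phi> to its partial sum \<open>P\<close> over
  \<open>A\<close> is nonnegative. The factor \<open>(2 * pi)\<^sup>2\<close> reflects the
  unnormalised measure.\<close>

lemma Bessel_inequality: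
  assumes \<phi>: "in_Lp 2 torus \<phi>" and A: "finite A"
  shows "(2 * pi)\<^sup>2 * (\<Sum>k\<in>A. (norm (fourier_coeff \<phi> k))\<^sup>2) \<le> (LINT x|torus. norm (\<phi> x) powr 2)"
proof -
  define c where "c = fourier_coeff \<phi>"
  define P where "P x = (\<Sum>k\<in>A. c k * fourier_char k x)" for x
  define E where "E = (\<Sum>k\<in>A. (norm (c k))\<^sup>2)"
  have meas: "\<phi> \<in> borel_measurable torus" and sq: "integrable torus (\<lambda>x. (norm (\<phi> x))\<^sup>2)"
    using \<phi> by (simp_all add: in_Lp_def norm_powr_2)
  have charm: "fourier_char k \<in> borel_measurable torus" for k
    using integrable_fourier_char by (rule borel_measurable_integrable)
  have norm_char: "norm (fourier_char k x) = 1" for k x by (simp add: fourier_char_def)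
  have one: "integrable torus (\<lambda>x. 1 :: real)"
    using integrable_norm[OF integrable_fourier_char[of 0]] by (simp add: norm_char)
  have int: "integrable torus (\<lambda>x. \<phi> x * cnj (fourier_char k x))" for k
  \<comment> \<open>On a domain of finite measure \<open>1 + (norm (\<phi> x))\<^sup>2\<close> is an
    integrable majorant of \<open>norm (\<phi> x)\<close>.\<close>
  proof (rule Bochner_Integration.integrable_bound[OF Bochner_Integration.integrable_add[OF one sq]])
    show "(\<lambda>x. \<phi> x * cnj (fourier_char k x)) \<in> borel_measurable torus"
    proof -
      have "cnj (fourier_char k x) = fourier_char (- k) x" for x
        by (simp add: fourier_char_def cis_cnj)
      then show ?thesis using borel_measurable_times[OF meas charm[of "- k"]] by simp
    qed
    show "AE x in torus. norm (\<phi> x * cnj (fourier_char k x)) \<le> norm (1 + (norm (\<phi> x))\<^sup>2)"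
    proof (rule AE_I2)
      fix x
      have "0 \<le> (norm (\<phi> x) - 1)\<^sup>2" by simp
      then have "2 * norm (\<phi> x) \<le> 1 + (norm (\<phi> x))\<^sup>2" by (simp add: power2_eq_square algebra_simps)
      then have "norm (\<phi> x) \<le> 1 + (norm (\<phi> x))\<^sup>2" using norm_ge_zero[of "\<phi> x"] by linarith
      then show "norm (\<phi> x * cnj (fourier_char k x)) \<le> norm (1 + (norm (\<phi> x))\<^sup>2)"
        by (simp add: norm_mult norm_char)
    qed
  qed
  have intP: "integrable torus (\<lambda>x. P x * cnj (fourier_char k x))" for k
    unfolding P_def sum_distrib_right mult.assoc fourier_char_mult_cnj
    by (intro Bochner_Integration.integrable_sum integrable_mult_right integrable_fourier_char)
  have coeff: "(LINT x|torus. \<phi> x * cnj (fourier_char k x)) = (2 * pi)\<^sup>2 * c k" for k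
    by (simp add: c_def fourier_coeff_def)
  have coeffP: "(LINT x|torus. P x * cnj (fourier_char k x)) = (2 * pi)\<^sup>2 * c k" if "k \<in> A" for k
    using fourier_coeff_trig_sum[OF A, of c k] that by (simp add: fourier_coeff_def P_def field_simps)
  \<comment> \<open>The inner product with \<open>P\<close> depends only on the coefficients in
    \<open>A\<close>, so \<phi> and \<open>P\<close> itself can be treated together.\<close>
  have cross: "integrable torus (\<lambda>x. u x * cnj (P x))" "(LINT x|torus. u x * cnj (P x)) = complex_of_real ((2 * pi)\<^sup>2 * E)"
    if u: "\<And>k. integrable torus (\<lambda>x. u x * cnj (fourier_char k x))"
      "\<And>k. k \<in> A \<Longrightarrow> (LINT x|torus. u x * cnj (fourier_char k x)) = (2 * pi)\<^sup>2 * c k" for u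
  proof -
    have eq: "u x * cnj (P x) = (\<Sum>k\<in>A. cnj (c k) * (u x * cnj (fourier_char k x)))" for x
      by (simp add: P_def sum_distrib_left ac_simps)
    show "integrable torus (\<lambda>x. u x * cnj (P x))"
      unfolding eq by (intro Bochner_Integration.integrable_sum integrable_mult_right u)
    have "(LINT x|torus. u x * cnj (P x)) = (\<Sum>k\<in>A. cnj (c k) * (LINT x|torus. u x * cnj (fourier_char k x)))"
      unfolding eq
      by (subst Bochner_Integration.integral_sum[OF integrable_mult_right[OF u(1)]]) simp
    also have "\<dots> = (\<Sum>k\<in>A. (2 * pi)\<^sup>2 * complex_of_real ((norm (c k))\<^sup>2))"
      by (rule sum.cong[OF refl]) (simp only: u(2) complex_norm_square ac_simps)
    also have "\<dots> = complex_of_real ((2 * pi)\<^sup>2 * E)"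
      by (simp add: E_def sum_distrib_left)
    finally show "(LINT x|torus. u x * cnj (P x)) = complex_of_real ((2 * pi)\<^sup>2 * E)" .
  qed
  note \<phi>P = cross[of \<phi>, OF int coeff] and PP = cross[of P, OF intP coeffP]
  have re1: "integrable torus (\<lambda>x. Re (\<phi> x * cnj (P x)))" "(LINT x|torus. Re (\<phi> x * cnj (P x))) = (2 * pi)\<^sup>2 * E"
  proof -
    show "integrable torus (\<lambda>x. Re (\<phi> x * cnj (P x)))" by (rule integrable_Re[OF \<phi>P(1)])
    show "(LINT x|torus. Re (\<phi> x * cnj (P x))) = (2 * pi)\<^sup>2 * E"
      using integral_Re[OF \<phi>P(1)] arg_cong[OF \<phi>P(2), of Re] by (simp only: Re_complex_of_real)
  qed
  have re2: "integrable torus (\<lambda>x. Re (P x * cnj (P x)))" "(LINT x|torus. Re (P x * cnj (P x))) = (2 * pi)\<^sup>2 * E"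
  proof -
    show "integrable torus (\<lambda>x. Re (P x * cnj (P x)))" by (rule integrable_Re[OF PP(1)])
    show "(LINT x|torus. Re (P x * cnj (P x))) = (2 * pi)\<^sup>2 * E"
      using integral_Re[OF PP(1)] arg_cong[OF PP(2), of Re] by (simp only: Re_complex_of_real)
  qed
  have expand: "(norm (\<phi> x - P x))\<^sup>2 = (norm (\<phi> x))\<^sup>2 - 2 * Re (\<phi> x * cnj (P x)) + Re (P x * cnj (P x))" for x
    unfolding cmod_power2 by (simp add: power2_eq_square algebra_simps)
  have linear: "(LINT x|torus. u x - 2 * v x + w x) = (LINT x|torus. u x) - 2 * (LINT x|torus. v x) + (LINT x|torus. w x)"
    if "integrable torus u" "integrable torus v" "integrable torus w" for u v w :: "real \<times> real \<Rightarrow> real"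
    using that by simp
  have "0 \<le> (LINT x|torus. (norm (\<phi> x - P x))\<^sup>2)" by simp
  also have "\<dots> = (LINT x|torus. (norm (\<phi> x))\<^sup>2) - 2 * ((2 * pi)\<^sup>2 * E) + (2 * pi)\<^sup>2 * E"
    unfolding expand linear[OF sq re1(1) re2(1)] re1(2) re2(2) ..
  finally show ?thesis by (simp add: E_def c_def norm_powr_2)
qed

text \<open>A zero with \<open>snd \<xi> \<noteq> 0\<close> satisfies
  \<open>(a * fst \<xi>)\<^sup>2 = - (a * b) * (snd \<xi>)\<^sup>2\<close>; then
  \<open>snd \<xi>\<close> divides \<open>a * fst \<xi>\<close>, and the quotient squares to
  \<open>- (a * b)\<close>.\<close>

lemma anisotropic_if_not_square:
  fixes a b :: int
  assumes ab: "a \<noteq> 0" "b \<noteq> 0" and sq: "\<not> (\<exists>h::int. - (a * b) = h\<^sup>2)" and zero: "bform a b \<xi> \<xi> = 0"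
  shows "\<xi> = 0"
proof (cases "snd \<xi> = 0")
  case True
  with zero ab show ?thesis by (simp add: bform_def prod_eq_iff)
next
  case False
  have eq: "(a * fst \<xi>)\<^sup>2 = - (a * b) * (snd \<xi>)\<^sup>2"
    using zero unfolding bform_def power2_eq_square by algebra
  then have "(snd \<xi>)\<^sup>2 dvd (a * fst \<xi>)\<^sup>2" by simp
  then have "snd \<xi> dvd a * fst \<xi>" by (simp add: pow_divides_pow_iff)
  then obtain h where "a * fst \<xi> = snd \<xi> * h" by (rule dvdE)
  then have "h\<^sup>2 * (snd \<xi>)\<^sup>2 = - (a * b) * (snd \<xi>)\<^sup>2"
    using eq by (simp add: power_mult_distrib mult.commute)
  then have "- (a * b) = h\<^sup>2" using False by (metis mult_right_cancel power2_eq_square mult_eq_0_iff)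
  with sq show ?thesis by blast
qed

text \<open>The factor \<open>M\<close> allowed in \<open>quad\<close> cancels the
  \<open>1 / M\<close> left by \<open>integral_wave_le\<close>, so a count with the reciprocal of
  the time scale gives a uniform constant.\<close>

lemma Strichartz_from_quad_sum:
  assumes \<phi>: "in_Lp 2 torus \<phi>" and M: "0 < M" and T: "0 \<le> T" "T \<le> 1 / real M" and C: "0 \<le> C"
    and quad: "(\<Sum>p\<in>quads (freq_box N) (\<lambda>\<xi> \<eta>. \<bar>bform a b \<xi> \<eta>\<bar> \<le> int M). quad_prod (\<lambda>k. norm (fourier_coeff \<phi> k)) p) \<le>
      C * real M * (\<Sum>k\<in>freq_box N. (norm (fourier_coeff \<phi> k))\<^sup>2)\<^sup>2"
  shows "Lp_norm 4 (time_torus T) (wave a b N (fourier_coeff \<phi>)) \<le> (32 * pi ^ 3 * C) powr (1 / 4) * Lp_norm 2 torus \<phi>"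
proof -
  define E where "E = (\<Sum>k\<in>freq_box N. (norm (fourier_coeff \<phi> k))\<^sup>2)"
  define m where "m = (LINT x|torus. norm (\<phi> x) powr 2)"
  define L where "L = (LINT p|lborel. indicator ({0..T} \<times> torus_domain) p * norm (wave a b N (fourier_coeff \<phi>) p) ^ 4)"
  have E0: "0 \<le> E" by (simp add: E_def sum_nonneg)
  have "(2 * pi)\<^sup>2 * E \<le> m" unfolding E_def m_def by (rule Bessel_inequality[OF \<phi>]) simp
  \<comment> \<open>The factor in Bessel's inequality is at least 1 and is dropped.\<close>
  moreover have "1 * E \<le> (2 * pi)\<^sup>2 * E"
    using pi_gt3 E0 by (intro mult_right_mono one_le_power) auto
  ultimately have Em: "E \<le> m" by linarith
  have "L \<le> 32 * pi ^ 3 / real M * (\<Sum>p\<in>quads (freq_box N) (\<lambda>\<xi> \<eta>. \<bar>bform a b \<xi> \<eta>\<bar> \<le> int M). quad_prod (\<lambda>k. norm (fourier_coeff \<phi> k)) p)"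
    unfolding L_def by (rule integral_wave_le[OF M T])
  also have "\<dots> \<le> 32 * pi ^ 3 / real M * (C * real M * E\<^sup>2)"
    using quad by (intro mult_left_mono) (simp_all add: E_def)
  also have "\<dots> = 32 * pi ^ 3 * C * E\<^sup>2" using M by simp
  also have "\<dots> \<le> 32 * pi ^ 3 * C * m\<^sup>2"
    using Em E0 C by (intro mult_left_mono power_mono) auto
  finally have L: "L \<le> 32 * pi ^ 3 * C * m\<^sup>2" .
  have L0: "0 \<le> L" unfolding L_def by (intro integral_nonneg_AE AE_I2) simp
  have m0: "0 \<le> m" using Em E0 by linarith
  have "L powr (1 / 4) \<le> (32 * pi ^ 3 * C * m\<^sup>2) powr (1 / 4)"
    using L L0 by (intro powr_mono2) auto
  also have "\<dots> = (32 * pi ^ 3 * C) powr (1 / 4) * (m\<^sup>2) powr (1 / 4)"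
    using C m0 by (simp add: powr_mult)
  also have "(m\<^sup>2) powr (1 / 4) = m powr (1 / 2)"
  proof (cases "m = 0")
    case False
    then have "m\<^sup>2 = m powr 2" using m0 by (simp add: powr_numeral)
    then show ?thesis by (simp add: powr_powr)
  qed simp
  finally show ?thesis 
    by (simp only: Lp_norm_wave L_def[symmetric] Lp_norm_def[of 2] m_def[symmetric])
qed

text \<open>The integer replacement \<open>M\<close> of \<open>ln N\<close> is comparable to it
  because \<open>ln N\<close> is at least 2 / 3. The last bound comes from N <= e^M <= 4^M and fixes
  the number \<open>8 * M\<close> of dyadic scales for the points of the box.\<close>

lemma ceiling_ln_bounds:
  assumes "2 \<le> N"
  defines "M \<equiv> nat \<lceil>ln (real N)\<rceil>"
  shows "0 < M" "real M \<le> 3 * ln (real N)" "(2 * N + 1)\<^sup>2 < 2 ^ (8 * M)"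
proof -
  have ln: "2 / 3 \<le> ln (real N)"
  proof -
    have "ln 2 \<le> ln (real N)" using assms(1) by simp
    with ln2_ge_two_thirds show ?thesis by linarith
  qed
  show M: "0 < M" using ln by (simp add: M_def)
  have M_eq: "real M = of_int \<lceil>ln (real N)\<rceil>" using ln by (simp add: M_def)
  then have "real M \<le> ln (real N) + 1" by linarith
  with ln show "real M \<le> 3 * ln (real N)" by linarith
  have "ln (real N) \<le> real M" unfolding M_eq by linarith
  then have "exp (ln (real N)) \<le> exp (real M)" by (simp only: exp_le_cancel_iff)
  also have "exp (real M) = exp 1 ^ M" by (simp add: exp_of_nat_mult[symmetric])
  also have "\<dots> \<le> 4 ^ M" using exp_le by (intro power_mono) auto
  finally have "real N \<le> real (4 ^ M)" using assms(1) by simp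
  then have N: "N \<le> 4 ^ M" by (simp only: of_nat_le_iff)
  have "(2 * N + 1)\<^sup>2 < (4 * N)\<^sup>2" using assms(1) by (intro power_strict_mono) auto
  also have "\<dots> \<le> (4 * 4 ^ M)\<^sup>2" using N by (intro power_mono) auto
  also have "\<dots> \<le> (4 ^ M * 4 ^ M)\<^sup>2"
  proof -
    have "(4::nat) ^ 1 \<le> 4 ^ M" using M by (intro power_increasing) auto
    then show ?thesis by (intro power_mono mult_right_mono) auto
  qed
  also have "\<dots> = (2::nat) ^ (8 * M)"
  proof -
    have "(4::nat) ^ M = 2 ^ (2 * M)" by (simp add: power_mult)
    then show ?thesis by (simp add: power2_eq_square flip: power_add)
  qed
  finally show "(2 * N + 1)\<^sup>2 < 2 ^ (8 * M)" .
qed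

lemma card_freq_box: "card (freq_box N) = (2 * N + 1)\<^sup>2"
proof -
  have "card {- int N..int N} = 2 * N + 1" by simp
  then show ?thesis by (simp add: freq_box_def card_cartesian_product power2_eq_square del: card_atLeastAtMost_int)
qed

theorem theorem1p4:
  fixes a b :: int
  assumes "a \<noteq> 0" and "b \<noteq> 0"
  shows "\<exists>c > 0. \<exists>K > 0. \<forall>N \<phi>. dyadic N \<longrightarrow> 2 \<le> N \<longrightarrow> in_Lp 2 torus \<phi> \<longrightarrow>
    in_Lp 4 (time_torus (time_scale a b c N)) (\<lambda>(t, x). propagator a b t (sharp_proj N \<phi>) x) \<and>
    Lp_norm 4 (time_torus (time_scale a b c N)) (\<lambda>(t, x). propagator a b t (sharp_proj N \<phi>) x)
      \<le> K * Lp_norm 2 torus \<phi>"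
proof -
  \<comment> \<open>The term \<open>2 ^ 80\<close> absorbs
    \<open>12 * M + 2 + 2 ^ 76 * (8 * M)\<close>, and the other summand covers
    \<open>quad_sum_box_le\<close> with \<open>M = N\<close>. The value 1 / 3 of \<open>c\<close>
    comes from \<open>real M \<le> 3 * ln (real N)\<close>.\<close>
  define C where "C = 2 ^ 80 + 2 * real (6 * nat (\<bar>a\<bar> + \<bar>b\<bar>) + 7)"
  define c :: real where "c = 1 / 3"
  define K where "K = (32 * pi ^ 3 * C) powr (1 / 4)"
  have C: "0 < C" by (simp add: C_def add_pos_nonneg)
  then have "0 < K" by (simp add: K_def)
  have eq: "(\<lambda>(t, x). propagator a b t (sharp_proj N \<phi>) x) = wave a b N (fourier_coeff \<phi>)" for N \<phi>
    by (simp add: propagator_eq_wave fun_eq_iff)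
  have main: "Lp_norm 4 (time_torus (time_scale a b c N)) (wave a b N (fourier_coeff \<phi>)) \<le> K * Lp_norm 2 torus \<phi>"
    if N: "2 \<le> N" and \<phi>: "in_Lp 2 torus \<phi>" for N \<phi>
  proof (cases "\<exists>h::int. - (a * b) = h\<^sup>2")
    case True
    define E where "E = (\<Sum>k\<in>freq_box N. (norm (fourier_coeff \<phi> k))\<^sup>2)"
    have "(\<Sum>p\<in>quads (freq_box N) (\<lambda>\<xi> \<eta>. \<bar>bform a b \<xi> \<eta>\<bar> \<le> int N). quad_prod (\<lambda>k. norm (fourier_coeff \<phi> k)) p) \<le>
        2 * real (6 * N + 6 * nat (\<bar>a\<bar> + \<bar>b\<bar>) * N + 1) * E\<^sup>2"
      unfolding E_def by (rule quad_sum_box_le[OF assms]) simp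
    also have "\<dots> \<le> C * real N * E\<^sup>2"
    proof (rule mult_right_mono)
      have "6 * N + 6 * nat (\<bar>a\<bar> + \<bar>b\<bar>) * N + 1 \<le> (6 * nat (\<bar>a\<bar> + \<bar>b\<bar>) + 7) * N"
        using N by (simp add: algebra_simps)
      then have "real (6 * N + 6 * nat (\<bar>a\<bar> + \<bar>b\<bar>) * N + 1) \<le> real ((6 * nat (\<bar>a\<bar> + \<bar>b\<bar>) + 7) * N)"
        by (rule of_nat_mono)
      then have "2 * real (6 * N + 6 * nat (\<bar>a\<bar> + \<bar>b\<bar>) * N + 1) \<le> 2 * real (6 * nat (\<bar>a\<bar> + \<bar>b\<bar>) + 7) * real N"
        by (simp only: of_nat_mult mult.assoc) simp
      also have "\<dots> \<le> C * real N" by (intro mult_right_mono) (simp_all add: C_def)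
      finally show "2 * real (6 * N + 6 * nat (\<bar>a\<bar> + \<bar>b\<bar>) * N + 1) \<le> C * real N" .
    qed simp
    finally have quad: "(\<Sum>p\<in>quads (freq_box N) (\<lambda>\<xi> \<eta>. \<bar>bform a b \<xi> \<eta>\<bar> \<le> int N). quad_prod (\<lambda>k. norm (fourier_coeff \<phi> k)) p) \<le>
        C * real N * E\<^sup>2" .
    have "time_scale a b c N = c / real N" using True by (simp add: time_scale_def)
    moreover have "c / real N \<le> 1 / real N" by (rule divide_right_mono) (simp_all add: c_def)
    moreover have "0 \<le> c / real N" by (simp add: c_def)
    ultimately have "0 \<le> time_scale a b c N" "time_scale a b c N \<le> 1 / real N" by simp_all
    then show ?thesis
      unfolding K_def using N C quad[unfolded E_def]
      by (intro Strichartz_from_quad_sum[OF \<phi>, of N]) auto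
  next
    case False
    define M where "M = nat \<lceil>ln (real N)\<rceil>"
    note M = ceiling_ln_bounds[OF N, folded M_def]
    \<comment> \<open>The coefficients are cut off outside the box, since the rectangle bound needs
      a weight with finite support.\<close>
    define f where "f k = (if k \<in> freq_box N then norm (fourier_coeff \<phi> k) else 0)" for k
    define E where "E = (\<Sum>k\<in>freq_box N. (norm (fourier_coeff \<phi> k))\<^sup>2)"
    have "(\<Sum>p\<in>quads (freq_box N) (\<lambda>\<xi> \<eta>. \<bar>bform a b \<xi> \<eta>\<bar> \<le> int M). quad_prod (\<lambda>k. norm (fourier_coeff \<phi> k)) p) =
        (\<Sum>p\<in>quads (freq_box N) (\<lambda>\<xi> \<eta>. \<bar>bform a b \<xi> \<eta>\<bar> \<le> int M). quad_prod f p)"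
      by (rule sum.cong[OF refl]) (auto simp: quads_def quad_prod_def f_def)
    also have "\<dots> \<le> (12 * real M + 2 + 2 ^ 76 * real (8 * M)) * (\<Sum>k\<in>freq_box N. f k ^ 2)\<^sup>2"
    proof (rule quad_sum_box_anisotropic_le)
      show "\<xi> = 0" if "bform a b \<xi> \<xi> = 0" for \<xi>
        using anisotropic_if_not_square[OF assms False that] .
      show "card (freq_box N) < 2 ^ (8 * M)" using M(3) by (simp add: card_freq_box)
    qed (use M(1) in \<open>auto simp: f_def\<close>)
    also have "(\<Sum>k\<in>freq_box N. f k ^ 2) = E"
      unfolding E_def by (rule sum.cong[OF refl]) (simp add: f_def)
    also have "(12 * real M + 2 + 2 ^ 76 * real (8 * M)) * E\<^sup>2 \<le> C * real M * E\<^sup>2"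
    proof (rule mult_right_mono)
      have "12 * real M + 2 + 2 ^ 76 * real (8 * M) \<le> 2 ^ 80 * real M" using M(1) by simp
      also have "\<dots> \<le> C * real M" by (intro mult_right_mono) (simp_all add: C_def)
      finally show "12 * real M + 2 + 2 ^ 76 * real (8 * M) \<le> C * real M" .
    qed simp
    finally have quad: "(\<Sum>p\<in>quads (freq_box N) (\<lambda>\<xi> \<eta>. \<bar>bform a b \<xi> \<eta>\<bar> \<le> int M). quad_prod (\<lambda>k. norm (fourier_coeff \<phi> k)) p) \<le>
        C * real M * E\<^sup>2" .
    have scale: "time_scale a b c N = c / ln (real N)" using False by (simp add: time_scale_def)
    have ln0: "0 < ln (real N)" using N by simp
    have "time_scale a b c N = 1 / (3 * ln (real N))" unfolding scale by (simp add: c_def)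
    also have "\<dots> \<le> 1 / real M" using M(1,2) by (intro divide_left_mono) auto
    finally have "time_scale a b c N \<le> 1 / real M" .
    moreover have "0 \<le> time_scale a b c N" unfolding scale using ln0 by (simp add: c_def)
    ultimately show ?thesis
      unfolding K_def using M(1) C quad[unfolded E_def]
      by (intro Strichartz_from_quad_sum[OF \<phi>, of M]) auto
  qed
  have "0 < c" by (simp add: c_def)
  then show ?thesis
    using \<open>0 < K\<close> main in_Lp_wave unfolding eq by blast
qed

end
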